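(* Let $(Z_{i,j}:i,j\in\mathbb Z)$ be a stationary Gaussian process with mean zero and variance one, and let $R(u,v):=E[Z_{0,0}Z_{-u,v}]$ for $u,v\in\mathbb Z$. Assume that $R(u,v)=R(v,u)$ for all $u,v\in\mathbb Z$ and that $\sum_{u,v\in\mathbb Z}|R(u,v)|<\infty$. For $n\ge1$ let $A_n$ be the $n\times n$ symmetric matrix whose $(i,j)$-th entry is $Z_{i\wedge j,\,i\vee j}$, let $\lambda_1\le\dots\le\lambda_n$ be its eigenvalues, and let $\mu_n:=\frac1n\sum_{i=1}^n\delta_{\lambda_i/\sqrt n}$. Then, as $n\to\infty$, $\mu_n$ converges weakly in probability to a (deterministic) probability distribution $\mu$ on $\mathbb R$. The $k$-th moment of $\mu$ is $0$ if $k$ is odd and $\beta_k$ if $k$ is even, where $\beta_{2m}$ ($m\ge1$) is the number defined from $R$ in the context. Furthermore, $\mu$ is uniquely determined by its moments, that is, any probability distribution on $\mathbb R$ having the same moments as $\mu$ equals $\mu$.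
   Context: Notation: $a\wedge b=\min(a,b)$, $a\vee b=\max(a,b)$. Stationarity means that for all $k,l\in\mathbb Z$, $(Z_{i+k,j+l}:i,j\in\mathbb Z)$ has the same distribution as $(Z_{i,j}:i,j\in\mathbb Z)$. For $m\ge1$, $NC_2(2m)$ is the set of non-crossing pair partitions of $\{1,\dots,2m\}$. For $\sigma\in NC_2(2m)$, its Kreweras complement is the maximal (coarsest) partition $\overline\sigma$ of $\{\overline1,\dots,\overline{2m}\}$ such that $\sigma\cup\overline\sigma$ is a non-crossing partition of the ordered set $1<\overline1<2<\overline2<\dots<2m<\overline{2m}$. It has $m+1$ blocks $V_1,\dots,V_{m+1}$, regarded (dropping bars) as subsets of $\{1,\dots,2m\}$. Define $$S(\sigma):=\Big\{(k_1,\dots,k_{2m})\in\mathbb Z^{2m}:\ \sum_{j\in V_s}k_j=0,\ s=1,\dots,m+1\Big\},$$ $$\beta_{2m}:=\sum_{\sigma\in NC_2(2m)}\ \sum_{k\in S(\sigma)}\ \prod_{(u,v)\in\sigma}R(k_u,k_v),\quad m\ge1,$$ where the series converges absolutely because $R$ is absolutely summable (and the order within a pair $(u,v)$ is irrelevant because $R$ is symmetric). "$\mu_n$ converges weakly in probability to $\mu$" means $L(\mu_n,\mu)\to0$ in probability, where $L$ is the Lévy distance between probability measures on $\mathbb R$: $L(\nu_1,\nu_2):=\inf\{\varepsilon>0:\nu_1((-\infty,x-\varepsilon])-\varepsilon\le\nu_2((-\infty,x])\le\nu_1((-\infty,x+\varepsilon])+\varepsilon\text{ for all }x\in\mathbb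 R\}$. *)

theory Defs
  imports "HOL-Probability.Probability" "Jordan_Normal_Form.Char_Poly"
begin

section \<open>Stationary Gaussian processes\<close>

text \<open>Degenerate normal laws (variance zero) are allowed, since linear combinations of the
  coordinates of a Gaussian process may be almost surely constant.\<close>

definition gaussian_rv :: "'a measure \<Rightarrow> ('a \<Rightarrow> real) \<Rightarrow> bool" where
  "gaussian_rv M X \<longleftrightarrow> X \<in> borel_measurable M \<and>
     (\<exists>\<mu>. (AE \<omega> in M. X \<omega> = \<mu>) \<or>
          (\<exists>\<sigma>>0. distributed M lborel X (\<lambda>x. ennreal (normal_density \<mu> \<sigma> x))))"

definition gaussian_process :: "'a measure \<Rightarrow> ('i \<Rightarrow> 'a \<Rightarrow> real) \<Rightarrow> bool" where
  "gaussian_process M X \<longleftrightarrow> (\<forall>i. X i \<in> borel_measurable M) \<and>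
     (\<forall>F c. finite F \<longrightarrow> gaussian_rv M (\<lambda>\<omega>. \<Sum>i\<in>F. c i * X i \<omega>))"

text \<open>Equality in distribution of the whole field and its shifts, as random elements of the
  product space over the index set of all pairs of integers.\<close>

definition stationary_field :: "'a measure \<Rightarrow> (int \<Rightarrow> int \<Rightarrow> 'a \<Rightarrow> real) \<Rightarrow> bool" where
  "stationary_field M Z \<longleftrightarrow>
     (\<forall>k l. distr M (PiM (UNIV :: (int \<times> int) set) (\<lambda>_. borel)) (\<lambda>\<omega> (i, j). Z (i + k) (j + l) \<omega>)
          = distr M (PiM (UNIV :: (int \<times> int) set) (\<lambda>_. borel)) (\<lambda>\<omega> (i, j). Z i j \<omega>))"

section \<open>Empirical spectral distributions\<close>

text \<open>The \<^const>\<open>mat\<close> constructor indexes from 0 while the mathematical indices run over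
  1, ..., n; hence the offset.\<close>

definition sym_field_matrix :: "(int \<Rightarrow> int \<Rightarrow> real) \<Rightarrow> nat \<Rightarrow> real mat" where
  "sym_field_matrix z n = mat n n (\<lambda>(i, j). z (int (min i j) + 1) (int (max i j) + 1))"

text \<open>The roots of the characteristic polynomial in increasing order, repeated according to
  multiplicity. For a real symmetric n by n matrix this list has length n.\<close>

definition eigenvalue_list :: "real mat \<Rightarrow> real list" where
  "eigenvalue_list A = sorted_list_of_multiset (proots (char_poly A))"

definition scaled_esd :: "nat \<Rightarrow> real mat \<Rightarrow> real measure" where
  "scaled_esd n A =
     distr (uniform_count_measure {..<n}) borel (\<lambda>i. eigenvalue_list A ! i / sqrt (real n))"

section \<open>Weak convergence in probability\<close>

definition levy_dist :: "real measure \<Rightarrow> real measure \<Rightarrow> real" where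
  "levy_dist \<nu>\<^sub>1 \<nu>\<^sub>2 = Inf {\<epsilon>. \<epsilon> > 0 \<and>
     (\<forall>x. cdf \<nu>\<^sub>1 (x - \<epsilon>) - \<epsilon> \<le> cdf \<nu>\<^sub>2 x \<and> cdf \<nu>\<^sub>2 x \<le> cdf \<nu>\<^sub>1 (x + \<epsilon>) + \<epsilon>)}"

text \<open>Measurability is part of the notion: \<^const>\<open>measure\<close> assigns 0 to non-measurable sets,
  so the limits alone would be meaningless.\<close>

definition tends_in_prob :: "'a measure \<Rightarrow> (nat \<Rightarrow> 'a \<Rightarrow> real) \<Rightarrow> real \<Rightarrow> bool" where
  "tends_in_prob M X c \<longleftrightarrow> (\<forall>n. X n \<in> borel_measurable M) \<and>
     (\<forall>\<epsilon>>0. (\<lambda>n. measure M {\<omega> \<in> space M. \<bar>X n \<omega> - c\<bar> > \<epsilon>}) \<longlonglongrightarrow> 0)"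

definition weakly_in_prob :: "'a measure \<Rightarrow> (nat \<Rightarrow> 'a \<Rightarrow> real measure) \<Rightarrow> real measure \<Rightarrow> bool" where
  "weakly_in_prob M \<mu>n \<mu> \<longleftrightarrow> tends_in_prob M (\<lambda>n \<omega>. levy_dist (\<mu>n n \<omega>) \<mu>) 0"

section \<open>Non-crossing pair partitions and Kreweras complements\<close>

definition noncrossing :: "nat set set \<Rightarrow> bool" where
  "noncrossing P \<longleftrightarrow>
     \<not> (\<exists>B\<in>P. \<exists>C\<in>P. B \<noteq> C \<and> (\<exists>a\<in>B. \<exists>b\<in>C. \<exists>c\<in>B. \<exists>d\<in>C. a < b \<and> b < c \<and> c < d))"

definition NC2 :: "nat \<Rightarrow> nat set set set" where
  "NC2 N = {\<sigma>. partition_on {1..N} \<sigma> \<and> (\<forall>B\<in>\<sigma>. card B = 2) \<and> noncrossing \<sigma>}"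

text \<open>The ordered set 1, 1', 2, 2', ..., N, N' (primes for bars) is embedded into the natural
  numbers by sending j to 2j and j' to 2j + 1.\<close>

definition interleave :: "nat set set \<Rightarrow> nat set set \<Rightarrow> nat set set" where
  "interleave \<sigma> \<tau> = (\<lambda>B. (\<lambda>j. 2 * j) ` B) ` \<sigma> \<union> (\<lambda>B. (\<lambda>j. 2 * j + 1) ` B) ` \<tau>"

text \<open>The complement is given with bars dropped. Here \<^term>\<open>refines A P Q\<close> means that P is
  finer than Q, so the complement is the greatest admissible partition.\<close>

definition kreweras :: "nat \<Rightarrow> nat set set \<Rightarrow> nat set set" where
  "kreweras N \<sigma> = (THE \<tau>. partition_on {1..N} \<tau> \<and> noncrossing (interleave \<sigma> \<tau>) \<and>
     (\<forall>\<tau>'. partition_on {1..N} \<tau>' \<and> noncrossing (interleave \<sigma> \<tau>') \<longrightarrow> refines {1..N} \<tau>' \<tau>))"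

text \<open>Integer vectors of length N are extensional functions on \<open>{1..N}\<close>.\<close>

definition S_set :: "nat \<Rightarrow> nat set set \<Rightarrow> (nat \<Rightarrow> int) set" where
  "S_set N \<sigma> = {k \<in> {1..N} \<rightarrow>\<^sub>E UNIV. \<forall>V\<in>kreweras N \<sigma>. (\<Sum>j\<in>V. k j) = 0}"

text \<open>The argument \<open>N\<close> is the (even) moment order 2m. A pair B is read as (Min B, Max B); for
  symmetric R the order is immaterial.\<close>

definition beta_moment :: "(int \<Rightarrow> int \<Rightarrow> real) \<Rightarrow> nat \<Rightarrow> real" where
  "beta_moment R N = (\<Sum>\<sigma>\<in>NC2 N. \<Sum>\<^sub>\<infinity>k\<in>S_set N \<sigma>. \<Prod>B\<in>\<sigma>. R (k (Min B)) (k (Max B)))"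

end

theory Submission
  imports Defs "Jordan_Normal_Form.Schur_Decomposition"
begin

text \<open>
  The normalised trace of the \<open>k\<close>-th power is a sum over closed walks of products of \<open>k\<close> entries;
  by Wick's formula its mean is a sum over pair partitions \<open>\<sigma>\<close> of \<open>{1..k}\<close>. A shortest
  block \<open>{u, v}\<close> of \<open>\<sigma>\<close> either joins neighbouring steps or is crossed by another block.
  In the crossed case, summing out the vertices of the walk one by one saves a factor \<open>n\<close>
  because \<open>R\<close> is summable. In the other case the walk backtracks up to a shift \<open>t\<close>, which
  contributes \<open>\<Sum>\<^sub>\<infinity>t. R t s\<close> times the same problem for \<open>\<sigma> - {{u, v}}\<close> with shifted walks;
  the series over \<open>S(\<sigma>)\<close> obeys the same recursion. Hence only non-crossing \<open>\<sigma>\<close> survive. Blocks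
  linking two closed walks also lose a factor \<open>n\<close>, so the variances vanish. Since there are at most
  \<open>2 ^ (2 * m)\<close> non-crossing pair partitions, the limiting moments grow at most geometrically:
  the limit has compact support, is determined by its moments, and moment convergence implies weak
  convergence.
\<close>

section \<open>Pair partitions\<close>

text \<open>Removing a block {u, v} of neighbours does not leave a closed walk: with
  \<open>p = cyc_pred V u\<close>, the vertex \<open>x v\<close>, which takes over from
  \<open>x p\<close>, may differ from it by any integer. So the induction runs over walks with a
  prescribed jump \<open>r l\<close> behind every vertex l, and the limit is a series over labels
  whose class sums agree with those of r; S(\<sigma>) is the case r = 0. The second obstacle is the
  sorting of the two indices of a matrix entry. Symmetry of R together with
  \<open>R (- u) (- v) = R u v\<close> leaves two forms of the covariance of two entries: one for
  edges run through in opposite directions, one for equal directions. In a backtracking step the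
  first form does not involve the middle vertex, which is therefore free and yields a factor n. The
  second form is summable over the middle vertex and drops out, and so do the positions at which the
  directions fail to be opposite, whose number is bounded once the differences are fixed.\<close>

definition pairings :: "nat set \<Rightarrow> nat set set set" where
  "pairings V = {\<sigma>. partition_on V \<sigma> \<and> (\<forall>B\<in>\<sigma>. card B = 2)}"

lemma NC2_eq: "NC2 N = {\<sigma>\<in>pairings {1..N}. noncrossing \<sigma>}"
  by (auto simp: NC2_def pairings_def)

lemma pairings_empty: "pairings {} = {{}}"
  by (auto simp: pairings_def partition_on_def)

lemma finite_pairings: "finite V \<Longrightarrow> finite (pairings V)"
  by (rule finite_subset[of _ "Pow (Pow V)"]) (auto simp: pairings_def partition_on_def)

lemma pairings_finite: "\<sigma> \<in> pairings V \<Longrightarrow> finite V \<Longrightarrow> finite \<sigma>"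
  by (auto simp: pairings_def intro: finite_elements)

lemma pairings_block:
  assumes "\<sigma> \<in> pairings V" "B \<in> \<sigma>"
  obtains u v where "u < v" "B = {u, v}" "u \<in> V" "v \<in> V" "Min B = u" "Max B = v"
proof -
  have "card B = 2" "B \<subseteq> V" using assms by (auto simp: pairings_def partition_on_def)
  then obtain a b where ab: "B = {a,b}" "a \<noteq> b" by (auto simp: card_2_iff)
  show ?thesis
  proof (cases "a < b")
    case True
    then show ?thesis using that[of a b] ab \<open>B \<subseteq> V\<close> by auto
  next
    case False
    then have "b < a" using ab by auto
    then show ?thesis using that[of b a] ab \<open>B \<subseteq> V\<close> by (auto simp: insert_commute)
  qed
qed

lemma pairings_disjoint:
  "\<sigma> \<in> pairings V \<Longrightarrow> B \<in> \<sigma> \<Longrightarrow> C \<in> \<sigma> \<Longrightarrow> x \<in> B \<Longrightarrow> x \<in> C \<Longrightarrow> B = C"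
  by (auto simp: pairings_def partition_on_def disjoint_def)

lemma pairings_cover: "\<sigma> \<in> pairings V \<Longrightarrow> x \<in> V \<Longrightarrow> \<exists>B\<in>\<sigma>. x \<in> B"
  by (auto simp: pairings_def partition_on_def)

lemma pairings_subset: "\<sigma> \<in> pairings V \<Longrightarrow> B \<in> \<sigma> \<Longrightarrow> B \<subseteq> V"
  by (auto simp: pairings_def partition_on_def)

lemma pairings_card: "\<sigma> \<in> pairings V \<Longrightarrow> finite V \<Longrightarrow> card V = 2 * card \<sigma>"
proof -
  assume a: "\<sigma> \<in> pairings V" "finite V"
  have "card (\<Union>\<sigma>) = 2 * card \<sigma>"
    using a by (intro card_partition[symmetric, THEN trans])
      (auto simp: pairings_def partition_on_def disjoint_def intro: finite_elements)
  then show ?thesis using a by (simp add: pairings_def partition_on_def)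
qed

lemma pairings_remove:
  assumes "\<sigma> \<in> pairings V" "{u,v} \<in> \<sigma>"
  shows "\<sigma> - {{u,v}} \<in> pairings (V - {u,v})"
proof -
  have *: "B \<inter> {u,v} = {}" if "B \<in> \<sigma>" "B \<noteq> {u,v}" for B
    using pairings_disjoint[OF assms(1) that(1) assms(2)] that by blast
  show ?thesis using assms *
    by (fastforce simp: pairings_def partition_on_def disjoint_def)
qed

lemma pairings_insert:
  assumes "\<sigma> \<in> pairings (V - {u,v})" "u \<in> V" "v \<in> V" "u \<noteq> v"
  shows "insert {u,v} \<sigma> \<in> pairings V" "{u,v} \<notin> \<sigma>"
proof -
  have "\<Union>\<sigma> = V - {u,v}" using assms by (auto simp: pairings_def partition_on_def)
  then show "{u,v} \<notin> \<sigma>" by blast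
  show "insert {u,v} \<sigma> \<in> pairings V" using assms \<open>\<Union>\<sigma> = V - {u,v}\<close>
    by (auto simp: pairings_def partition_on_def disjoint_def)
qed

text \<open>Pairings are sorted by the partner b of a chosen element a. This is the recursion that
  \<open>wick_step\<close> reproduces for Gaussian moments.\<close>

lemma sum_pairings:
  fixes h :: "nat set set \<Rightarrow> 'b::comm_monoid_add"
  assumes "finite V" "a \<in> V"
  shows "(\<Sum>\<sigma>\<in>pairings V. h \<sigma>) = (\<Sum>b\<in>V-{a}. \<Sum>\<sigma>\<in>pairings (V-{a,b}). h (insert {a,b} \<sigma>))"
proof -
  have "(\<Sum>b\<in>V-{a}. \<Sum>\<sigma>\<in>pairings (V-{a,b}). h (insert {a,b} \<sigma>))
      = (\<Sum>(b,\<sigma>)\<in>Sigma (V-{a}) (\<lambda>b. pairings (V-{a,b})). h (insert {a,b} \<sigma>))"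
    using assms by (subst sum.Sigma) (auto intro!: finite_pairings)
  also have "\<dots> = (\<Sum>\<sigma>\<in>pairings V. h \<sigma>)"
  \<comment> \<open>Going back, b is read off as the other element of the unique block of \<sigma>
    that contains a.\<close>
  proof (rule sum.reindex_bij_witness[where
        i = "\<lambda>\<sigma>. let B = (THE B. B \<in> \<sigma> \<and> a \<in> B) in (THE b. B = {a,b} \<and> b \<noteq> a, \<sigma> - {B})"
        and j = "\<lambda>(b,\<sigma>). insert {a,b} \<sigma>"], goal_cases)
    case (1 x)
    obtain b \<sigma> where x: "x = (b,\<sigma>)" "b \<in> V" "b \<noteq> a" "\<sigma> \<in> pairings (V-{a,b})" using 1 by auto
    have i: "insert {a,b} \<sigma> \<in> pairings V" "{a,b} \<notin> \<sigma>"
      using pairings_insert[OF x(4)] assms x by auto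
    have "(THE B. B \<in> insert {a,b} \<sigma> \<and> a \<in> B) = {a,b}"
      using pairings_disjoint[OF i(1)] by (intro the_equality) blast+
    moreover have "(THE b'. {a,b} = {a,b'} \<and> b' \<noteq> a) = b"
      using x by (intro the_equality) (auto simp: doubleton_eq_iff)
    ultimately show ?case using i x by (simp add: Let_def)
  next
    case (2 x)
    then show ?case using pairings_insert assms by auto
  next
    case (3 \<sigma>)
    obtain B where B: "B \<in> \<sigma>" "a \<in> B" using pairings_cover 3 assms by blast
    then obtain b where b: "B = {a,b}" "b \<noteq> a" using pairings_block[OF 3 B(1)] by (metis doubleton_eq_iff insertE insert_commute less_irrefl singletonD)
    have t: "(THE B. B \<in> \<sigma> \<and> a \<in> B) = B"
      using pairings_disjoint[OF 3] B by (intro the_equality) blast+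
    moreover have "(THE b'. {a,b} = {a,b'} \<and> b' \<noteq> a) = b"
      using b by (intro the_equality) (auto simp: doubleton_eq_iff)
    ultimately show ?case using B b by (auto simp: Let_def)
  next
    case (4 \<sigma>)
    obtain B where B: "B \<in> \<sigma>" "a \<in> B" using pairings_cover 4 assms by blast
    then obtain b where b: "B = {a,b}" "b \<noteq> a" using pairings_block[OF 4 B(1)] by (metis doubleton_eq_iff insertE insert_commute less_irrefl singletonD)
    have t: "(THE B. B \<in> \<sigma> \<and> a \<in> B) = B"
      using pairings_disjoint[OF 4] B by (intro the_equality) blast+
    moreover have "(THE b'. {a,b} = {a,b'} \<and> b' \<noteq> a) = b"
      using b by (intro the_equality) (auto simp: doubleton_eq_iff)
    ultimately show ?case using B b pairings_remove[OF 4, of a b] pairings_subset[OF 4 B(1)] by (auto simp: Let_def)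
  next
    case (5 x) then show ?case by auto
  qed
  finally show ?thesis by simp
qed

text \<open>A shortest block contains no other block in its interior.\<close>
lemma exists_innermost:
  assumes "\<sigma> \<in> pairings V" "finite V" "V \<noteq> {}"
  obtains u v where "u < v" "{u,v} \<in> \<sigma>" "\<And>B. B \<in> \<sigma> \<Longrightarrow> \<not> (u < Min B \<and> Max B < v)"
proof -
  have ne: "\<sigma> \<noteq> {}" using assms by (auto simp: pairings_def partition_on_def)
  have f: "finite \<sigma>" using assms pairings_finite by auto
  obtain B where B: "B \<in> \<sigma>" "\<And>C. C \<in> \<sigma> \<Longrightarrow> Max B - Min B \<le> Max C - Min C"
    using ex_min_if_finite[of "(\<lambda>B. Max B - Min B) ` \<sigma>"] f ne
    by (metis (no_types, lifting) arg_min_if_finite(1) arg_min_least)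
  obtain u v where uv: "u < v" "B = {u,v}" "Min B = u" "Max B = v"
    using pairings_block[OF assms(1) B(1)] by metis
  show ?thesis
  proof (rule that[of u v])
    fix C assume C: "C \<in> \<sigma>"
    obtain a b where "a < b" "Min C = a" "Max C = b" using pairings_block[OF assms(1) C] by metis
    then show "\<not> (u < Min C \<and> Max C < v)" using B(2)[OF C] uv by auto
  qed (use uv B in auto)
qed

lemma sum_PiE_insert:
  fixes h :: "('i \<Rightarrow> 'b) \<Rightarrow> 'c::comm_monoid_add"
  assumes "l \<notin> V"
  shows "(\<Sum>x\<in>PiE (insert l V) (\<lambda>_. X). h x) = (\<Sum>x\<in>PiE V (\<lambda>_. X). \<Sum>a\<in>X. h (x(l := a)))"
proof -
  have "(\<Sum>x\<in>PiE (insert l V) (\<lambda>_. X). h x) = (\<Sum>(a,x)\<in>X \<times> PiE V (\<lambda>_. X). h (x(l := a)))"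
    unfolding PiE_insert_eq using assms
    by (subst sum.reindex[OF inj_combinator]) (auto simp: case_prod_unfold)
  also have "\<dots> = (\<Sum>a\<in>X. \<Sum>x\<in>PiE V (\<lambda>_. X). h (x(l := a)))"
    by (rule sum.cartesian_product[symmetric])
  also have "\<dots> = (\<Sum>x\<in>PiE V (\<lambda>_. X). \<Sum>a\<in>X. h (x(l := a)))" by (rule sum.swap)
  finally show ?thesis .
qed

section \<open>Wick's formula\<close>

text \<open>Every factor is at most the largest one in absolute value. Crude as it is, the bound
  makes a product integrable as soon as all powers of its factors are.\<close>

lemma abs_prod_le_sum_power:
  fixes a :: "'i \<Rightarrow> real"
  assumes "finite I" "I \<noteq> {}"
  shows "\<bar>\<Prod>i\<in>I. a i\<bar> \<le> (\<Sum>i\<in>I. \<bar>a i\<bar> ^ card I)"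
proof -
  obtain j where j: "j \<in> I" "\<And>i. i \<in> I \<Longrightarrow> \<bar>a i\<bar> \<le> \<bar>a j\<bar>"
  proof -
    have "Max ((\<lambda>i. \<bar>a i\<bar>) ` I) \<in> (\<lambda>i. \<bar>a i\<bar>) ` I" using assms by (intro Max_in) auto
    then obtain j where "j \<in> I" "\<bar>a j\<bar> = Max ((\<lambda>i. \<bar>a i\<bar>) ` I)" by auto
    then show ?thesis using assms by (intro that[of j]) auto
  qed
  have "\<bar>\<Prod>i\<in>I. a i\<bar> = (\<Prod>i\<in>I. \<bar>a i\<bar>)" by (rule abs_prod)
  also have "\<dots> \<le> (\<Prod>i\<in>I. \<bar>a j\<bar>)" using j by (intro prod_mono) auto
  also have "\<dots> = \<bar>a j\<bar> ^ card I" by simp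
  also have "\<dots> \<le> (\<Sum>i\<in>I. \<bar>a i\<bar> ^ card I)" using assms j
    by (intro member_le_sum) auto
  finally show ?thesis .
qed

text \<open>An iterated difference: enlarging I by j applies f(x + a j) - f(x), which lowers the
  degree in x by one. A power below card I is annihilated, and the power card I leaves its
  multilinear coefficient. Thus statements about powers of sums turn into statements about
  products.\<close>

lemma polarization:
  fixes a :: "'i \<Rightarrow> real"
  assumes "finite I" "d \<le> card I"
  shows "(\<Sum>S\<in>Pow I. (-1) ^ card (I - S) * (x + sum a S) ^ d)
    = (if d = card I then fact (card I) * (\<Prod>i\<in>I. a i) else 0)"
  using assms
proof (induction I arbitrary: d x rule: finite_induct)
  case empty then show ?case by simp
next
  case (insert j I)
  let ?D = "\<lambda>d x. (\<Sum>S\<in>Pow I. (-1) ^ card (I - S) * (x + sum a S) ^ d)"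
  have P: "Pow (insert j I) = Pow I \<union> insert j ` Pow I" by (rule Pow_insert)
  have dis: "Pow I \<inter> insert j ` Pow I = {}" using insert by auto
  have inj: "inj_on (insert j) (Pow I)" using insert by (intro inj_onI) (metis Diff_insert_absorb PowD subset_iff)
  have "(\<Sum>S\<in>Pow (insert j I). (-1) ^ card (insert j I - S) * (x + sum a S) ^ d)
     = (\<Sum>S\<in>Pow I. (-1) ^ card (insert j I - S) * (x + sum a S) ^ d)
     + (\<Sum>S\<in>Pow I. (-1) ^ card (insert j I - insert j S) * (x + sum a (insert j S)) ^ d)"
    unfolding P using insert by (subst sum.union_disjoint) (auto simp: dis sum.reindex[OF inj])
  also have "(\<Sum>S\<in>Pow I. (-1) ^ card (insert j I - S) * (x + sum a S) ^ d) = - ?D d x"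
    unfolding sum_negf[symmetric]
  proof (intro sum.cong refl)
    fix S assume "S \<in> Pow I"
    then have "insert j I - S = insert j (I - S)" using insert by auto
    then show "(-1) ^ card (insert j I - S) * (x + sum a S) ^ d = - ((-1) ^ card (I - S) * (x + sum a S) ^ d)"
      using insert by simp
  qed
  also have "(\<Sum>S\<in>Pow I. (-1) ^ card (insert j I - insert j S) * (x + sum a (insert j S)) ^ d) = ?D d (x + a j)"
  proof (intro sum.cong refl)
    fix S assume S: "S \<in> Pow I"
    then have "insert j I - insert j S = I - S" "j \<notin> S" "finite S"
      using insert by (auto intro: finite_subset)
    then show "(-1) ^ card (insert j I - insert j S) * (x + sum a (insert j S)) ^ d
      = (-1) ^ card (I - S) * (x + a j + sum a S) ^ d" by (simp add: add_ac)
  qed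
  also have "?D d (x + a j) = (\<Sum>S\<in>Pow I. (-1) ^ card (I - S) * (\<Sum>e\<le>d. of_nat (d choose e) * (x + sum a S) ^ e * a j ^ (d - e)))"
    by (simp add: binomial_ring[symmetric] add_ac)
  also have "\<dots> = (\<Sum>e\<le>d. of_nat (d choose e) * a j ^ (d - e) * ?D e x)"
    unfolding sum_distrib_left by (subst sum.swap) (simp add: mult_ac)
  \<comment> \<open>The term e = d is the undifferenced sum, which cancels.\<close>
  also have "\<dots> = ?D d x + (\<Sum>e<d. of_nat (d choose e) * a j ^ (d - e) * ?D e x)"
    by (subst lessThan_Suc_atMost[symmetric], subst sum.lessThan_Suc) (simp add: add_ac)
  finally have eq: "(\<Sum>S\<in>Pow (insert j I). (-1) ^ card (insert j I - S) * (x + sum a S) ^ d)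
     = (\<Sum>e<d. of_nat (d choose e) * a j ^ (d - e) * ?D e x)" by simp
  \<comment> \<open>Here e < d \<le> card I + 1, so the induction hypothesis applies; only e = card
    I survives, and it occurs in the sum only if d = card I + 1.\<close>
  have "(\<Sum>e<d. of_nat (d choose e) * a j ^ (d - e) * ?D e x)
     = (\<Sum>e<d. if e = card I then of_nat (d choose e) * a j ^ (d - e) * (fact (card I) * (\<Prod>i\<in>I. a i)) else 0)"
    using insert.prems insert.hyps by (intro sum.cong refl) (subst insert.IH, auto)
  also have "\<dots> = (if d = Suc (card I) then of_nat (Suc (card I)) * a j * (fact (card I) * (\<Prod>i\<in>I. a i)) else 0)"
    using insert.prems insert.hyps by (auto simp: sum.delta)
  finally show ?case using eq insert.hyps by (auto simp: algebra_simps)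
qed

section \<open>Moments of jointly Gaussian variables\<close>

context prob_space begin

text \<open>The even moments are expressed through the second moment so that degenerate laws fit in:
  a centred constant is 0, and the formulas hold with variance 0.\<close>

lemma gaussian_rv_moments:
  assumes g: "gaussian_rv M X" and z: "expectation X = 0"
  shows "integrable M (\<lambda>\<omega>. X \<omega> ^ k)"
    and "expectation (\<lambda>\<omega>. X \<omega> ^ (2*j)) = fact (2*j) / (2^j * fact j) * (expectation (\<lambda>\<omega>. X \<omega> ^ 2)) ^ j"
    and "expectation (\<lambda>\<omega>. X \<omega> ^ (2*j+1)) = 0"
proof -
  have [measurable]: "X \<in> borel_measurable M" using g by (simp add: gaussian_rv_def)
  obtain \<mu> where "(AE \<omega> in M. X \<omega> = \<mu>) \<or> (\<exists>\<sigma>>0. distributed M lborel X (\<lambda>x. ennreal (normal_density \<mu> \<sigma> x)))"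
    using g by (auto simp: gaussian_rv_def)
  then consider (c) "AE \<omega> in M. X \<omega> = \<mu>"
    | (n) \<sigma> where "\<sigma> > 0" "distributed M lborel X (\<lambda>x. ennreal (normal_density \<mu> \<sigma> x))" by auto
  then have *: "integrable M (\<lambda>\<omega>. X \<omega> ^ k) \<and>
    expectation (\<lambda>\<omega>. X \<omega> ^ (2*j)) = fact (2*j) / (2^j * fact j) * (expectation (\<lambda>\<omega>. X \<omega> ^ 2)) ^ j \<and>
    expectation (\<lambda>\<omega>. X \<omega> ^ (2*j+1)) = 0" for k j
  proof cases
    case c
    have "expectation X = expectation (\<lambda>_. \<mu>)" using c by (intro integral_cong_AE) auto
    then have "\<mu> = 0" using z by (simp add: prob_space)
    then have AE: "AE \<omega> in M. X \<omega> ^ m = 0 ^ m" for m using c by auto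
    have e: "expectation (\<lambda>\<omega>. X \<omega> ^ m) = expectation (\<lambda>_. 0 ^ m)" for m
      using AE[of m] by (intro integral_cong_AE) auto
    have "integrable M (\<lambda>\<omega>. X \<omega> ^ k) = integrable M (\<lambda>\<omega>. 0 ^ k :: real)"
      using AE[of k] by (intro integrable_cong_AE) auto
    then show ?thesis unfolding e by (cases j) (auto simp: prob_space)
  next
    case n
    have "\<mu> = 0" using normal_distributed_expectation[OF n] z by simp
    note D = n(2)[unfolded this]
    note di = distributed_integral[OF D, symmetric, simplified]
    have i: "integrable M (\<lambda>\<omega>. X \<omega> ^ m)" for m
      using integrable_normal_moment[OF n(1), of 0 m] distributed_integrable[OF D, of "\<lambda>x. x ^ m"] by simp
    have ev: "expectation (\<lambda>\<omega>. X \<omega> ^ (2*j)) = fact (2*j) / ((2/\<sigma>\<^sup>2)^j * fact j)" for j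
      using integral_normal_moment_even[OF n(1), of 0 j] di[of "\<lambda>x. x ^ (2*j)"] by simp
    have od: "expectation (\<lambda>\<omega>. X \<omega> ^ (2*j+1)) = 0" for j
      using integral_normal_moment_odd[OF n(1), of 0 j] di[of "\<lambda>x. x ^ (2*j+1)"] by simp
    have "expectation (\<lambda>\<omega>. X \<omega> ^ 2) = \<sigma>\<^sup>2" using ev[of 1] by (simp add: fact_numeral)
    then have "expectation (\<lambda>\<omega>. X \<omega> ^ (2*j)) = fact (2*j) / (2^j * fact j) * (expectation (\<lambda>\<omega>. X \<omega> ^ 2)) ^ j" for j
      unfolding ev using n(1) by (simp add: power_divide)
    then show ?thesis using i od by blast
  qed
  show "integrable M (\<lambda>\<omega>. X \<omega> ^ k)"
    "expectation (\<lambda>\<omega>. X \<omega> ^ (2*j)) = fact (2*j) / (2^j * fact j) * (expectation (\<lambda>\<omega>. X \<omega> ^ 2)) ^ j"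
    "expectation (\<lambda>\<omega>. X \<omega> ^ (2*j+1)) = 0" using * by blast+
qed

lemma integrable_prod_of_powers:
  assumes "finite I" "\<And>i. i \<in> I \<Longrightarrow> Y i \<in> borel_measurable M"
    "\<And>i k. i \<in> I \<Longrightarrow> integrable M (\<lambda>\<omega>. (Y i \<omega> :: real) ^ k)"
  shows "integrable M (\<lambda>\<omega>. \<Prod>i\<in>I. Y i \<omega>)"
proof (cases "I = {}")
  case False
  show ?thesis
  proof (rule Bochner_Integration.integrable_bound)
    show "integrable M (\<lambda>\<omega>. \<Sum>i\<in>I. \<bar>Y i \<omega>\<bar> ^ card I)"
      using integrable_abs[OF assms(3)[of _ "card I"]]
      by (intro Bochner_Integration.integrable_sum) (simp add: power_abs)
    show "(\<lambda>\<omega>. \<Prod>i\<in>I. Y i \<omega>) \<in> borel_measurable M" using assms by simp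
    show "AE x in M. norm (\<Prod>i\<in>I. Y i x) \<le> norm (\<Sum>i\<in>I. \<bar>Y i x\<bar> ^ card I)"
      using abs_prod_le_sum_power[OF assms(1) False] by (auto intro: order_trans[OF _ abs_ge_self])
  qed
qed simp

text \<open>Both sides of the moment formula for \<open>W + s X\<close> are polynomials in \<open>s\<close>; compare their
  derivatives at \<open>s = 0\<close>.\<close>
lemma gaussian_pair_moment:
  assumes g: "\<And>a s. gaussian_rv M (\<lambda>\<omega>. a * W \<omega> + s * X \<omega>)"
    and z: "expectation W = 0" "expectation X = 0"
  shows "expectation (\<lambda>\<omega>. X \<omega> * W \<omega> ^ k) = k * expectation (\<lambda>\<omega>. X \<omega> * W \<omega>) * expectation (\<lambda>\<omega>. W \<omega> ^ (k-1))"
proof -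
  have gW: "gaussian_rv M W" using g[of 1 0] by simp
  have gX: "gaussian_rv M X" using g[of 0 1] by simp
  have [measurable]: "W \<in> borel_measurable M" "X \<in> borel_measurable M"
    using gW gX by (auto simp: gaussian_rv_def)
  note iW = gaussian_rv_moments(1)[OF gW z(1)] and iX = gaussian_rv_moments(1)[OF gX z(2)]
  have iWX: "integrable M (\<lambda>\<omega>. W \<omega> ^ i * X \<omega> ^ j)" for i j
  proof -
    have "integrable M (\<lambda>\<omega>. \<Prod>b\<in>(UNIV::bool set). if b then W \<omega> ^ i else X \<omega> ^ j)"
    proof (rule integrable_prod_of_powers, goal_cases)
      case (3 b k)
      then show ?case using iW[of "i*k"] iX[of "j*k"] by (cases b) (auto simp: power_mult)
    qed auto
    then show ?thesis by (simp add: UNIV_bool mult.commute)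
  qed
  let ?Y = "\<lambda>s \<omega>. W \<omega> + s * X \<omega>"
  have gY: "gaussian_rv M (?Y s)" for s using g[of 1 s] by simp
  have zY: "expectation (?Y s) = 0" for s
    using z iW[of 1] iX[of 1] by simp
  \<comment> \<open>These are the coefficients of the polynomial s \<mapsto> E[(W + s X)^n]; the one
    at i = 1 carries the mixed moment in question.\<close>
  define c where "c i n = real (n choose i) * expectation (\<lambda>\<omega>. X \<omega> ^ i * W \<omega> ^ (n - i))" for i n
  have ex: "expectation (\<lambda>\<omega>. ?Y s \<omega> ^ n) = (\<Sum>i\<le>n. c i n * s ^ i)" for s n
  proof -
    have "(\<lambda>\<omega>. ?Y s \<omega> ^ n) = (\<lambda>\<omega>. \<Sum>i\<le>n. (real (n choose i) * s ^ i) * (W \<omega> ^ (n - i) * X \<omega> ^ i))"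
      by (simp add: add.commute[of "W _"] binomial_ring power_mult_distrib mult_ac)
    then show ?thesis using iWX
      by (simp add: c_def mult.commute[of "X _ ^ _"]) (simp add: mult_ac)
  qed
  have der: "((\<lambda>s. expectation (\<lambda>\<omega>. ?Y s \<omega> ^ n)) has_real_derivative c 1 n) (at 0)" if "n > 0" for n
  proof -
    have "((\<lambda>s. \<Sum>i\<le>n. c i n * s ^ i) has_real_derivative (\<Sum>i\<le>n. c i n * (real i * 0 ^ (i - 1)))) (at 0)"
      by (auto intro!: derivative_eq_intros sum.cong)
    also have "(\<Sum>i\<le>n. c i n * (real i * 0 ^ (i - 1))) = (\<Sum>i\<le>n. if i = 1 then c 1 n else 0)"
    proof (intro sum.cong refl)
      fix i show "c i n * (real i * 0 ^ (i - 1)) = (if i = 1 then c 1 n else 0)"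
        by (cases "i = 0"; cases "i = 1") (auto simp: power_0_left)
    qed
    also have "\<dots> = c 1 n" using that by (simp add: sum.delta)
    finally show ?thesis by (simp add: ex)
  qed
  have c1: "c 1 (Suc k) = Suc k * expectation (\<lambda>\<omega>. X \<omega> * W \<omega> ^ k)"
    by (simp add: c_def)
  show ?thesis
  proof (cases "even k")
    case True
    \<comment> \<open>For even k the exponent k + 1 is odd, so all these moments of W + s X vanish;
      the right-hand side is 0 because k = 0 or k - 1 is odd.\<close>
    then have e: "Suc k = 2 * (k div 2) + 1" by simp
    have "((\<lambda>s. 0) has_real_derivative c 1 (Suc k)) (at 0)"
      using der[of "Suc k"] gaussian_rv_moments(3)[OF gY zY] unfolding e by simp
    then have "c 1 (Suc k) = 0" using DERIV_unique DERIV_const by blast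
    then have l: "expectation (\<lambda>\<omega>. X \<omega> * W \<omega> ^ k) = 0" using c1 by simp
    show ?thesis
    proof (cases "k = 0")
      case False
      then have "k - 1 = 2 * (k div 2 - 1) + 1" using True by presburger
      then have "expectation (\<lambda>\<omega>. W \<omega> ^ (k-1)) = 0" using gaussian_rv_moments(3)[OF gW z(1)] by metis
      then show ?thesis using l by simp
    qed (use l in simp)
  next
    case False
    define j where "j = k div 2"
    have k: "k = 2 * j + 1" "Suc k = 2 * (j + 1)" using False by (auto simp: j_def)
    \<comment> \<open>q j is the double factorial (2j - 1)!!, the factor in front of the j-th power
      of the variance. Its recursion turns the derivative of the (k + 1)-st moment into k times the
      (k - 1)-st.\<close>
    define q where "q j = (fact (2*j) / (2^j * fact j) :: real)" for j :: nat
    have q: "q (Suc j) = (2 * j + 1) * q j"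
    proof -
      have 1: "fact (2 * Suc j) = (2 * real j + 2) * ((2 * real j + 1) * fact (2 * j))"
        by (simp add: algebra_simps)
      have 2: "2 ^ Suc j * fact (Suc j) = (2 * real j + 2) * (2 ^ j * fact j)"
        by (simp add: algebra_simps)
      have "2 * real j + 2 \<noteq> 0" by (simp add: add_nonneg_eq_0_iff)
      then show ?thesis unfolding q_def 1 2 by (subst mult_divide_mult_cancel_left) auto
    qed
    define w where "w = expectation (\<lambda>\<omega>. W \<omega> ^ 2)"
    define y where "y = expectation (\<lambda>\<omega>. X \<omega> * W \<omega>)"
    define v where "v = expectation (\<lambda>\<omega>. X \<omega> ^ 2)"
    have Y2: "expectation (\<lambda>\<omega>. ?Y s \<omega> ^ 2) = w + 2 * y * s + v * s^2" for s
      unfolding ex by (simp add: c_def w_def y_def v_def numeral_2_eq_2)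
    have "(\<lambda>s. expectation (\<lambda>\<omega>. ?Y s \<omega> ^ (Suc k))) = (\<lambda>s. q (Suc j) * (w + 2 * y * s + v * s^2) ^ Suc j)"
      unfolding k(2) using gaussian_rv_moments(2)[OF gY zY, of _ "Suc j"] unfolding Y2 q_def by (intro ext) simp
    moreover have "((\<lambda>s. q (Suc j) * (w + 2 * y * s + v * s^2) ^ Suc j) has_real_derivative
        q (Suc j) * (Suc j * w ^ j * (2 * y))) (at 0)"
    proof -
      have "((\<lambda>s. w + 2 * y * s + v * s^2) has_real_derivative 2 * y) (at 0)"
        by (auto intro!: derivative_eq_intros)
      then show ?thesis
        by (rule DERIV_cong[OF DERIV_cmult[OF DERIV_power]]) (simp add: algebra_simps)
    qed
    ultimately have "c 1 (Suc k) = q (Suc j) * (Suc j * w ^ j * (2 * y))"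
      using der[of "Suc k"] DERIV_unique by fastforce
    then have "Suc k * expectation (\<lambda>\<omega>. X \<omega> * W \<omega> ^ k) = Suc k * (real k * y * (q j * w ^ j))"
      using c1 k q by (simp add: algebra_simps)
    then have "expectation (\<lambda>\<omega>. X \<omega> * W \<omega> ^ k) = real k * y * (q j * w ^ j)"
      by (simp del: of_nat_Suc)
    also have "q j * w ^ j = expectation (\<lambda>\<omega>. W \<omega> ^ (k-1))"
      using gaussian_rv_moments(2)[OF gW z(1), of j] by (simp add: q_def w_def k(1))
    finally show ?thesis by (simp add: y_def)
  qed
qed

text \<open>The map e need not be injective: a walk may use the same matrix entry several times.
  Coefficients with the same image are collected.\<close>

lemma gaussian_process_comp:
  fixes e :: "'c \<Rightarrow> 'i"
  assumes "gaussian_process M X" shows "gaussian_process M (\<lambda>v. X (e v))"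
  unfolding gaussian_process_def
proof (intro conjI allI impI)
  fix F :: "'c set" and c :: "'c \<Rightarrow> real" assume F: "finite F"
  have "(\<Sum>v\<in>F. c v * X (e v) \<omega>) = (\<Sum>i\<in>e`F. (\<Sum>v\<in>{v\<in>F. e v = i}. c v) * X i \<omega>)" for \<omega>
  proof -
    have "(\<Sum>v\<in>F. c v * X (e v) \<omega>) = (\<Sum>i\<in>e`F. \<Sum>v\<in>{v\<in>F. e v = i}. c v * X (e v) \<omega>)"
      by (rule sum.image_gen[OF F])
    also have "\<dots> = (\<Sum>i\<in>e`F. (\<Sum>v\<in>{v\<in>F. e v = i}. c v) * X i \<omega>)"
      unfolding sum_distrib_right by (intro sum.cong refl) auto
    finally show ?thesis .
  qed
  then have *: "(\<lambda>\<omega>. \<Sum>v\<in>F. c v * X (e v) \<omega>) = (\<lambda>\<omega>. \<Sum>i\<in>e`F. (\<Sum>v\<in>{v\<in>F. e v = i}. c v) * X i \<omega>)"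
    by (intro ext)
  have "finite (e ` F)" using F by simp
  then show "gaussian_rv M (\<lambda>\<omega>. \<Sum>v\<in>F. c v * X (e v) \<omega>)"
    unfolding * by (rule gaussian_process_def[THEN iffD1, OF assms, THEN conjunct2, rule_format])
qed (use assms in \<open>simp add: gaussian_process_def\<close>)

lemma gaussian_process_integrable_prod:
  assumes g: "gaussian_process M X" and z: "\<And>i. expectation (X i) = 0" and I: "finite I"
  shows "integrable M (\<lambda>\<omega>. \<Prod>i\<in>I. X (e i) \<omega>)"
proof (rule integrable_prod_of_powers[OF I])
  fix i k assume "i \<in> I"
  have "gaussian_rv M (\<lambda>\<omega>. \<Sum>i\<in>{e i}. 1 * X i \<omega>)"
    by (rule gaussian_process_def[THEN iffD1, OF g, THEN conjunct2, rule_format]) simp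
  then show "integrable M (\<lambda>\<omega>. X (e i) \<omega> ^ k)" using gaussian_rv_moments(1) z by simp
qed (use g in \<open>auto simp: gaussian_process_def\<close>)

text \<open>\<open>gaussian_pair_moment\<close> is applied to every partial sum W over S \<subseteq>
  I and the results are combined by \<open>polarization\<close>. The alternating sum over S turns
  the k-th power of W into k! times the full product; after exchanging it with the sum over j in S,
  it turns the (k - 1)-st power into (k - 1)! times the product over I - {j}.\<close>

lemma wick_step:
  assumes g: "gaussian_process M X" and z: "\<And>i. expectation (X i) = 0"
    and I: "finite I" and a: "a \<notin> I"
  shows "expectation (\<lambda>\<omega>. X a \<omega> * (\<Prod>i\<in>I. X i \<omega>))
    = (\<Sum>j\<in>I. expectation (\<lambda>\<omega>. X a \<omega> * X j \<omega>) * expectation (\<lambda>\<omega>. \<Prod>i\<in>I-{j}. X i \<omega>))"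
proof (cases "I = {}")
  case True then show ?thesis using z by simp
next
  case False
  define k where "k = card I"
  have k: "k > 0" using False I by (simp add: k_def card_gt_0_iff)
  have gl: "gaussian_rv M (\<lambda>\<omega>. \<Sum>i\<in>F. c i * X i \<omega>)" if "finite F" for F c
    using g that by (simp add: gaussian_process_def)
  have gX: "gaussian_rv M (X i)" for i using gl[of "{i}" "\<lambda>_. 1"] by simp
  have [measurable]: "X i \<in> borel_measurable M" for i using g by (simp add: gaussian_process_def)
  have i1: "integrable M (X i)" for i using gaussian_rv_moments(1)[OF gX z, of i 1] by simp
  let ?W = "\<lambda>S \<omega>. \<Sum>i\<in>S. X i \<omega>"
  have zW: "expectation (?W S) = 0" for S using i1 z by simp
  have gW: "gaussian_rv M (?W S)" if "finite S" for S using gl[OF that, of "\<lambda>_. 1"] by simp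
  have iW: "integrable M (\<lambda>\<omega>. ?W S \<omega> ^ n)" if "finite S" for S n
    using gaussian_rv_moments(1)[OF gW[OF that] zW] by simp
  have iXX: "integrable M (\<lambda>\<omega>. X a \<omega> * X j \<omega>)" if "j \<in> I" for j
    using gaussian_process_integrable_prod[OF g z, of "{a,j}" "\<lambda>x. x"] a that
    by (cases "a = j") auto
  have gXW: "gaussian_rv M (\<lambda>\<omega>. b * ?W S \<omega> + s * X a \<omega>)" if "S \<subseteq> I" for b s S
  proof -
    have "finite S" "a \<notin> S" using that I a finite_subset by auto
    then have "(\<Sum>i\<in>insert a S. (if i = a then s else b) * X i \<omega>) = b * ?W S \<omega> + s * X a \<omega>" for \<omega>
      by (auto simp: sum_distrib_left intro!: sum.cong)
    then show ?thesis using gl[of "insert a S" "\<lambda>i. if i = a then s else b"] \<open>finite S\<close> by simp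
  qed
  have iXW: "integrable M (\<lambda>\<omega>. X a \<omega> * ?W S \<omega> ^ n)" if "S \<subseteq> I" for S n
  proof -
    have fS: "finite S" using that I finite_subset by auto
    have "integrable M (\<lambda>\<omega>. \<Prod>b\<in>(UNIV::bool set). if b then X a \<omega> else ?W S \<omega> ^ n)"
    proof (rule integrable_prod_of_powers, goal_cases)
      case (3 b k)
      then show ?case using iW[OF fS, of "n*k"] gaussian_rv_moments(1)[OF gX z, of a k]
        by (cases b) (auto simp: power_mult)
    qed auto
    then show ?thesis by (simp add: UNIV_bool mult.commute)
  qed
  have "fact k * expectation (\<lambda>\<omega>. X a \<omega> * (\<Prod>i\<in>I. X i \<omega>))
     = expectation (\<lambda>\<omega>. \<Sum>S\<in>Pow I. (-1) ^ card (I - S) * (X a \<omega> * ?W S \<omega> ^ k))"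
  proof -
    have "fact k * (X a \<omega> * (\<Prod>i\<in>I. X i \<omega>)) = (\<Sum>S\<in>Pow I. (-1) ^ card (I - S) * (X a \<omega> * ?W S \<omega> ^ k))" for \<omega>
    proof -
      have "fact k * (X a \<omega> * (\<Prod>i\<in>I. X i \<omega>)) = X a \<omega> * (\<Sum>S\<in>Pow I. (-1) ^ card (I - S) * ?W S \<omega> ^ k)"
        using polarization[OF I, of k 0 "\<lambda>i. X i \<omega>"] by (simp add: k_def)
      then show ?thesis by (simp add: sum_distrib_left mult.left_commute)
    qed
    then show ?thesis by (simp flip: Bochner_Integration.integral_mult_right_zero)
  qed
  also have "\<dots> = (\<Sum>S\<in>Pow I. (-1) ^ card (I - S) * expectation (\<lambda>\<omega>. X a \<omega> * ?W S \<omega> ^ k))"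
    using iXW by simp
  also have "\<dots> = (\<Sum>S\<in>Pow I. \<Sum>j\<in>S. (-1) ^ card (I - S) * (k * expectation (\<lambda>\<omega>. X a \<omega> * X j \<omega>) * expectation (\<lambda>\<omega>. ?W S \<omega> ^ (k - 1))))"
  proof (intro sum.cong refl)
    fix S assume S: "S \<in> Pow I"
    have "expectation (\<lambda>\<omega>. X a \<omega> * ?W S \<omega>) = (\<Sum>j\<in>S. expectation (\<lambda>\<omega>. X a \<omega> * X j \<omega>))"
    proof -
      have "integrable M (\<lambda>\<omega>. X a \<omega> * X j \<omega>)" if "j \<in> S" for j using S iXX that by auto
      then show ?thesis by (simp only: sum_distrib_left Bochner_Integration.integral_sum)
    qed
    then show "(-1) ^ card (I - S) * expectation (\<lambda>\<omega>. X a \<omega> * ?W S \<omega> ^ k) =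
      (\<Sum>j\<in>S. (-1) ^ card (I - S) * (k * expectation (\<lambda>\<omega>. X a \<omega> * X j \<omega>) * expectation (\<lambda>\<omega>. ?W S \<omega> ^ (k - 1))))"
      using gaussian_pair_moment[OF gXW zW z, of S k] S
      by (simp only: sum_distrib_left sum_distrib_right PowD)
  qed
  also have "\<dots> = (\<Sum>j\<in>I. \<Sum>S\<in>{S\<in>Pow I. j \<in> S}. (-1) ^ card (I - S) * (k * expectation (\<lambda>\<omega>. X a \<omega> * X j \<omega>) * expectation (\<lambda>\<omega>. ?W S \<omega> ^ (k - 1))))"
  proof -
    have "(\<Sum>S\<in>Pow I. \<Sum>j\<in>S. h S j) = (\<Sum>S\<in>Pow I. \<Sum>j\<in>{j\<in>I. j \<in> S}. h S j)" for h :: "'b set \<Rightarrow> 'b \<Rightarrow> real"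
      by (intro sum.cong) auto
    note * = this
    show ?thesis unfolding * by (rule sum.swap_restrict) (use I in auto)
  qed
  also have "\<dots> = (\<Sum>j\<in>I. k * expectation (\<lambda>\<omega>. X a \<omega> * X j \<omega>) * (fact (k-1) * expectation (\<lambda>\<omega>. \<Prod>i\<in>I-{j}. X i \<omega>)))"
  proof (intro sum.cong refl)
    fix j assume j: "j \<in> I"
    have bij: "(\<Sum>S\<in>{S\<in>Pow I. j \<in> S}. h S) = (\<Sum>S\<in>Pow (I-{j}). h (insert j S))" for h :: "'b set \<Rightarrow> real"
      using j by (intro sum.reindex_bij_witness[of _ "insert j" "\<lambda>S. S - {j}"]) (auto simp: insert_absorb insert_Diff)
    have c: "card (I - {j}) = k - 1" using j I by (simp add: k_def)
    have "fact (k-1) * expectation (\<lambda>\<omega>. \<Prod>i\<in>I-{j}. X i \<omega>)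
       = expectation (\<lambda>\<omega>. \<Sum>S\<in>Pow (I-{j}). (-1) ^ card (I - insert j S) * ?W (insert j S) \<omega> ^ (k - 1))"
    proof -
      have "fact (k-1) * (\<Prod>i\<in>I-{j}. X i \<omega>) = (\<Sum>S\<in>Pow (I-{j}). (-1) ^ card (I - insert j S) * ?W (insert j S) \<omega> ^ (k - 1))" for \<omega>
      proof -
        \<comment> \<open>With j split off from every S, \<open>X j \<omega>\<close> becomes the
          base point x of \<open>polarization\<close>, and the exponent k - 1 is exactly the size of
          the remaining set.\<close>
        have "(\<Sum>S\<in>Pow (I-{j}). (-1) ^ card (I - insert j S) * ?W (insert j S) \<omega> ^ (k - 1))
           = (\<Sum>S\<in>Pow (I-{j}). (-1) ^ card ((I - {j}) - S) * (X j \<omega> + ?W S \<omega>) ^ (k - 1))"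
        proof (intro sum.cong refl)
          fix S assume S: "S \<in> Pow (I-{j})"
          then have "finite S" "j \<notin> S" using I finite_subset[of S I] by auto
          moreover have "I - insert j S = (I - {j}) - S" by auto
          ultimately show "(-1) ^ card (I - insert j S) * ?W (insert j S) \<omega> ^ (k - 1) = (-1) ^ card ((I - {j}) - S) * (X j \<omega> + ?W S \<omega>) ^ (k - 1)"
            by simp
        qed
        then show ?thesis using polarization[of "I-{j}" "k-1" "X j \<omega>" "\<lambda>i. X i \<omega>"] I c by simp
      qed
      then show ?thesis by (simp flip: Bochner_Integration.integral_mult_right_zero)
    qed
    also have "\<dots> = (\<Sum>S\<in>Pow (I-{j}). (-1) ^ card (I - insert j S) * expectation (\<lambda>\<omega>. ?W (insert j S) \<omega> ^ (k - 1)))"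
    proof -
      have "integrable M (\<lambda>\<omega>. ?W (insert j S) \<omega> ^ (k - 1))" if "S \<in> Pow (I-{j})" for S
        using that I finite_subset[of S I] by (intro iW) auto
      then show ?thesis by simp
    qed
    finally show "(\<Sum>S\<in>{S\<in>Pow I. j \<in> S}. (-1) ^ card (I - S) * (k * expectation (\<lambda>\<omega>. X a \<omega> * X j \<omega>) * expectation (\<lambda>\<omega>. ?W S \<omega> ^ (k - 1))))
       = k * expectation (\<lambda>\<omega>. X a \<omega> * X j \<omega>) * (fact (k-1) * expectation (\<lambda>\<omega>. \<Prod>i\<in>I-{j}. X i \<omega>))"
      unfolding bij by (simp add: sum_distrib_left mult_ac)
  qed
  also have "\<dots> = fact k * (\<Sum>j\<in>I. expectation (\<lambda>\<omega>. X a \<omega> * X j \<omega>) * expectation (\<lambda>\<omega>. \<Prod>i\<in>I-{j}. X i \<omega>))"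
  proof -
    have "fact k = real k * fact (k - 1)" using k by (rule fact_reduce)
    then show ?thesis by (simp only: sum_distrib_left mult_ac)
  qed
  finally show ?thesis by simp
qed

theorem wick:
  fixes X :: "nat \<Rightarrow> 'a \<Rightarrow> real"
  assumes g: "gaussian_process M X" and z: "\<And>i. expectation (X i) = 0" and V: "finite V"
  shows "expectation (\<lambda>\<omega>. \<Prod>v\<in>V. X v \<omega>) =
    (\<Sum>\<sigma>\<in>pairings V. \<Prod>B\<in>\<sigma>. expectation (\<lambda>\<omega>. X (Min B) \<omega> * X (Max B) \<omega>))"
  using V
proof (induction "card V" arbitrary: V rule: less_induct)
  case less
  show ?case
  proof (cases "V = {}")
    case True then show ?thesis by (simp add: pairings_empty prob_space)
  next
    case False
    then obtain a where a: "a \<in> V" by auto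
    let ?c = "\<lambda>B. expectation (\<lambda>\<omega>. X (Min B) \<omega> * X (Max B) \<omega>)"
    have "expectation (\<lambda>\<omega>. \<Prod>v\<in>V. X v \<omega>) = expectation (\<lambda>\<omega>. X a \<omega> * (\<Prod>v\<in>V-{a}. X v \<omega>))"
      using a less by (simp add: prod.remove)
    also have "\<dots> = (\<Sum>b\<in>V-{a}. expectation (\<lambda>\<omega>. X a \<omega> * X b \<omega>) * expectation (\<lambda>\<omega>. \<Prod>v\<in>V-{a}-{b}. X v \<omega>))"
      using less by (intro wick_step[OF g z]) auto
    also have "\<dots> = (\<Sum>b\<in>V-{a}. \<Sum>\<sigma>\<in>pairings (V-{a,b}). \<Prod>B\<in>insert {a,b} \<sigma>. ?c B)"
    proof (intro sum.cong refl)
      fix b assume b: "b \<in> V - {a}"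
      have e: "V - {a} - {b} = V - {a,b}" by auto
      have "card (V - {a,b}) < card V" using a less by (intro psubset_card_mono) auto
      then have IH: "expectation (\<lambda>\<omega>. \<Prod>v\<in>V-{a,b}. X v \<omega>) = (\<Sum>\<sigma>\<in>pairings (V-{a,b}). \<Prod>B\<in>\<sigma>. ?c B)"
        using less by auto
      have cab: "?c {a,b} = expectation (\<lambda>\<omega>. X a \<omega> * X b \<omega>)"
        using b by (cases "a < b") (auto simp: mult.commute)
      show "expectation (\<lambda>\<omega>. X a \<omega> * X b \<omega>) * expectation (\<lambda>\<omega>. \<Prod>v\<in>V-{a}-{b}. X v \<omega>)
        = (\<Sum>\<sigma>\<in>pairings (V-{a,b}). \<Prod>B\<in>insert {a,b} \<sigma>. ?c B)"
        unfolding e IH sum_distrib_left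
      proof (intro sum.cong refl)
        fix \<sigma> assume s: "\<sigma> \<in> pairings (V-{a,b})"
        have "finite \<sigma>" "{a,b} \<notin> \<sigma>"
          using pairings_finite[OF s] less pairings_insert(2)[OF s] a b by auto
        then show "expectation (\<lambda>\<omega>. X a \<omega> * X b \<omega>) * (\<Prod>B\<in>\<sigma>. ?c B) = (\<Prod>B\<in>insert {a,b} \<sigma>. ?c B)"
          by (simp add: cab[symmetric])
      qed
    qed
    also have "\<dots> = (\<Sum>\<sigma>\<in>pairings V. \<Prod>B\<in>\<sigma>. ?c B)"
      using sum_pairings[OF _ a, of "\<lambda>\<sigma>. \<Prod>B\<in>\<sigma>. ?c B"] less by simp
    finally show ?thesis .
  qed
qed

end

section \<open>The method of moments\<close>

definition all_moments :: "real measure \<Rightarrow> bool" where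
  "all_moments \<nu> \<longleftrightarrow> real_distribution \<nu> \<and> (\<forall>k. integrable \<nu> (\<lambda>x. x ^ k))"

abbreviation moment :: "real measure \<Rightarrow> nat \<Rightarrow> real" where
  "moment \<nu> k \<equiv> (\<integral>x. x ^ k \<partial>\<nu>)"

abbreviation tail_moment :: "real measure \<Rightarrow> real \<Rightarrow> nat \<Rightarrow> real" where
  "tail_moment \<nu> K k \<equiv> (\<integral>x. indicator {x. \<bar>x\<bar> > K} x * \<bar>x\<bar> ^ k \<partial>\<nu>)"

lemma all_moments_tail_integrable:
  assumes "all_moments \<nu>"
  shows "integrable \<nu> (\<lambda>x. indicator {x. \<bar>x\<bar> > K} x * \<bar>x\<bar> ^ k)"
proof -
  interpret real_distribution \<nu> using assms by (simp add: all_moments_def)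
  have i: "integrable \<nu> (\<lambda>x. x ^ k)" using assms by (simp add: all_moments_def)
  show ?thesis
    by (rule Bochner_Integration.integrable_bound[OF i])
      (auto simp: indicator_def power_abs abs_mult)
qed

text \<open>Where |x| > K, |x|^k is at most x^(2(k + i)) / K^(k + 2i) for every i. In the limit n
  \<rightarrow> \<infinity> the right-hand side integrates to at most q (C/K)^(2i), with q
  independent of i, and this is small for large i.\<close>

lemma tail_moment_tendsto_0:
  assumes am: "\<And>n::nat. all_moments (\<nu> n)"
    and lim: "\<And>k. (\<lambda>n. moment (\<nu> n) k) \<longlonglongrightarrow> \<beta> k"
    and bd: "\<And>m. m \<ge> 1 \<Longrightarrow> \<beta> (2*m) \<le> C ^ (2*m)"
    and CK: "0 < C" "C < K"
  shows "(\<lambda>n. tail_moment (\<nu> n) K k) \<longlonglongrightarrow> 0"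
proof (rule LIMSEQ_I)
  fix e :: real assume e: "e > 0"
  define q where "q = C^(2*k) / K^k"
  have q: "q > 0" using CK by (simp add: q_def)
  have K: "K > 0" using CK by simp
  have le: "tail_moment (\<nu> n) K k \<le> moment (\<nu> n) (2*(k+i)) / K^(k+2*i)" for n i
  proof -
    interpret real_distribution "\<nu> n" using am by (simp add: all_moments_def)
    have "tail_moment (\<nu> n) K k \<le> (\<integral>x. x^(2*(k+i)) / K^(k+2*i) \<partial>\<nu> n)"
    proof (rule integral_mono)
      show "integrable (\<nu> n) (\<lambda>x. x^(2*(k+i)) / K^(k+2*i))"
        using am by (auto simp: all_moments_def)
      fix x :: real
      show "indicator {x. \<bar>x\<bar> > K} x * \<bar>x\<bar> ^ k \<le> x^(2*(k+i)) / K^(k+2*i)"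
      proof (cases "\<bar>x\<bar> > K")
        case True
        have "\<bar>x\<bar>^k * K^(k+2*i) \<le> \<bar>x\<bar>^k * \<bar>x\<bar>^(k+2*i)"
          using True K by (intro mult_left_mono power_mono) auto
        also have "\<dots> = \<bar>x\<bar>^(2*(k+i))" by (simp add: power_add[symmetric] algebra_simps)
        also have "\<dots> = x^(2*(k+i))" by (rule power_even_abs) simp
        finally show ?thesis using True K by (simp add: pos_le_divide_eq)
      next
        case False
        moreover have "0 \<le> x^(2*(k+i))" by (rule zero_le_even_power) simp
        ultimately show ?thesis using K by simp
      qed
    qed (rule all_moments_tail_integrable[OF am])
    then show ?thesis by simp
  qed
  have "(\<lambda>i. (C/K)^(2*i) * q) \<longlonglongrightarrow> 0 * q"
    unfolding power_mult using CK by (intro tendsto_mult LIMSEQ_power_zero) (auto simp: power_less_one_iff abs_square_less_1)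
  then have "\<forall>\<^sub>F i in sequentially. (C/K)^(2*i) * q < e" using e by (intro order_tendstoD) auto
  then have "\<forall>\<^sub>F i in sequentially. (C/K)^(2*i) * q < e \<and> i \<ge> 1"
    by (intro eventually_conj eventually_ge_at_top)
  then obtain i where i: "(C/K)^(2*i) * q < e" "i \<ge> 1"
    using eventually_happens by fastforce
  have "\<beta> (2*(k+i)) / K^(k+2*i) \<le> C^(2*(k+i)) / K^(k+2*i)"
    using bd[of "k+i"] i K by (intro divide_right_mono) auto
  also have "\<dots> = (C/K)^(2*i) * q" by (simp add: q_def power_add power_divide field_simps power_mult_distrib)
  also have "\<dots> < e" by fact
  finally have "\<beta> (2*(k+i)) / K^(k+2*i) < e" .
  moreover have "(\<lambda>n. moment (\<nu> n) (2*(k+i)) / K^(k+2*i)) \<longlonglongrightarrow> \<beta> (2*(k+i)) / K^(k+2*i)"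
    using K by (intro tendsto_divide lim) auto
  ultimately have "\<forall>\<^sub>F n in sequentially. moment (\<nu> n) (2*(k+i)) / K^(k+2*i) < e"
    by (rule order_tendstoD(2)[rotated])
  then have "\<forall>\<^sub>F n in sequentially. norm (tail_moment (\<nu> n) K k - 0) < e"
  proof (rule eventually_mono)
    fix n assume "moment (\<nu> n) (2*(k+i)) / K^(k+2*i) < e"
    moreover have "tail_moment (\<nu> n) K k \<ge> 0" by (rule Bochner_Integration.integral_nonneg) auto
    ultimately show "norm (tail_moment (\<nu> n) K k - 0) < e" using le[of n i] by simp
  qed
  then show "\<exists>N. \<forall>n\<ge>N. norm (tail_moment (\<nu> n) K k - 0) < e" by (simp add: eventually_sequentially)
qed

text \<open>The constant sequence is a case of the preceding limit. So a law with these moment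
  bounds has no mass beyond any K > C.\<close>

lemma tail_moment_eq_0:
  assumes am: "all_moments \<mu>"
    and bd: "\<And>m. m \<ge> 1 \<Longrightarrow> moment \<mu> (2*m) \<le> C ^ (2*m)"
    and CK: "0 < C" "C < K"
  shows "tail_moment \<mu> K k = 0"
  using tail_moment_tendsto_0[of "\<lambda>_. \<mu>" "moment \<mu>" C K k] assms LIMSEQ_unique[OF tendsto_const] by fastforce

text \<open>A bounded continuous f is close to a polynomial p on [-K, K]. Outside, |f - p| is at
  most 1 plus the absolute monomials of p, and their tail moments, collected in T, vanish in the
  limit.\<close>

theorem moments_tendsto_imp_weak_conv:
  assumes am: "\<And>n::nat. all_moments (\<nu> n)" "all_moments \<mu>"
    and lim: "\<And>k. (\<lambda>n. moment (\<nu> n) k) \<longlonglongrightarrow> moment \<mu> k"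
    and bd: "\<And>m. m \<ge> 1 \<Longrightarrow> moment \<mu> (2*m) \<le> C ^ (2*m)"
    and C: "0 < C"
  shows "weak_conv_m \<nu> \<mu>"
proof (rule integral_bdd_continuous_conv_imp_weak_conv)
  show "real_distribution (\<nu> n)" "real_distribution \<mu>" for n using am by (auto simp: all_moments_def)
  fix f :: "real \<Rightarrow> real" assume f: "\<And>x. isCont f x" "\<And>x. \<bar>f x\<bar> \<le> 1"
  define K where "K = C + 1"
  have CK: "C < K" by (simp add: K_def)
  have fm[measurable]: "f \<in> borel_measurable borel"
    using f by (intro borel_measurable_continuous_onI) (auto simp: continuous_on_eq_continuous_at)
  show "(\<lambda>n. integral\<^sup>L (\<nu> n) f) \<longlonglongrightarrow> integral\<^sup>L \<mu> f"
  proof (rule LIMSEQ_I)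
    fix e' :: real assume e': "e' > 0"
    \<comment> \<open>Four errors: the approximation by p under each of the two measures, the tail
      term T of \<open>\<nu> n\<close>, and the difference of the moments of p. The tail term of
      \<mu> is 0.\<close>
    define e where "e = e' / 4"
    have e: "e > 0" using e' by (simp add: e_def)
    obtain p where p: "real_polynomial_function p" "\<And>x. x \<in> {-K..K} \<Longrightarrow> \<bar>f x - p x\<bar> < e"
      using Stone_Weierstrass_real_polynomial_function[of "{-K..K}" f e] f e
      by (auto simp: continuous_at_imp_continuous_on)
    obtain a d where pa: "p = (\<lambda>x. \<Sum>i\<le>d. a i * x ^ i)"
      using p(1) by (auto simp: real_polynomial_function_iff_sum)
    define T where "T \<nu> = tail_moment \<nu> K 0 + (\<Sum>i\<le>d. \<bar>a i\<bar> * tail_moment \<nu> K i)" for \<nu>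
    have main: "\<bar>integral\<^sup>L \<nu> f - (\<Sum>i\<le>d. a i * moment \<nu> i)\<bar> \<le> e + T \<nu>" if am: "all_moments \<nu>" for \<nu>
    proof -
      interpret real_distribution \<nu> using am by (simp add: all_moments_def)
      have im: "integrable \<nu> (\<lambda>x. x ^ i)" for i using am by (simp add: all_moments_def)
      have ip: "integrable \<nu> p" unfolding pa using im by auto
      have iF: "integrable \<nu> f" by (rule integrable_const_bound[of _ 1]) (use f in auto)
      let ?i = "\<lambda>x. indicator {x. \<bar>x\<bar> > K} x :: real"
      let ?g = "\<lambda>x. e + (?i x * \<bar>x\<bar>^0 + (\<Sum>i\<le>d. \<bar>a i\<bar> * (?i x * \<bar>x\<bar> ^ i)))"
      have ig: "integrable \<nu> ?g"
        by (intro Bochner_Integration.integrable_add Bochner_Integration.integrable_sum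
            integrable_mult_right all_moments_tail_integrable[OF am] integrable_const)
      have "(\<Sum>i\<le>d. a i * moment \<nu> i) = integral\<^sup>L \<nu> p" unfolding pa using im by simp
      then have "\<bar>integral\<^sup>L \<nu> f - (\<Sum>i\<le>d. a i * moment \<nu> i)\<bar> = \<bar>\<integral>x. f x - p x \<partial>\<nu>\<bar>"
        using ip iF by simp
      also have "\<dots> \<le> (\<integral>x. \<bar>f x - p x\<bar> \<partial>\<nu>)" by (rule integral_abs_bound)
      also have "\<dots> \<le> (\<integral>x. ?g x \<partial>\<nu>)"
      proof (rule integral_mono[OF _ ig])
        show "integrable \<nu> (\<lambda>x. \<bar>f x - p x\<bar>)" using ip iF by auto
        fix x
        show "\<bar>f x - p x\<bar> \<le> ?g x"
        proof (cases "\<bar>x\<bar> > K")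
          case True
          have "\<bar>p x\<bar> \<le> (\<Sum>i\<le>d. \<bar>a i\<bar> * \<bar>x\<bar> ^ i)" unfolding pa
            by (rule order_trans[OF sum_abs]) (simp add: abs_mult power_abs)
          then show ?thesis using True f(2)[of x] e by simp
        next
          case False
          then have "\<bar>f x - p x\<bar> < e" by (intro p(2)) auto
          then show ?thesis using False by simp
        qed
      qed
      also have "\<dots> = e + T \<nu>"
      proof -
        have "(\<integral>x. (?i x * \<bar>x\<bar>^0 + (\<Sum>i\<le>d. \<bar>a i\<bar> * (?i x * \<bar>x\<bar> ^ i))) \<partial>\<nu>) = T \<nu>"
        proof -
          note it = all_moments_tail_integrable[OF am, of K]
          have "(\<integral>x. (?i x * \<bar>x\<bar>^0 + (\<Sum>i\<le>d. \<bar>a i\<bar> * (?i x * \<bar>x\<bar> ^ i))) \<partial>\<nu>)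
             = tail_moment \<nu> K 0 + (\<integral>x. (\<Sum>i\<le>d. \<bar>a i\<bar> * (?i x * \<bar>x\<bar> ^ i)) \<partial>\<nu>)"
            by (intro Bochner_Integration.integral_add Bochner_Integration.integrable_sum integrable_mult_right it)
          also have "(\<integral>x. (\<Sum>i\<le>d. \<bar>a i\<bar> * (?i x * \<bar>x\<bar> ^ i)) \<partial>\<nu>) = (\<Sum>i\<le>d. \<bar>a i\<bar> * tail_moment \<nu> K i)"
            by (subst Bochner_Integration.integral_sum)
              (rule integrable_mult_right[OF it], simp only: Bochner_Integration.integral_mult_right_zero)
          finally show ?thesis by (simp only: T_def)
        qed
        moreover have "(\<integral>x. ?g x \<partial>\<nu>) = (\<integral>x. e \<partial>\<nu>) + (\<integral>x. (?i x * \<bar>x\<bar>^0 + (\<Sum>i\<le>d. \<bar>a i\<bar> * (?i x * \<bar>x\<bar> ^ i))) \<partial>\<nu>)"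
          by (intro Bochner_Integration.integral_add Bochner_Integration.integrable_add Bochner_Integration.integrable_sum
            integrable_mult_right all_moments_tail_integrable[OF am] integrable_const)
        moreover have "measure \<nu> UNIV = 1" using prob_space by simp
        ultimately show ?thesis by simp
      qed
      finally show ?thesis .
    qed
    have T\<mu>: "T \<mu> = 0" unfolding T_def
      by (simp only: tail_moment_eq_0[OF am(2) bd C CK]) simp
    have "(\<lambda>n. T (\<nu> n)) \<longlonglongrightarrow> 0 + (\<Sum>i\<le>d. \<bar>a i\<bar> * 0)" unfolding T_def
      by (intro tendsto_add tendsto_sum tendsto_mult tendsto_const tail_moment_tendsto_0[OF am(1) lim bd C CK])
    then have 1: "\<forall>\<^sub>F n in sequentially. T (\<nu> n) < e" using e by (intro order_tendstoD) auto
    have "(\<lambda>n. \<bar>(\<Sum>i\<le>d. a i * moment (\<nu> n) i) - (\<Sum>i\<le>d. a i * moment \<mu> i)\<bar>) \<longlonglongrightarrow>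
        \<bar>(\<Sum>i\<le>d. a i * moment \<mu> i) - (\<Sum>i\<le>d. a i * moment \<mu> i)\<bar>"
      by (intro tendsto_rabs tendsto_diff tendsto_sum tendsto_mult tendsto_const lim)
    then have 2: "\<forall>\<^sub>F n in sequentially. \<bar>(\<Sum>i\<le>d. a i * moment (\<nu> n) i) - (\<Sum>i\<le>d. a i * moment \<mu> i)\<bar> < e"
      using e by (intro order_tendstoD) auto
    have "\<forall>\<^sub>F n in sequentially. norm (integral\<^sup>L (\<nu> n) f - integral\<^sup>L \<mu> f) < e'"
      using 1 2
    proof eventually_elim
      case (elim n)
      have "4 * e = e'" by (simp add: e_def)
      then show ?case using main[OF am(1)[of n]] main[OF am(2)] T\<mu> elim unfolding real_norm_def by linarith
    qed
    then show "\<exists>N. \<forall>n\<ge>N. norm (integral\<^sup>L (\<nu> n) f - integral\<^sup>L \<mu> f) < e'"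
      by (simp add: eventually_sequentially)
  qed
qed

section \<open>Distribution functions and the Levy distance\<close>

lemma exists_continuity_point:
  assumes "real_distribution \<mu>" "a < b"
  shows "\<exists>x. a < x \<and> x < b \<and> isCont (cdf \<mu>) x"
proof -
  interpret real_distribution \<mu> by fact
  have "mono (cdf \<mu>)" by (auto simp: mono_def cdf_nondecreasing)
  then have "countable {x. \<not> isCont (cdf \<mu>) x}" by (rule mono_ctble_discont)
  then have "\<not> {a<..<b} \<subseteq> {x. \<not> isCont (cdf \<mu>) x}"
    using uncountable_open_interval[of a b] assms countable_subset by blast
  then show ?thesis by auto
qed

text \<open>The distribution functions agree at the continuity points of \<open>cdf \<mu>\<close>,
  which are dense, and right continuity extends this to every point.\<close>

lemma weak_conv_const_imp_eq:
  assumes rd: "real_distribution \<nu>" "real_distribution \<mu>" and w: "weak_conv_m (\<lambda>_. \<nu>) \<mu>"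
  shows "\<nu> = \<mu>"
proof (rule cdf_unique[OF rd], rule ext)
  fix x
  interpret n: real_distribution \<nu> by fact
  interpret m: real_distribution \<mu> by fact
  have eq: "cdf \<nu> y = cdf \<mu> y" if "isCont (cdf \<mu>) y" for y
    using w that LIMSEQ_unique[OF tendsto_const] by (auto simp: weak_conv_m_def weak_conv_def)
  have "\<forall>n. \<exists>y. x < y \<and> y < x + 1 / Suc n \<and> isCont (cdf \<mu>) y"
    using exists_continuity_point[OF rd(2)] by simp
  then obtain y where y: "\<And>n. x < y n" "\<And>n. y n < x + 1 / Suc n" "\<And>n. isCont (cdf \<mu>) (y n)" by metis
  have "(\<lambda>n. x + 1 / Suc n) \<longlonglongrightarrow> x + 0" by (intro tendsto_add tendsto_const LIMSEQ_Suc lim_1_over_n)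
  then have "y \<longlonglongrightarrow> x" using y(1,2)
    by (intro real_tendsto_sandwich[of "\<lambda>_. x" y _ "\<lambda>n. x + 1 / Suc n"]) (auto simp: less_imp_le)
  then have f: "filterlim y (at_right x) sequentially"
    using y(1) by (auto simp: filterlim_at less_imp_neq[symmetric])
  have "(\<lambda>n. cdf \<nu> (y n)) \<longlonglongrightarrow> cdf \<nu> x" "(\<lambda>n. cdf \<mu> (y n)) \<longlonglongrightarrow> cdf \<mu> x"
    using f n.cdf_is_right_cont[of x] m.cdf_is_right_cont[of x]
    by (auto simp: continuous_within intro: filterlim_compose)
  then show "cdf \<nu> x = cdf \<mu> x" using eq[OF y(3)] LIMSEQ_unique by auto
qed

lemma levy_dist_le:
  assumes "e > 0" "\<And>x. cdf \<nu> (x - e) - e \<le> cdf \<mu> x" "\<And>x. cdf \<mu> x \<le> cdf \<nu> (x + e) + e"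
  shows "levy_dist \<nu> \<mu> \<le> e"
  unfolding levy_dist_def
  by (rule cInf_lower) (use assms in \<open>auto intro!: bdd_belowI[of _ 0]\<close>)

text \<open>\<open>Inf\<close> says nothing about an empty set of reals; the witness 1, which always
  works for functions with values in [0, 1], gives the Levy distance its meaning.\<close>

lemma levy_set_ne:
  assumes "\<And>x. cdf \<nu> x \<le> 1" "real_distribution \<mu>"
  shows "{\<epsilon>. \<epsilon> > 0 \<and> (\<forall>x. cdf \<nu> (x - \<epsilon>) - \<epsilon> \<le> cdf \<mu> x \<and> cdf \<mu> x \<le> cdf \<nu> (x + \<epsilon>) + \<epsilon>)} \<noteq> {}"
proof -
  interpret real_distribution \<mu> by fact
  have "1 \<in> {\<epsilon>. \<epsilon> > 0 \<and> (\<forall>x. cdf \<nu> (x - \<epsilon>) - \<epsilon> \<le> cdf \<mu> x \<and> cdf \<mu> x \<le> cdf \<nu> (x + \<epsilon>) + \<epsilon>)}"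
    using assms(1) cdf_nonneg cdf_bounded_prob
    by (auto intro: order_trans[of _ 0] order_trans[of _ 1] simp: cdf_def2)
  then show ?thesis by blast
qed

lemma levy_dist_nonneg:
  assumes "\<And>x. cdf \<nu> x \<le> 1" "real_distribution \<mu>"
  shows "levy_dist \<nu> \<mu> \<ge> 0"
  unfolding levy_dist_def by (rule cInf_greatest[OF levy_set_ne[OF assms]]) auto

text \<open>Choose one continuity point of \<open>cdf \<mu>\<close> in every cell of a grid of width
  h = e/2. Finitely many of them control the middle part: passing from x to a chosen point of a
  neighbouring cell moves it by less than 2h = e, and monotonicity does the rest. Far out,
  \<open>cdf \<mu>\<close> is within h of 0 or 1.\<close>

lemma weak_conv_imp_levy_dist_small:
  assumes rd: "\<And>n. real_distribution (\<nu> n)" "real_distribution \<mu>" and w: "weak_conv_m \<nu> \<mu>" and e: "e > 0"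
  shows "\<forall>\<^sub>F n in sequentially. levy_dist (\<nu> n) \<mu> \<le> e"
proof -
  interpret n: real_distribution "\<nu> n" for n by (rule rd)
  interpret m: real_distribution \<mu> by fact
  define h where "h = e/2"
  have h: "h > 0" using e by (simp add: h_def)
  have "\<forall>\<^sub>F x in at_bot. cdf \<mu> x < h" using m.cdf_lim_at_bot h by (intro order_tendstoD) auto
  then obtain a where a: "\<And>x. x \<le> a \<Longrightarrow> cdf \<mu> x < h" by (auto simp: eventually_at_bot_linorder)
  have "\<forall>\<^sub>F x in at_top. cdf \<mu> x > 1 - h" using m.cdf_lim_at_top_prob h by (intro order_tendstoD) auto
  then obtain b where b: "\<And>x. x \<ge> b \<Longrightarrow> cdf \<mu> x > 1 - h" by (auto simp: eventually_at_top_linorder)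
  obtain N :: int where N: "- (N * h) \<le> a" "N * h \<ge> b"
  proof -
    define N where "N = \<lceil>max (- a) b / h\<rceil>"
    have "max (-a) b / h \<le> N" unfolding N_def by (rule le_of_int_ceiling)
    then have "max (-a) b \<le> N * h" using h by (simp add: pos_divide_le_eq)
    then show ?thesis using that[of N] by auto
  qed
  have a': "x \<le> - N * h \<Longrightarrow> cdf \<mu> x < h" and b': "x \<ge> N * h \<Longrightarrow> cdf \<mu> x > 1 - h" for x
    using N a[of x] b[of x] by auto
  have "\<forall>i::int. \<exists>x. i * h < x \<and> x < (i+1) * h \<and> isCont (cdf \<mu>) x"
    using exists_continuity_point[OF rd(2)] h by simp
  then obtain g :: "int \<Rightarrow> real" where g: "\<And>i. i * h < g i" "\<And>i. g i < (i+1) * h" "\<And>i. isCont (cdf \<mu>) (g i)" by metis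
  have "\<forall>\<^sub>F n in sequentially. \<bar>cdf (\<nu> n) (g i) - cdf \<mu> (g i)\<bar> < h" for i
  proof -
    have "(\<lambda>n. \<bar>cdf (\<nu> n) (g i) - cdf \<mu> (g i)\<bar>) \<longlonglongrightarrow> \<bar>cdf \<mu> (g i) - cdf \<mu> (g i)\<bar>"
      using w g(3) by (intro tendsto_rabs tendsto_diff tendsto_const) (auto simp: weak_conv_m_def weak_conv_def)
    then show ?thesis using h by (intro order_tendstoD) auto
  qed
  \<comment> \<open>The points used are those with indices -N - 1, N + 1 and i - 1, i + 1 for -N
    \<le> i \<le> N. The absolute value is there because N may be negative.\<close>
  then have "\<forall>\<^sub>F n in sequentially. \<forall>i\<in>{- \<bar>N\<bar> - 2..\<bar>N\<bar> + 2}. \<bar>cdf (\<nu> n) (g i) - cdf \<mu> (g i)\<bar> < h"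
    by (intro eventually_ball_finite) auto
  then show ?thesis
  proof eventually_elim
    case (elim n)
    have mono: "x \<le> y \<Longrightarrow> cdf \<mu> x \<le> cdf \<mu> y" "x \<le> y \<Longrightarrow> cdf (\<nu> n) x \<le> cdf (\<nu> n) y" for x y
      by (auto intro: m.cdf_nondecreasing n.cdf_nondecreasing)
    have el: "cdf (\<nu> n) (g i) < cdf \<mu> (g i) + h" "cdf \<mu> (g i) < cdf (\<nu> n) (g i) + h"
      if "- \<bar>N\<bar> - 2 \<le> i" "i \<le> \<bar>N\<bar> + 2" for i
      using elim[rule_format, of i] that by (auto simp: abs_less_iff)
    show ?case
    proof (rule levy_dist_le[OF e])
      fix x
      define i where "i = \<lfloor>x/h\<rfloor>"
      have i: "i * h \<le> x" "x < (i+1) * h"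
        using pos_le_divide_eq[OF h, of "real_of_int i" x] pos_divide_less_eq[OF h, of x "real_of_int i + 1"]
          of_int_floor_le[of "x/h"] real_of_int_floor_add_one_gt[of "x/h"]
        by (auto simp: i_def)
      have low: "x \<le> - N * h" if "i < - N"
      proof -
        have "real_of_int (i + 1) * h \<le> real_of_int (- N) * h" using that h by (intro mult_right_mono) auto
        then show ?thesis using i by simp
      qed
      have high: "x \<ge> N * h + h" if "i > N"
      proof -
        have "real_of_int (N + 1) * h \<le> real_of_int i * h" using that h by (intro mult_right_mono) auto
        then show ?thesis using i by (simp add: algebra_simps)
      qed
      show "cdf (\<nu> n) (x - e) - e \<le> cdf \<mu> x"
      proof -
        consider "i > N" | "i < - N" | "- N \<le> i" "i \<le> N" by linarith
        then show ?thesis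
        proof cases
          case 1
          then have "cdf \<mu> x > 1 - h" using high h by (intro b') auto
          then show ?thesis using n.cdf_bounded_prob[of n "x-e"] h by (simp add: h_def)
        next
          case 2
          have "x - e \<le> g (-N-1)" using low[OF 2] g(1)[of "-N-1"] h by (simp add: h_def algebra_simps)
          then have "cdf (\<nu> n) (x - e) \<le> cdf (\<nu> n) (g (-N-1))" by (rule mono)
          also have "\<dots> < cdf \<mu> (g (-N-1)) + h" by (intro el) auto
          also have "cdf \<mu> (g (-N-1)) < h" using g(2)[of "-N-1"] by (intro a') simp
          finally show ?thesis using m.cdf_nonneg[of x] by (simp add: h_def)
        next
          case 3
          have "x - e \<le> g (i-1)" "g (i-1) \<le> x" using i g(1)[of "i-1"] g(2)[of "i-1"] by (auto simp: h_def algebra_simps)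
          then have "cdf (\<nu> n) (x - e) \<le> cdf (\<nu> n) (g (i-1))" "cdf \<mu> (g (i-1)) \<le> cdf \<mu> x" by (auto intro: mono)
          moreover have "cdf (\<nu> n) (g (i-1)) < cdf \<mu> (g (i-1)) + h" using 3 by (intro el) auto
          ultimately show ?thesis using h by (simp add: h_def)
        qed
      qed
      show "cdf \<mu> x \<le> cdf (\<nu> n) (x + e) + e"
      proof -
        consider "i > N" | "i < - N" | "- N \<le> i" "i \<le> N" by linarith
        then show ?thesis
        proof cases
          case 2
          then have "cdf \<mu> x < h" using low by (intro a') auto
          then show ?thesis using n.cdf_nonneg[of n "x+e"] h by (simp add: h_def)
        next
          case 1
          have "g (N+1) \<le> x + e" using high[OF 1] g(2)[of "N+1"] h by (simp add: h_def algebra_simps)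
          then have "cdf (\<nu> n) (g (N+1)) \<le> cdf (\<nu> n) (x + e)" by (rule mono)
          moreover have "cdf \<mu> (g (N+1)) < cdf (\<nu> n) (g (N+1)) + h" by (intro el) auto
          moreover have "cdf \<mu> (g (N+1)) > 1 - h" using g(1)[of "N+1"] h by (intro b') (simp add: algebra_simps)
          ultimately show ?thesis using m.cdf_bounded_prob[of x] by (simp add: h_def)
        next
          case 3
          have "x \<le> g (i+1)" "g (i+1) \<le> x + e" using i g(1)[of "i+1"] g(2)[of "i+1"] by (auto simp: h_def algebra_simps)
          then have "cdf \<mu> x \<le> cdf \<mu> (g (i+1))" "cdf (\<nu> n) (g (i+1)) \<le> cdf (\<nu> n) (x + e)" by (auto intro: mono)
          moreover have "cdf \<mu> (g (i+1)) < cdf (\<nu> n) (g (i+1)) + h" using 3 by (intro el) auto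
          ultimately show ?thesis using h by (simp add: h_def)
        qed
      qed
    qed
  qed
qed

theorem moments_determine:
  assumes am: "all_moments \<nu>" "all_moments \<mu>" and eq: "\<And>k. moment \<nu> k = moment \<mu> k"
    and bd: "\<And>m. m \<ge> 1 \<Longrightarrow> moment \<mu> (2*m) \<le> C ^ (2*m)" and C: "0 < C"
  shows "\<nu> = \<mu>"
  using am by (intro weak_conv_const_imp_eq moments_tendsto_imp_weak_conv[of "\<lambda>_. \<nu>" \<mu> C] bd C)
    (auto simp: eq all_moments_def)

text \<open>A sequence of counterexamples, the j-th with moments up to order j within 1/(j + 1),
  would converge weakly. In this uniform form the result can be applied to a random measure outcome
  by outcome, and only finitely many moments have to be controlled.\<close>

theorem moments_close_imp_levy_close:
  assumes am: "all_moments \<mu>"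
    and bd: "\<And>m. m \<ge> 1 \<Longrightarrow> moment \<mu> (2*m) \<le> C ^ (2*m)" and C: "0 < C" and e: "e > 0"
  shows "\<exists>J. \<exists>\<delta>>0. \<forall>\<nu>. all_moments \<nu> \<longrightarrow> (\<forall>k\<le>J. \<bar>moment \<nu> k - moment \<mu> k\<bar> < \<delta>) \<longrightarrow> levy_dist \<nu> \<mu> \<le> e"
proof (rule ccontr)
  assume "\<not> ?thesis"
  then have "\<forall>j. \<exists>\<nu>. all_moments \<nu> \<and> (\<forall>k\<le>j. \<bar>moment \<nu> k - moment \<mu> k\<bar> < 1 / Suc j) \<and> \<not> levy_dist \<nu> \<mu> \<le> e"
    by (metis of_nat_0_less_iff zero_less_Suc zero_less_divide_1_iff)
  then obtain \<nu> where \<nu>: "\<And>j. all_moments (\<nu> j)" "\<And>j k. k \<le> j \<Longrightarrow> \<bar>moment (\<nu> j) k - moment \<mu> k\<bar> < 1 / Suc j"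
    "\<And>j. \<not> levy_dist (\<nu> j) \<mu> \<le> e" by metis
  have "(\<lambda>j. moment (\<nu> j) k) \<longlonglongrightarrow> moment \<mu> k" for k
  proof (rule LIM_zero_cancel, rule tendsto_0_le[OF lim_inverse_n'[THEN LIMSEQ_Suc], where K=1])
    show "\<forall>\<^sub>F j in sequentially. norm (moment (\<nu> j) k - moment \<mu> k) \<le> norm (1 / real (Suc j)) * 1"
      using eventually_ge_at_top[of k] by eventually_elim (use \<nu>(2) in \<open>auto simp: less_imp_le\<close>)
  qed
  then have "weak_conv_m \<nu> \<mu>" by (intro moments_tendsto_imp_weak_conv[OF \<nu>(1) am _ bd C])
  then have "\<forall>\<^sub>F j in sequentially. levy_dist (\<nu> j) \<mu> \<le> e"
    using \<nu>(1) am e by (intro weak_conv_imp_levy_dist_small) (auto simp: all_moments_def)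
  then show False using \<nu>(3) by (auto simp: eventually_sequentially)
qed

text \<open>Bounded second moments give tightness and hence a weak subsequential limit M0. Powers
  are unbounded, so their integrals need not follow weak convergence directly; powers of the
  truncation c do, and replacing x by c x costs at most twice a tail moment.\<close>

theorem exists_limit_moments:
  assumes am: "\<And>n::nat. all_moments (\<nu> n)"
    and lim: "\<And>k. (\<lambda>n. moment (\<nu> n) k) \<longlonglongrightarrow> \<beta> k"
    and bd: "\<And>m. m \<ge> 1 \<Longrightarrow> \<beta> (2*m) \<le> C ^ (2*m)" and C: "0 < C"
  shows "\<exists>\<mu>. all_moments \<mu> \<and> (\<forall>k. moment \<mu> k = \<beta> k)"
proof -
  interpret real_distribution "\<nu> n" for n using am by (simp add: all_moments_def)
  have im: "integrable (\<nu> n) (\<lambda>x. x ^ k)" for n k using am by (simp add: all_moments_def)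
  obtain B where B: "\<And>n. moment (\<nu> n) 2 \<le> B" "B > 0"
    using convergent_imp_Bseq[OF convergentI[OF lim[of 2]]] by (auto simp: Bseq_def abs_le_iff)
  have "tight \<nu>"
    unfolding tight_def
  proof (intro conjI allI impI)
    show "real_distribution (\<nu> n)" for n by unfold_locales
    fix e :: real assume e: "e > 0"
    \<comment> \<open>Chebyshev's inequality leaves mass at most B / a^2 = e / 2 outside the
      interval.\<close>
    define a where "a = sqrt (2 * B / e)"
    have a: "a > 0" "a^2 = 2 * B / e" using e B by (auto simp: a_def)
    have "measure (\<nu> n) {-a<..a} > 1 - e" for n
    proof -
      have "1 - measure (\<nu> n) {-a<..a} = (\<integral>x. 1 - indicator {-a<..a} x \<partial>\<nu> n)"
      proof -
        have "measure (\<nu> n) UNIV = 1" using prob_space[of n] by simp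
        moreover have "integrable (\<nu> n) (indicator {-a<..a} :: real \<Rightarrow> real)"
          by (rule integrable_const_bound[of _ 1]) auto
        ultimately show ?thesis by simp
      qed
      also have "\<dots> \<le> (\<integral>x. x^2 / a^2 \<partial>\<nu> n)"
      proof (rule integral_mono)
        show "integrable (\<nu> n) (\<lambda>x. x^2 / a^2)" using im by simp
        show "integrable (\<nu> n) (\<lambda>x. 1 - indicator {-a<..a} x :: real)"
          by (rule integrable_const_bound[of _ 1]) (auto split: split_indicator)
        fix x :: real
        show "1 - indicator {-a<..a} x \<le> x^2 / a^2"
        proof (cases "x \<in> {-a<..a}")
          case False
          then have "\<bar>a\<bar> \<le> \<bar>x\<bar>" using a by auto
          then have "a^2 \<le> x^2" by (simp add: abs_le_square_iff)
          moreover have "0 < a^2" using a(1) by (rule zero_less_power)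
          ultimately have "1 \<le> x^2 / a^2" by (simp only: le_divide_eq_1_pos)
          then show ?thesis using False by simp
        qed simp
      qed
      also have "\<dots> = moment (\<nu> n) 2 / a^2" by simp
      also have "\<dots> \<le> B / a^2" using B(1) by (intro divide_right_mono) auto
      also have "\<dots> = e / 2" using a B e by simp
      finally show ?thesis using e by simp
    qed
    then show "\<exists>a b. a < b \<and> (\<forall>n. measure (\<nu> n) {a<..b} > 1 - e)"
      using a by (intro exI[of _ "-a"] exI[of _ a]) auto
  qed
  then obtain r M0 where r: "strict_mono (r::nat\<Rightarrow>nat)" and M0: "real_distribution M0" "weak_conv_m (\<nu> \<circ> r) M0"
    using tight_imp_convergent_subsubsequence[of \<nu> "\<lambda>x. x"] by (auto simp: strict_mono_def comp_def)
  interpret M0: real_distribution M0 by fact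
  define K where "K = C + 1"
  have CK: "C < K" "K > 0" using C by (auto simp: K_def)
  define c where "c x = max (-K) (min K x)" for x
  have c: "continuous_on UNIV c" unfolding c_def by (intro continuous_intros)
  have cb: "\<bar>c x\<bar> \<le> K" for x using CK by (auto simp: c_def)
  have [measurable]: "c \<in> borel_measurable borel" using c by (rule borel_measurable_continuous_onI)
  \<comment> \<open>The limit law is the truncated image of M0, so that all its moments exist at
    once.\<close>
  define \<mu> where "\<mu> = distr M0 borel c"
  have rd: "real_distribution \<mu>" unfolding \<mu>_def by (rule M0.real_distribution_distr) simp
  have ic: "integrable M0 (\<lambda>x. c x ^ k)" for k
    by (rule M0.integrable_const_bound[of _ "K^k"]) (auto simp: power_abs intro!: power_mono cb)
  have mc: "moment \<mu> k = (\<integral>x. c x ^ k \<partial>M0)" for k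
    unfolding \<mu>_def by (subst integral_distr) auto
  have "all_moments \<mu>" unfolding all_moments_def
    using rd ic by (auto simp: \<mu>_def integrable_distr_eq)
  moreover have "moment \<mu> k = \<beta> k" for k
  proof -
    have 1: "(\<lambda>n. \<integral>x. c x ^ k \<partial>(\<nu> (r n))) \<longlonglongrightarrow> (\<integral>x. c x ^ k \<partial>M0)"
    proof (rule weak_conv_imp_integral_bdd_continuous_conv[of "\<lambda>n. \<nu> (r n)" M0 "\<lambda>x. c x ^ k" "K^k"])
      show "isCont (\<lambda>x. c x ^ k) x" for x
        using c by (intro continuous_intros) (simp add: continuous_on_eq_continuous_at)
      show "norm (c x ^ k) \<le> K ^ k" for x by (auto simp: power_abs intro!: power_mono cb)
    qed (use M0 in \<open>auto simp: comp_def intro: real_distribution_axioms\<close>)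
    have b: "\<bar>(\<integral>x. c x ^ k \<partial>(\<nu> n)) - moment (\<nu> n) k\<bar> \<le> 2 * tail_moment (\<nu> n) K k" for n
    proof -
      have ic: "integrable (\<nu> n) (\<lambda>x. c x ^ k)"
        by (rule integrable_const_bound[of _ "K^k"]) (auto simp: power_abs intro!: power_mono cb)
      have "\<bar>(\<integral>x. c x ^ k \<partial>(\<nu> n)) - moment (\<nu> n) k\<bar> = \<bar>\<integral>x. c x ^ k - x ^ k \<partial>(\<nu> n)\<bar>"
        using ic im by simp
      also have "\<dots> \<le> (\<integral>x. \<bar>c x ^ k - x ^ k\<bar> \<partial>(\<nu> n))" by (rule integral_abs_bound)
      also have "\<dots> \<le> (\<integral>x. 2 * (indicator {x. \<bar>x\<bar> > K} x * \<bar>x\<bar> ^ k) \<partial>(\<nu> n))"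
      proof (rule integral_mono)
        show "integrable (\<nu> n) (\<lambda>x. \<bar>c x ^ k - x ^ k\<bar>)" using ic im by auto
        show "integrable (\<nu> n) (\<lambda>x. 2 * (indicator {x. \<bar>x\<bar> > K} x * \<bar>x\<bar> ^ k))"
          by (intro integrable_mult_right all_moments_tail_integrable am)
        fix x
        show "\<bar>c x ^ k - x ^ k\<bar> \<le> 2 * (indicator {x. \<bar>x\<bar> > K} x * \<bar>x\<bar> ^ k)"
        proof (cases "\<bar>x\<bar> > K")
          case True
          have "\<bar>c x ^ k - x ^ k\<bar> \<le> \<bar>c x\<bar> ^ k + \<bar>x\<bar> ^ k"
            by (rule order_trans[OF abs_triangle_ineq4]) (simp add: power_abs)
          also have "\<bar>c x\<bar> ^ k \<le> \<bar>x\<bar> ^ k" using True cb[of x] by (intro power_mono) auto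
          finally show ?thesis using True by simp
        next
          case False
          then have "c x = x" by (auto simp: c_def)
          then show ?thesis by simp
        qed
      qed
      finally show ?thesis by simp
    qed
    have "(\<lambda>n. 2 * tail_moment (\<nu> n) K k) \<longlonglongrightarrow> 2 * 0"
      by (intro tendsto_mult tendsto_const tail_moment_tendsto_0[OF am lim bd C CK(1)])
    then have t: "(\<lambda>n. 2 * tail_moment (\<nu> n) K k) \<longlonglongrightarrow> 0" by (simp only: mult_zero_right)
    have "(\<lambda>n. (\<integral>x. c x ^ k \<partial>(\<nu> n)) - moment (\<nu> n) k) \<longlonglongrightarrow> 0"
      by (rule Lim_null_comparison[OF _ t], rule always_eventually, rule allI, unfold real_norm_def, rule b)
    then have "(\<lambda>n. (\<integral>x. c x ^ k \<partial>(\<nu> n)) - moment (\<nu> n) k + moment (\<nu> n) k) \<longlonglongrightarrow> 0 + \<beta> k"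
      by (intro tendsto_add lim)
    then have "(\<lambda>n. \<integral>x. c x ^ k \<partial>(\<nu> n)) \<longlonglongrightarrow> \<beta> k" by simp
    then have "(\<lambda>n. \<integral>x. c x ^ k \<partial>(\<nu> (r n))) \<longlonglongrightarrow> \<beta> k"
      using LIMSEQ_subseq_LIMSEQ[OF _ r] by (simp add: comp_def)
    then show ?thesis using 1 LIMSEQ_unique mc by metis
  qed
  ultimately show ?thesis by blast
qed

section \<open>Measurability of the Levy distance\<close>

lemma exists_rat_seq_at_right:
  fixes x :: real
  obtains y where "\<And>n. y n \<in> \<rat>" "\<And>n. x < y n" "y \<longlonglongrightarrow> x"
proof -
  have "\<forall>n. \<exists>y\<in>\<rat>. x < y \<and> y < x + 1 / Suc n" by (auto intro!: Rats_dense_in_real)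
  then obtain y where y: "\<And>n. y n \<in> \<rat>" "\<And>n. x < y n" "\<And>n. y n < x + 1 / Suc n" by metis
  have "(\<lambda>n. x + 1 / Suc n) \<longlonglongrightarrow> x + 0" by (intro tendsto_add tendsto_const LIMSEQ_Suc lim_1_over_n)
  then have "y \<longlonglongrightarrow> x" using y(2,3)
    by (intro real_tendsto_sandwich[of "\<lambda>_. x" y _ "\<lambda>n. x + 1 / Suc n"]) (auto simp: less_imp_le)
  then show ?thesis using that y by blast
qed

lemma (in finite_borel_measure) cdf_tendsto_right:
  assumes "\<And>n. x < y n" "y \<longlonglongrightarrow> x"
  shows "(\<lambda>n. cdf M (y n)) \<longlonglongrightarrow> cdf M x"
proof -
  have "filterlim y (at_right x) sequentially"
    using assms by (auto simp: filterlim_at less_imp_neq[symmetric])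
  then show ?thesis
    using cdf_is_right_cont[of x] by (auto simp: continuous_within intro: filterlim_compose)
qed

text \<open>Right continuity reduces the defining inequalities from all real x to rational x, and
  monotonicity in \<epsilon> lets the infimum be tested on rational \<epsilon>. The event that the
  distance is below c is thus a countable combination of events in terms of
  \<open>cdf (\<nu> \<omega>) t\<close>.\<close>

lemma borel_measurable_levy_dist:
  assumes fb: "\<And>\<omega>. finite_borel_measure (\<nu> \<omega>)" and le1: "\<And>\<omega> x. cdf (\<nu> \<omega>) x \<le> 1"
    and rd: "real_distribution \<mu>"
    and [measurable]: "\<And>t. (\<lambda>\<omega>. cdf (\<nu> \<omega>) t) \<in> borel_measurable M"
  shows "(\<lambda>\<omega>. levy_dist (\<nu> \<omega>) \<mu>) \<in> borel_measurable M"
proof (rule borel_measurableI_less)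
  fix c :: real
  interpret n: finite_borel_measure "\<nu> \<omega>" for \<omega> by (rule fb)
  interpret m: real_distribution \<mu> by fact
  define P where "P \<omega> \<epsilon> x \<longleftrightarrow> cdf (\<nu> \<omega>) (x - \<epsilon>) - \<epsilon> \<le> cdf \<mu> x \<and> cdf \<mu> x \<le> cdf (\<nu> \<omega>) (x + \<epsilon>) + \<epsilon>" for \<omega> \<epsilon> x
  have P_rat: "P \<omega> \<epsilon> x" if a: "\<forall>x\<in>\<rat>. P \<omega> \<epsilon> x" for \<omega> \<epsilon> x
  proof -
    obtain y where y: "\<And>n. y n \<in> \<rat>" "\<And>n. x < y n" "y \<longlonglongrightarrow> x"
      by (rule exists_rat_seq_at_right[of x]) blast
    have l: "(\<lambda>n. cdf (\<nu> \<omega>) (y n + s)) \<longlonglongrightarrow> cdf (\<nu> \<omega>) (x + s)" for s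
      using y by (intro n.cdf_tendsto_right tendsto_add tendsto_const) auto
    have m: "(\<lambda>n. cdf \<mu> (y n)) \<longlonglongrightarrow> cdf \<mu> x" using y by (intro m.cdf_tendsto_right) auto
    have "cdf (\<nu> \<omega>) (x - \<epsilon>) - \<epsilon> \<le> cdf \<mu> x"
      by (rule LIMSEQ_le[OF tendsto_diff[OF l[of "-\<epsilon>", simplified] tendsto_const] m])
        (use a y(1) in \<open>auto simp: P_def\<close>)
    moreover have "cdf \<mu> x \<le> cdf (\<nu> \<omega>) (x + \<epsilon>) + \<epsilon>"
      by (rule LIMSEQ_le[OF m tendsto_add[OF l[of "\<epsilon>"] tendsto_const]])
        (use a y(1) in \<open>auto simp: P_def\<close>)
    ultimately show "P \<omega> \<epsilon> x" by (simp add: P_def)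
  qed
  have up: "P \<omega> \<epsilon>' x" if "P \<omega> \<epsilon> x" "\<epsilon> \<le> \<epsilon>'" for \<omega> \<epsilon> \<epsilon>' x
    using that n.cdf_nondecreasing[of "x-\<epsilon>'" "x-\<epsilon>" \<omega>] n.cdf_nondecreasing[of "x+\<epsilon>" "x+\<epsilon>'" \<omega>]
    unfolding P_def by auto
  have "levy_dist (\<nu> \<omega>) \<mu> < c \<longleftrightarrow> (\<exists>q\<in>\<rat>. 0 < q \<and> q < c \<and> (\<forall>x\<in>\<rat>. P \<omega> q x))" for \<omega>
  proof -
    let ?E = "{\<epsilon>. \<epsilon> > 0 \<and> (\<forall>x. P \<omega> \<epsilon> x)}"
    have "levy_dist (\<nu> \<omega>) \<mu> = Inf ?E" unfolding levy_dist_def P_def ..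
    moreover have "?E \<noteq> {}" using levy_set_ne[OF le1 rd] unfolding P_def by blast
    moreover have "bdd_below ?E" by (rule bdd_belowI[of _ 0]) auto
    ultimately have "levy_dist (\<nu> \<omega>) \<mu> < c \<longleftrightarrow> (\<exists>e\<in>?E. e < c)" by (simp add: cInf_less_iff)
    also have "\<dots> \<longleftrightarrow> (\<exists>q\<in>\<rat>. 0 < q \<and> q < c \<and> (\<forall>x. P \<omega> q x))"
    proof safe
      fix e assume e: "e < c" "0 < e" "\<forall>x. P \<omega> e x"
      obtain q where "q \<in> \<rat>" "e < q" "q < c" using Rats_dense_in_real[OF e(1)] by auto
      then show "\<exists>q\<in>\<rat>. 0 < q \<and> q < c \<and> (\<forall>x. P \<omega> q x)" 
        using e up[of \<omega> e _ q] by (intro bexI[of _ q] conjI allI) auto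
    qed auto
    also have "\<dots> \<longleftrightarrow> (\<exists>q\<in>\<rat>. 0 < q \<and> q < c \<and> (\<forall>x\<in>\<rat>. P \<omega> q x))" using P_rat by blast
    finally show ?thesis .
  qed
  moreover have "{\<omega>\<in>space M. \<exists>q\<in>\<rat>. 0 < q \<and> q < c \<and> (\<forall>x\<in>\<rat>. P \<omega> q x)} \<in> sets M"
    unfolding P_def using countable_rat[measurable] by measurable
  ultimately show "{\<omega>\<in>space M. levy_dist (\<nu> \<omega>) \<mu> < c} \<in> sets M" by simp
qed

text \<open>A continuous function is a pointwise limit of polynomials (approximate within
  \<open>1/j\<close> on \<open>[-j, j]\<close>), so statistics of unordered tuples are measurable as soon as
  their power sums are.\<close>
lemma borel_measurable_sum_of_power_sums:
  fixes g :: "'a \<Rightarrow> nat \<Rightarrow> real"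
  assumes m: "\<And>k. (\<lambda>\<omega>. \<Sum>i<n. g \<omega> i ^ k) \<in> borel_measurable M"
  shows "(\<lambda>\<omega>. \<Sum>i<n. indicator {..t} (g \<omega> i) :: real) \<in> borel_measurable M"
proof -
  have cont: "(\<lambda>\<omega>. \<Sum>i<n. f (g \<omega> i)) \<in> borel_measurable M"
    if f: "continuous_on UNIV f" for f :: "real \<Rightarrow> real"
  proof -
    have "\<forall>j. \<exists>p. real_polynomial_function p \<and> (\<forall>x\<in>{- real j..real j}. \<bar>f x - p x\<bar> < 1 / Suc j)"
    proof
      fix j
      show "\<exists>p. real_polynomial_function p \<and> (\<forall>x\<in>{- real j..real j}. \<bar>f x - p x\<bar> < 1 / Suc j)"
        using Stone_Weierstrass_real_polynomial_function[of "{- real j..real j}" f "1 / Suc j"]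
          continuous_on_subset[OF f] by (metis compact_Icc of_nat_0_less_iff subset_UNIV zero_less_Suc zero_less_divide_1_iff)
    qed
    then obtain p where p: "\<And>j. real_polynomial_function (p j)"
      "\<And>j x. x \<in> {- real j..real j} \<Longrightarrow> \<bar>f x - p j x\<bar> < 1 / Suc j" by metis
    have lim: "(\<lambda>j. p j x) \<longlonglongrightarrow> f x" for x
    proof (rule LIM_zero_cancel, rule tendsto_0_le[OF lim_inverse_n'[THEN LIMSEQ_Suc], where K=1])
      obtain N where N: "\<bar>x\<bar> \<le> real N" using real_arch_simple by blast
      show "\<forall>\<^sub>F j in sequentially. norm (p j x - f x) \<le> norm (1 / real (Suc j)) * 1"
        using eventually_ge_at_top[of N]
      proof eventually_elim
        case (elim j)
        then have "x \<in> {- real j..real j}" using N by auto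
        from p(2)[OF this] show ?case by (simp add: abs_minus_commute)
      qed
    qed
    show ?thesis
    proof (rule borel_measurable_LIMSEQ_real)
      show "(\<lambda>j. \<Sum>i<n. p j (g \<omega> i)) \<longlonglongrightarrow> (\<Sum>i<n. f (g \<omega> i))" for \<omega>
        by (intro tendsto_sum lim)
      fix j
      obtain a d where pa: "p j = (\<lambda>x. \<Sum>i\<le>d. a i * x ^ i)"
        using p(1)[of j] by (auto simp: real_polynomial_function_iff_sum)
      have "(\<lambda>\<omega>. \<Sum>i<n. p j (g \<omega> i)) = (\<lambda>\<omega>. \<Sum>k\<le>d. a k * (\<Sum>i<n. g \<omega> i ^ k))"
        unfolding pa sum_distrib_left by (intro ext sum.swap)
      then show "(\<lambda>\<omega>. \<Sum>i<n. p j (g \<omega> i)) \<in> borel_measurable M"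
        using m by simp
    qed
  qed
  show ?thesis
  proof (rule borel_measurable_LIMSEQ_real)
    show "(\<lambda>\<omega>. \<Sum>i<n. cts_step t (t + 1 / Suc j) (g \<omega> i)) \<in> borel_measurable M" for j
      by (intro cont uniformly_continuous_imp_continuous cts_step_uniformly_continuous) simp
    \<comment> \<open>The ramps fall from 1 at t to 0 at t + 1/(j + 1), so in the limit exactly the
      points up to t keep the value 1.\<close>
    have "(\<lambda>j. cts_step t (t + 1 / Suc j) x) \<longlonglongrightarrow> indicator {..t} x" for x
    proof (cases "x \<le> t")
      case True then show ?thesis by (simp add: cts_step_def)
    next
      case False
      have "(\<lambda>j. t + 1 / Suc j) \<longlonglongrightarrow> t + 0" by (intro tendsto_add tendsto_const LIMSEQ_Suc lim_1_over_n)
      then have "\<forall>\<^sub>F j in sequentially. t + 1 / Suc j < x" using False by (intro order_tendstoD) auto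
      then have "\<forall>\<^sub>F j in sequentially. cts_step t (t + 1 / Suc j) x = 0"
        by eventually_elim (use False in \<open>auto simp: cts_step_def\<close>)
      then show ?thesis using False by (simp add: tendsto_eventually)
    qed
    then show "(\<lambda>j. \<Sum>i<n. cts_step t (t + 1 / Suc j) (g \<omega> i)) \<longlonglongrightarrow> (\<Sum>i<n. indicator {..t} (g \<omega> i) :: real)" for \<omega>
      by (intro tendsto_sum)
  qed
qed

section \<open>Eigenvalues and closed walks\<close>

definition mat_trace :: "'a::comm_monoid_add mat \<Rightarrow> 'a" where
  "mat_trace A = (\<Sum>i<dim_row A. A $$ (i,i))"

lemma index_mult_mat_sum:
  assumes "A \<in> carrier_mat n m" "B \<in> carrier_mat m k" "i < n" "j < k"
  shows "(A * B) $$ (i,j) = (\<Sum>l<m. A $$ (i,l) * B $$ (l,j))"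
  using assms by (auto simp: scalar_prod_def atLeast0LessThan intro!: sum.cong)

lemma mat_trace_mult_commute:
  fixes A B :: "'a::comm_semiring_0 mat"
  assumes A: "A \<in> carrier_mat n m" and B: "B \<in> carrier_mat m n"
  shows "mat_trace (A * B) = mat_trace (B * A)"
proof -
  have "mat_trace (A * B) = (\<Sum>i<n. \<Sum>l<m. A $$ (i,l) * B $$ (l,i))"
    using A B index_mult_mat_sum[OF A B] by (simp add: mat_trace_def)
  also have "\<dots> = (\<Sum>l<m. \<Sum>i<n. B $$ (l,i) * A $$ (i,l))"
    by (subst sum.swap) (simp add: mult.commute)
  also have "\<dots> = mat_trace (B * A)"
    using A B index_mult_mat_sum[OF B A] by (simp add: mat_trace_def)
  finally show ?thesis .
qed

lemma mat_trace_similar_pow: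
  fixes A :: "'a::comm_ring_1 mat"
  assumes A: "A \<in> carrier_mat n n" and sim: "similar_mat A B"
  shows "mat_trace (A ^\<^sub>m k) = mat_trace (B ^\<^sub>m k)"
proof -
  obtain P Q where w: "similar_mat_wit A B P Q" using sim by (auto simp: similar_mat_def)
  note D = similar_mat_witD2[OF A w]
  have "A ^\<^sub>m k = P * (B ^\<^sub>m k * Q)"
    using similar_mat_wit_pow_id[OF w] D by (simp add: assoc_mult_mat[of _ n n _ n _ n])
  moreover have "mat_trace (P * (B ^\<^sub>m k * Q)) = mat_trace (B ^\<^sub>m k * Q * P)"
    by (rule mat_trace_mult_commute[of _ n n]) (use D in auto)
  ultimately have "mat_trace (A ^\<^sub>m k) = mat_trace (B ^\<^sub>m k * Q * P)" by simp
  also have "B ^\<^sub>m k * Q * P = B ^\<^sub>m k" using D by (simp add: assoc_mult_mat[of _ n n _ n _ n])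
  finally show ?thesis .
qed

lemma upper_triangular_pow:
  fixes B :: "'a::comm_ring_1 mat"
  assumes B: "B \<in> carrier_mat n n" and u: "upper_triangular B"
  shows "upper_triangular (B ^\<^sub>m k) \<and> (\<forall>i<n. (B ^\<^sub>m k) $$ (i,i) = (B $$ (i,i)) ^ k)"
proof (induction k)
  case 0
  then show ?case using B by auto
next
  case (Suc k)
  have Bk: "B ^\<^sub>m k \<in> carrier_mat n n" using B by auto
  have z: "(B ^\<^sub>m k) $$ (i,j) = 0" if "j < i" "i < n" for i j
    using Suc Bk that by auto
  have zB: "B $$ (i,j) = 0" if "j < i" "i < n" for i j using u B that by auto
  have ix: "(B ^\<^sub>m Suc k) $$ (i,j) = (\<Sum>l<n. (B ^\<^sub>m k) $$ (i,l) * B $$ (l,j))" if "i < n" "j < n" for i j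
    using index_mult_mat_sum[OF Bk B] that by simp
  have "(B ^\<^sub>m Suc k) $$ (i,j) = 0" if "j < i" "i < n" for i j
  proof -
    have "(B ^\<^sub>m k) $$ (i,l) * B $$ (l,j) = 0" if "l < n" for l
      using z[of l i] zB[of j l] that \<open>j < i\<close> \<open>i < n\<close> by (cases "l < i") auto
    then show ?thesis using ix that by simp
  qed
  moreover have "(B ^\<^sub>m Suc k) $$ (i,i) = (B $$ (i,i)) ^ Suc k" if i: "i < n" for i
  proof -
    have "(\<Sum>l<n. (B ^\<^sub>m k) $$ (i,l) * B $$ (l,i)) = (\<Sum>l<n. if l = i then (B $$ (i,i)) ^ Suc k else 0)"
    proof (intro sum.cong refl)
      fix l assume l: "l \<in> {..<n}"
      show "(B ^\<^sub>m k) $$ (i,l) * B $$ (l,i) = (if l = i then (B $$ (i,i)) ^ Suc k else 0)"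
        using z[of l i] zB[of i l] l i Suc by (cases l i rule: linorder_cases) (auto simp: mult.commute)
    qed
    then show ?thesis using ix i by simp
  qed
  ultimately show ?case using B by (auto simp del: pow_mat.simps)
qed

text \<open>For an eigenvector v the number q = v* A v is real by symmetry and equals a times the
  positive number s = |v|^2.\<close>

lemma symmetric_complex_eigenvalue_real:
  fixes A :: "real mat"
  assumes A: "A \<in> carrier_mat n n" and sym: "\<And>i j. i < n \<Longrightarrow> j < n \<Longrightarrow> A $$ (i,j) = A $$ (j,i)"
    and ev: "eigenvalue (map_mat complex_of_real A) a"
  shows "a \<in> \<real>"
proof -
  let ?c = "map_mat complex_of_real A"
  obtain v where v: "v \<in> carrier_vec n" "v \<noteq> 0\<^sub>v n" "?c *\<^sub>v v = a \<cdot>\<^sub>v v"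
    using ev A by (auto simp: eigenvalue_def eigenvector_def)
  have e: "(\<Sum>j<n. complex_of_real (A $$ (i,j)) * v $ j) = a * v $ i" if "i < n" for i
  proof -
    have "(?c *\<^sub>v v) $ i = (\<Sum>j<n. complex_of_real (A $$ (i,j)) * v $ j)"
      using A v(1) that by (simp add: scalar_prod_def atLeast0LessThan)
    then show ?thesis using v that by simp
  qed
  define q where "q = (\<Sum>i<n. \<Sum>j<n. cnj (v $ i) * (complex_of_real (A $$ (i,j)) * v $ j))"
  define s where "s = (\<Sum>i<n. (cmod (v $ i))\<^sup>2)"
  have "q = (\<Sum>i<n. a * (v $ i * cnj (v $ i)))"
    unfolding q_def by (intro sum.cong refl) (subst sum_distrib_left[symmetric], subst e, simp, simp add: mult_ac)
  also have "\<dots> = a * complex_of_real s"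
    unfolding s_def complex_norm_square[symmetric] sum_distrib_left[symmetric] by simp
  finally have qs: "q = a * complex_of_real s" .
  have "cnj q = (\<Sum>i<n. \<Sum>j<n. v $ i * (complex_of_real (A $$ (i,j)) * cnj (v $ j)))"
    unfolding q_def by (simp add: cnj_sum)
  also have "\<dots> = q" unfolding q_def
    by (subst sum.swap) (auto intro!: sum.cong simp: sym mult_ac)
  finally have qr: "q \<in> \<real>" by (simp add: Reals_cnj_iff)
  have "s \<noteq> 0"
  proof -
    obtain i where "i < n" "v $ i \<noteq> 0" using v by (metis carrier_vecD eq_vecI index_zero_vec(1,2))
    then have "0 < (cmod (v $ i))\<^sup>2" by simp
    also have "\<dots> \<le> s" unfolding s_def using \<open>i < n\<close> by (intro member_le_sum) auto
    finally show ?thesis by simp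
  qed
  then have "a = q / complex_of_real s" using qs by simp
  moreover have "q / complex_of_real s \<in> \<real>" using qr by (intro Reals_divide Reals_of_real)
  ultimately show ?thesis by (rule ssubst)
qed

text \<open>The characteristic polynomial factors over the complex numbers with real roots only; the
  factorisation descends because the embedding of real polynomials is injective.\<close>

lemma symmetric_char_poly_splits:
  fixes A :: "real mat"
  assumes A: "A \<in> carrier_mat n n" and sym: "\<And>i j. i < n \<Longrightarrow> j < n \<Longrightarrow> A $$ (i,j) = A $$ (j,i)"
  obtains rs where "char_poly A = (\<Prod>a\<leftarrow>rs. [:- a, 1:])" "length rs = n"
proof -
  let ?c = "map_mat complex_of_real A"
  have c: "?c \<in> carrier_mat n n" using A by auto
  obtain as where as: "char_poly ?c = (\<Prod>a\<leftarrow>as. [:- a, 1:])" "length as = n"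
    using char_poly_factorized[OF c] by auto
  have real: "a \<in> \<real>" if "a \<in> set as" for a
  proof -
    have "poly (char_poly ?c) a = 0" unfolding as(1) using that by (simp add: linear_poly_root)
    then show ?thesis using symmetric_complex_eigenvalue_real[OF A sym] eigenvalue_root_char_poly[OF c] by blast
  qed
  interpret h: inj_comm_ring_hom complex_of_real by unfold_locales auto
  interpret ph: map_poly_inj_comm_ring_hom complex_of_real ..
  have "map_poly complex_of_real (\<Prod>a\<leftarrow>map Re as. [:- a, 1:]) = (\<Prod>a\<leftarrow>as. [:- a, 1:])"
    using real
  proof (induction as)
    case Nil then show ?case by simp
  next
    case (Cons a as)
    have "complex_of_real (Re a) = a" using Cons.prems by (simp add: of_real_Re)
    then show ?case using Cons by (simp add: hom_distribs)
  qed
  also have "\<dots> = map_poly complex_of_real (char_poly A)"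
    by (subst of_real_hom.char_poly_hom[OF A, symmetric]) (rule as(1)[symmetric])
  finally have "char_poly A = (\<Prod>a\<leftarrow>map Re as. [:- a, 1:])" using ph.injectivity by metis
  then show ?thesis using that[of "map Re as"] as(2) by simp
qed

text \<open>Since the characteristic polynomial splits, A is similar to a triangular matrix B. The
  diagonal of B and the eigenvalue list are the same multiset of roots, the diagonal of a power of B
  consists of powers, and the trace is invariant under similarity.\<close>

lemma symmetric_eigenvalue_list:
  fixes A :: "real mat"
  assumes A: "A \<in> carrier_mat n n" and sym: "\<And>i j. i < n \<Longrightarrow> j < n \<Longrightarrow> A $$ (i,j) = A $$ (j,i)"
  shows "length (eigenvalue_list A) = n"
    and "(\<Sum>i<n. (eigenvalue_list A ! i) ^ k) = mat_trace (A ^\<^sub>m k)"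
proof -
  obtain rs where rs: "char_poly A = (\<Prod>a\<leftarrow>rs. [:- a, 1:])" "length rs = n"
    using symmetric_char_poly_splits[OF assms] by metis
  have proots_eq: "proots (\<Prod>a\<leftarrow>xs. [:- a, 1:]) = mset xs" for xs :: "real list"
  proof (induction xs)
    case (Cons a rs)
    have "(\<Prod>a\<leftarrow>rs. [:- a, 1:]) \<noteq> (0::real poly)" by (auto simp: prod_list_zero_iff)
    then show ?case using Cons by (simp add: proots_mult del: mult_pCons_left)
  qed simp
  have el: "mset (eigenvalue_list A) = mset rs"
    unfolding eigenvalue_list_def rs(1) proots_eq by simp
  then show len: "length (eigenvalue_list A) = n" using rs(2) by (metis size_mset)
  obtain B where B: "B \<in> carrier_mat n n" "upper_triangular B" "similar_mat A B"
    using schur_decomposition_exists[OF A rs(1)] by blast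
  have "(\<Prod>a\<leftarrow>diag_mat B. [:- a, 1:]) = (\<Prod>a\<leftarrow>rs. [:- a, 1:])"
    using char_poly_upper_triangular[OF B(1,2)] char_poly_similar[OF B(3)] rs by simp
  have ms: "mset (diag_mat B) = mset (eigenvalue_list A)"
    using proots_eq[of "diag_mat B"] proots_eq[of rs] \<open>(\<Prod>a\<leftarrow>diag_mat B. _ a) = _\<close> el by simp
  have "(\<Sum>i<n. (eigenvalue_list A ! i) ^ k) = (\<Sum>x\<leftarrow>eigenvalue_list A. x ^ k)"
    by (simp add: sum_list_sum_nth len atLeast0LessThan)
  also have "\<dots> = (\<Sum>x\<in>#mset (eigenvalue_list A). x ^ k)"
    by (simp flip: sum_mset_sum_list add: mset_map)
  also have "\<dots> = (\<Sum>x\<leftarrow>diag_mat B. x ^ k)" unfolding ms[symmetric]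
    by (simp flip: sum_mset_sum_list add: mset_map)
  also have "\<dots> = (\<Sum>i<n. B $$ (i,i) ^ k)"
    using B(1) by (simp add: diag_mat_def sum_list_sum_nth atLeast0LessThan)
  also have "\<dots> = mat_trace (B ^\<^sub>m k)"
    using upper_triangular_pow[OF B(1,2), of k] B(1) by (simp add: mat_trace_def)
  also have "\<dots> = mat_trace (A ^\<^sub>m k)" using mat_trace_similar_pow[OF A B(3)] by simp
  finally show "(\<Sum>i<n. (eigenvalue_list A ! i) ^ k) = mat_trace (A ^\<^sub>m k)" .
qed

section \<open>Traces of powers as sums over closed walks\<close>

lemma pow_mat_walks:
  fixes A :: "'a::comm_semiring_1 mat"
  assumes A: "A \<in> carrier_mat n n" and i: "i < n" and j: "j < n"
  shows "(A ^\<^sub>m k) $$ (i,j) = (\<Sum>x\<in>PiE {1..k} (\<lambda>_. {..<n}).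
     if (x(0:=i)) k = j then \<Prod>v\<in>{1..k}. A $$ ((x(0:=i)) (v-1), x v) else 0)"
  using j
proof (induction k arbitrary: j)
  case 0
  then show ?case using A i by simp
next
  case (Suc k)
  have Ak: "A ^\<^sub>m k \<in> carrier_mat n n" using A by auto
  \<comment> \<open>Walks are extensional on {1..k} and carry no vertex at 0; the update
    \<open>x(0:=i)\<close> supplies the starting vertex and also covers the walk of length
    0.\<close>
  let ?P = "\<lambda>x k. \<Prod>v\<in>{1..k}. A $$ ((x(0:=i)) (v-1), x v)"
  have "(A ^\<^sub>m Suc k) $$ (i,j) = (\<Sum>l<n. (A ^\<^sub>m k) $$ (i,l) * A $$ (l,j))"
    using index_mult_mat_sum[OF Ak A i Suc.prems] by simp
  also have "\<dots> = (\<Sum>l<n. \<Sum>x\<in>PiE {1..k} (\<lambda>_. {..<n}). (if (x(0:=i)) k = l then ?P x k else 0) * A $$ (l,j))"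
    by (intro sum.cong refl) (simp add: Suc.IH sum_distrib_right)
  also have "\<dots> = (\<Sum>x\<in>PiE {1..k} (\<lambda>_. {..<n}). \<Sum>l<n. (if (x(0:=i)) k = l then ?P x k else 0) * A $$ (l,j))"
    by (rule sum.swap)
  also have "\<dots> = (\<Sum>x\<in>PiE {1..k} (\<lambda>_. {..<n}). ?P x k * A $$ ((x(0:=i)) k, j))"
  proof (intro sum.cong refl)
    fix x assume x: "x \<in> PiE {1..k} (\<lambda>_. {..<n})"
    have y: "(x(0:=i)) k < n" using x i by (cases "k = 0") (auto simp: PiE_iff)
    have "(\<Sum>l<n. (if (x(0:=i)) k = l then ?P x k else 0) * A $$ (l,j))
       = (\<Sum>l<n. if l = (x(0:=i)) k then ?P x k * A $$ ((x(0:=i)) k,j) else 0)"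
      by (intro sum.cong) auto
    also have "\<dots> = ?P x k * A $$ ((x(0:=i)) k, j)" using y by (simp add: sum.delta)
    finally show "(\<Sum>l<n. (if (x(0:=i)) k = l then ?P x k else 0) * A $$ (l,j)) = ?P x k * A $$ ((x(0:=i)) k, j)" .
  qed
  also have "\<dots> = (\<Sum>x\<in>PiE {1..k} (\<lambda>_. {..<n}). \<Sum>a<n.
      if ((x(Suc k := a))(0:=i)) (Suc k) = j then ?P (x(Suc k := a)) (Suc k) else 0)"
  proof (intro sum.cong refl)
    fix x assume x: "x \<in> PiE {1..k} (\<lambda>_. {..<n})"
    have "?P (x(Suc k := a)) (Suc k) = ?P x k * A $$ ((x(0:=i)) k, a)" for a
    proof -
      have "?P (x(Suc k := a)) k = ?P x k"
        by (intro prod.cong refl) (auto simp: fun_upd_def)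
      moreover have "{1..Suc k} = insert (Suc k) {1..k}" by auto
      ultimately show ?thesis by (simp add: mult.commute)
    qed
    then have "(\<Sum>a<n. if ((x(Suc k := a))(0:=i)) (Suc k) = j then ?P (x(Suc k := a)) (Suc k) else 0)
        = (\<Sum>a<n. if a = j then ?P x k * A $$ ((x(0:=i)) k, j) else 0)"
      by (intro sum.cong) auto
    then show "?P x k * A $$ ((x(0:=i)) k, j) = (\<Sum>a<n.
      if ((x(Suc k := a))(0:=i)) (Suc k) = j then ?P (x(Suc k := a)) (Suc k) else 0)"
      using Suc.prems by (simp add: sum.delta)
  qed
  also have "\<dots> = (\<Sum>x\<in>PiE {1..Suc k} (\<lambda>_. {..<n}). if (x(0:=i)) (Suc k) = j then ?P x (Suc k) else 0)"
  proof -
    have "{1..Suc k} = insert (Suc k) {1..k}" by auto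
    then show ?thesis by (simp only:) (subst sum_PiE_insert, auto)
  qed
  finally show ?case .
qed

text \<open>A closed walk starts at its last vertex \<open>x k\<close>, so the sum over the starting
  vertex collapses and step k precedes step 1.\<close>

lemma trace_pow_walks:
  fixes A :: "'a::comm_semiring_1 mat"
  assumes A: "A \<in> carrier_mat n n" and k: "k \<ge> 1"
  shows "mat_trace (A ^\<^sub>m k) = (\<Sum>x\<in>PiE {1..k} (\<lambda>_. {..<n}).
     \<Prod>v\<in>{1..k}. A $$ (x (if v = 1 then k else v - 1), x v))"
proof -
  have "mat_trace (A ^\<^sub>m k) = (\<Sum>i<n. (A ^\<^sub>m k) $$ (i,i))"
    using A by (simp add: mat_trace_def)
  also have "\<dots> = (\<Sum>i<n. \<Sum>x\<in>PiE {1..k} (\<lambda>_. {..<n}).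
     if x k = i then \<Prod>v\<in>{1..k}. A $$ ((x(0:=i)) (v-1), x v) else 0)"
    using k by (intro sum.cong refl) (subst pow_mat_walks[OF A], auto)
  also have "\<dots> = (\<Sum>x\<in>PiE {1..k} (\<lambda>_. {..<n}). \<Sum>i<n.
     if i = x k then \<Prod>v\<in>{1..k}. A $$ (x (if v = 1 then k else v - 1), x v) else 0)"
    by (subst sum.swap) (auto intro!: sum.cong prod.cong)
  also have "\<dots> = (\<Sum>x\<in>PiE {1..k} (\<lambda>_. {..<n}). \<Prod>v\<in>{1..k}. A $$ (x (if v = 1 then k else v - 1), x v))"
    using k by (intro sum.cong refl) (auto simp: sum.delta PiE_iff)
  finally show ?thesis .
qed

section \<open>Sums over walks\<close>

locale summable_covariance =
  fixes R :: "int \<Rightarrow> int \<Rightarrow> real"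
  assumes R_sym: "R u v = R v u" and R_neg: "R (- u) (- v) = R u v"
    and R_summable: "(\<lambda>(u, v). \<bar>R u v\<bar>) summable_on UNIV"
begin

definition S :: real where "S = (\<Sum>\<^sub>\<infinity>(u, v)\<in>UNIV. \<bar>R u v\<bar>)"
text \<open>Twice S for the two terms of \<open>C_bound\<close>; the 1 keeps K positive even if R
  vanishes.\<close>

definition K :: real where "K = 2 * S + 1"

text \<open>The covariance of the entries at \<open>(a, b)\<close> and \<open>(c, d)\<close> of the symmetric matrix.\<close>
definition C :: "int \<Rightarrow> int \<Rightarrow> int \<Rightarrow> int \<Rightarrow> real" where
  "C a b c d = R (min a b - min c d) (max c d - max a b)"

text \<open>The two edges are traversed in opposite directions.\<close>
definition opposite :: "int \<Rightarrow> int \<Rightarrow> int \<Rightarrow> int \<Rightarrow> bool" where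
  "opposite a b c d \<longleftrightarrow> a \<le> b \<and> d \<le> c \<or> b \<le> a \<and> c \<le> d"

section \<open>Summing the covariance of two entries over some of its arguments\<close>

lemma S_nonneg: "S \<ge> 0" unfolding S_def by (intro infsum_nonneg) auto
lemma K_pos: "K > 0" and K_ge: "K \<ge> 2 * S" "K \<ge> S" "K \<ge> 1" using S_nonneg by (auto simp: K_def)

lemma R_diff: "R (a - b) (c - d) = R (b - a) (d - c)"
  using R_neg[of "b - a" "d - c"] by simp

lemma sum_R_le:
  assumes "finite A" "inj_on (\<lambda>x. (f x, g x)) A"
  shows "(\<Sum>x\<in>A. \<bar>R (f x) (g x)\<bar>) \<le> S"
proof -
  have "(\<Sum>x\<in>A. \<bar>R (f x) (g x)\<bar>) = (\<Sum>(u,v)\<in>(\<lambda>x. (f x, g x)) ` A. \<bar>R u v\<bar>)"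
    using assms(2) by (simp add: sum.reindex)
  also have "\<dots> \<le> S" unfolding S_def
    using R_summable assms(1) by (intro finite_sum_le_infsum) auto
  finally show ?thesis .
qed

lemma C_sym: "C a b c d = C c d a b"
  unfolding C_def by (rule R_diff)

text \<open>There are two ways of being opposite. One gives the right-hand side directly, the other
  gives it after exchanging the arguments of R and negating both. The same happens in
  \<open>C_not_opp\<close> for equal directions, so that only the relative direction
  matters.\<close>

lemma C_opp: "opposite a b c d \<Longrightarrow> C a b c d = R (a - d) (c - b)"
  unfolding opposite_def C_def
  using R_sym[of "b - c" "d - a"] R_diff[of d a b c] by (auto simp: min_def max_def)

lemma C_not_opp: "\<not> opposite a b c d \<Longrightarrow> C a b c d = R (a - c) (d - b)"
  unfolding opposite_def C_def
  using R_sym[of "b - d" "c - a"] R_diff[of c a b d] by (auto simp: min_def max_def)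

lemma C_bound: "\<bar>C a b c d\<bar> \<le> \<bar>R (a - c) (d - b)\<bar> + \<bar>R (a - d) (c - b)\<bar>"
  using C_opp[of a b c d] C_not_opp[of a b c d] by (cases "opposite a b c d") auto

lemma C_err: "\<bar>C a b c d - (if opposite a b c d then R (a - d) (c - b) else 0)\<bar> \<le> \<bar>R (a - c) (d - b)\<bar>"
  using C_opp[of a b c d] C_not_opp[of a b c d] by auto

lemma R_le_S: "\<bar>R u v\<bar> \<le> S"
  using sum_R_le[of "{()}" "\<lambda>_. u" "\<lambda>_. v"] by simp

lemma C_le: "\<bar>C a b c d\<bar> \<le> K"
  using C_bound[of a b c d] R_le_S[of "a - c" "d - b"] R_le_S[of "a - d" "c - b"] K_ge(1) by linarith

lemma C_sum1:
  assumes "finite X" shows "(\<Sum>d\<in>X. \<bar>C a b c d\<bar>) \<le> K"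
proof -
  have "(\<Sum>d\<in>X. \<bar>C a b c d\<bar>) \<le> (\<Sum>d\<in>X. \<bar>R (a - c) (d - b)\<bar>) + (\<Sum>d\<in>X. \<bar>R (a - d) (c - b)\<bar>)"
    unfolding sum.distrib[symmetric] by (intro sum_mono C_bound)
  also have "\<dots> \<le> S + S" using assms by (intro add_mono sum_R_le) (auto simp: inj_on_def)
  finally show ?thesis using K_ge(1) by simp
qed

text \<open>Both ends of an edge may be summed at the cost of a constant: the pair (c, d)
  determines, and is determined by, the two arguments of R. This is stronger than
  \<open>C_sum1\<close>, where one end stays fixed, and is the source of the saved factor in the
  crossing case. The shift s is the jump at the start of the edge.\<close>

lemma C_sum2:
  assumes "finite X" shows "(\<Sum>c\<in>X. \<Sum>d\<in>X. \<bar>C a b (c + s) d\<bar>) \<le> K"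
proof -
  have "(\<Sum>c\<in>X. \<Sum>d\<in>X. \<bar>C a b (c + s) d\<bar>) = (\<Sum>(c,d)\<in>X\<times>X. \<bar>C a b (c + s) d\<bar>)"
    by (simp add: sum.cartesian_product)
  also have "\<dots> \<le> (\<Sum>(c,d)\<in>X\<times>X. \<bar>R (a - (c + s)) (d - b)\<bar> + \<bar>R (a - d) (c + s - b)\<bar>)"
    by (intro sum_mono) (auto intro: C_bound)
  also have "\<dots> = (\<Sum>p\<in>X\<times>X. \<bar>R (a - (fst p + s)) (snd p - b)\<bar>) + (\<Sum>p\<in>X\<times>X. \<bar>R (a - snd p) (fst p + s - b)\<bar>)"
    by (simp add: sum.distrib case_prod_unfold)
  also have "\<dots> \<le> S + S" using assms by (intro add_mono sum_R_le) (auto simp: inj_on_def)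
  finally show ?thesis using K_ge(1) by simp
qed

text \<open>Vertex \<open>l\<close> of a walk is the end of the edge \<open>l\<close>, which starts at the
  vertex \<open>cyc_pred l\<close> shifted by \<open>r (cyc_pred l)\<close>.\<close>
definition edge_cov :: "(nat \<Rightarrow> nat) \<Rightarrow> (nat \<Rightarrow> int) \<Rightarrow> (nat \<Rightarrow> int) \<Rightarrow> nat set \<Rightarrow> real" where
  "edge_cov cyc_pred r x B = C (x (cyc_pred (Min B)) + r (cyc_pred (Min B))) (x (Min B)) (x (cyc_pred (Max B)) + r (cyc_pred (Max B))) (x (Max B))"

lemma edge_cov_pair: "c \<noteq> l \<Longrightarrow> edge_cov cyc_pred r x {c, l} = C (x (cyc_pred c) + r (cyc_pred c)) (x c) (x (cyc_pred l) + r (cyc_pred l)) (x l)"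
  unfolding edge_cov_def using C_sym by (cases "c < l") auto

lemma edge_cov_le: "\<bar>edge_cov cyc_pred r x B\<bar> \<le> K" unfolding edge_cov_def by (rule C_le)

lemma elim_vertex:
  fixes g F :: "(nat \<Rightarrow> int) \<Rightarrow> real"
  assumes "l \<notin> V" "\<And>x a. g (x(l := a)) = g x" "\<And>x. g x \<ge> 0"
    "\<And>x. (\<Sum>a\<in>X. F (x(l := a))) \<le> k"
  shows "(\<Sum>x\<in>PiE (insert l V) (\<lambda>_. X). g x * F x) \<le> k * (\<Sum>x\<in>PiE V (\<lambda>_. X). g x)"
proof -
  have "(\<Sum>x\<in>PiE (insert l V) (\<lambda>_. X). g x * F x) = (\<Sum>x\<in>PiE V (\<lambda>_. X). g x * (\<Sum>a\<in>X. F (x(l := a))))"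
    using assms by (simp add: sum_PiE_insert sum_distrib_left)
  also have "\<dots> \<le> (\<Sum>x\<in>PiE V (\<lambda>_. X). g x * k)"
    by (intro sum_mono mult_left_mono assms)
  finally show ?thesis by (simp add: sum_distrib_left mult.commute)
qed

text \<open>Eliminate the vertices in order of decreasing rank: a vertex whose block is already
  otherwise determined costs a factor \<open>K\<close>, any other one a factor \<open>card X\<close>.\<close>
lemma chain_bound:
  fixes \<rho> :: "nat \<Rightarrow> nat" and g :: "(nat \<Rightarrow> int) \<Rightarrow> real"
  assumes "finite L" "finite X" "finite \<tau>" "Bs \<inter> L = {}"
    and disj: "\<And>B D. B \<in> \<tau> \<Longrightarrow> D \<in> \<tau> \<Longrightarrow> B \<noteq> D \<Longrightarrow> B \<inter> D = {}"
    and top: "\<And>B. B \<in> \<tau> \<Longrightarrow> \<exists>c l. B = {c, l} \<and> c \<noteq> l \<and> l \<in> L \<and>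
        (\<forall>y\<in>{c, cyc_pred c, cyc_pred l}. y \<in> Bs \<or> y \<in> L \<and> \<rho> y < \<rho> l)"
    and g: "\<And>x. g x \<ge> 0" "\<And>x l a. l \<in> L \<Longrightarrow> g (x(l := a)) = g x"
  shows "(\<Sum>x\<in>PiE (Bs \<union> L) (\<lambda>_. X). g x * (\<Prod>B\<in>\<tau>. \<bar>edge_cov cyc_pred r x B\<bar>)) * real (card X) ^ card \<tau>
    \<le> K ^ card \<tau> * real (card X) ^ card L * (\<Sum>x\<in>PiE Bs (\<lambda>_. X). g x)"
  using assms
proof (induction "card L" arbitrary: L \<tau>)
  case 0
  then have "L = {}" by simp
  then have "\<tau> = {}" using 0(7) by blast
  then show ?case using \<open>L = {}\<close> by simp
next
  case (Suc n)
  have ne: "L \<noteq> {}" using Suc.hyps(2) by auto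
  obtain l where l: "l \<in> L" and lmax: "\<And>y. y \<in> L \<Longrightarrow> \<rho> y \<le> \<rho> l"
  proof -
    have "Max (\<rho> ` L) \<in> \<rho> ` L" using ne Suc.prems(1) by (intro Max_in) auto
    then obtain l where "l \<in> L" "\<rho> l = Max (\<rho> ` L)" by auto
    then show ?thesis using that[of l] Suc.prems(1) by simp
  qed
  define L' where "L' = L - {l}"
  have L: "L = insert l L'" "l \<notin> L'" "finite L'" "card L = Suc (card L')" "l \<notin> Bs"
    using l Suc.prems(1,4) card.remove[OF Suc.prems(1) l] by (auto simp: L'_def)
  have n: "n = card L'" using Suc.hyps L by simp
  have BL: "Bs \<union> L = insert l (Bs \<union> L')" "l \<notin> Bs \<union> L'" using L by auto
  have dis': "Bs \<inter> L' = {}" using Suc.prems(4) L by auto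
  have top': "\<exists>c l. B = {c, l} \<and> c \<noteq> l \<and> l \<in> L' \<and>
        (\<forall>y\<in>{c, cyc_pred c, cyc_pred l}. y \<in> Bs \<or> y \<in> L' \<and> \<rho> y < \<rho> l)" if B: "B \<in> \<tau>" "l \<notin> B" for B
  proof -
    obtain c m where cm: "B = {c, m}" "c \<noteq> m" "m \<in> L" "\<And>y. y\<in>{c, cyc_pred c, cyc_pred m} \<Longrightarrow> y \<in> Bs \<or> y \<in> L \<and> \<rho> y < \<rho> m"
      using Suc.prems(6)[OF B(1)] by blast
    have "m \<in> L'" using cm B L by auto
    moreover have "y \<in> Bs \<or> y \<in> L' \<and> \<rho> y < \<rho> m" if "y\<in>{c, cyc_pred c, cyc_pred m}" for y
      using cm(4)[OF that] lmax[OF cm(3)] L(1) by auto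
    ultimately show ?thesis using cm by blast
  qed
  \<comment> \<open>A block not containing l does not depend on \<open>x l\<close>: the vertices on
    which it depends are its top vertex, others in Bs, and others of smaller rank than the top,
    while l has maximal rank in L.\<close>
  have ind: "\<bar>edge_cov cyc_pred r (x(l := a)) B\<bar> = \<bar>edge_cov cyc_pred r x B\<bar>" if B: "B \<in> \<tau>" "l \<notin> B" for B x a
  proof -
    obtain c m where cm: "B = {c, m}" "c \<noteq> m" "m \<in> L'" "\<And>y. y\<in>{c, cyc_pred c, cyc_pred m} \<Longrightarrow> y \<in> Bs \<or> y \<in> L' \<and> \<rho> y < \<rho> m"
      using top'[OF B] by blast
    have "y \<noteq> l" if "y \<in> {c, cyc_pred c, cyc_pred m, m}" for y
      using cm(3) cm(4)[of y] L that by auto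
    then show ?thesis unfolding cm(1) edge_cov_pair[OF cm(2)] by simp
  qed
  show ?case
  proof (cases "\<exists>B\<in>\<tau>. l \<in> B")
    case False
    have "(\<Sum>x\<in>PiE (Bs \<union> L) (\<lambda>_. X). (g x * (\<Prod>B\<in>\<tau>. \<bar>edge_cov cyc_pred r x B\<bar>)) * 1)
       \<le> real (card X) * (\<Sum>x\<in>PiE (Bs \<union> L') (\<lambda>_. X). g x * (\<Prod>B\<in>\<tau>. \<bar>edge_cov cyc_pred r x B\<bar>))"
      unfolding BL(1) using BL(2) ind False Suc.prems(7,8) l
      by (intro elim_vertex) (auto simp: prod_nonneg)
    then have "(\<Sum>x\<in>PiE (Bs \<union> L) (\<lambda>_. X). g x * (\<Prod>B\<in>\<tau>. \<bar>edge_cov cyc_pred r x B\<bar>)) * real (card X) ^ card \<tau>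
       \<le> real (card X) * ((\<Sum>x\<in>PiE (Bs \<union> L') (\<lambda>_. X). g x * (\<Prod>B\<in>\<tau>. \<bar>edge_cov cyc_pred r x B\<bar>)) * real (card X) ^ card \<tau>)"
      by (simp only: mult_1_right mult.assoc[symmetric]) (rule mult_right_mono, auto)
    also have "\<dots> \<le> real (card X) * (K ^ card \<tau> * real (card X) ^ card L' * (\<Sum>x\<in>PiE Bs (\<lambda>_. X). g x))"
      using Suc.prems False L dis' top'
      by (intro mult_left_mono Suc.hyps(1)[OF n]) auto
    finally show ?thesis using L by (simp add: mult_ac)
  next
    case True
    then obtain B where B: "B \<in> \<tau>" "l \<in> B" by blast
    define \<tau>' where "\<tau>' = \<tau> - {B}"
    have t: "\<tau> = insert B \<tau>'" "B \<notin> \<tau>'" "finite \<tau>'" "card \<tau> = Suc (card \<tau>')"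
      using B Suc.prems(3) card.remove[OF Suc.prems(3) B(1)] by (auto simp: \<tau>'_def)
    obtain c m where cm: "B = {c, m}" "c \<noteq> m" "m \<in> L" "\<And>y. y\<in>{c, cyc_pred c, cyc_pred m} \<Longrightarrow> y \<in> Bs \<or> y \<in> L \<and> \<rho> y < \<rho> m"
      using Suc.prems(6)[OF B(1)] by blast
    \<comment> \<open>The vertex l has maximal rank, so it must be the top end of its block; the
      other end and both predecessors are then different from l and \<open>C_sum1\<close>
      applies.\<close>
    have "m = l"
    proof (rule ccontr)
      assume "m \<noteq> l"
      then have "c = l" using B cm by auto
      then show False using cm(4)[of c] lmax[OF cm(3)] L(5) by auto
    qed
    then have nl: "c \<noteq> l" "cyc_pred c \<noteq> l" "cyc_pred l \<noteq> l"
      using cm(2) cm(4)[of "cyc_pred c"] cm(4)[of "cyc_pred l"] L(5) by auto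
    have nB: "l \<notin> D" if "D \<in> \<tau>'" for D using Suc.prems(5)[of B D] B t that by auto
    have "(\<Sum>x\<in>PiE (Bs \<union> L) (\<lambda>_. X). g x * (\<Prod>B\<in>\<tau>. \<bar>edge_cov cyc_pred r x B\<bar>))
      = (\<Sum>x\<in>PiE (Bs \<union> L) (\<lambda>_. X). (g x * (\<Prod>B\<in>\<tau>'. \<bar>edge_cov cyc_pred r x B\<bar>)) * \<bar>edge_cov cyc_pred r x B\<bar>)"
      using t by (simp add: mult_ac)
    also have "\<dots> \<le> K * (\<Sum>x\<in>PiE (Bs \<union> L') (\<lambda>_. X). g x * (\<Prod>B\<in>\<tau>'. \<bar>edge_cov cyc_pred r x B\<bar>))"
      unfolding BL(1)
    proof (intro elim_vertex BL(2))
      show "g (x(l := a)) * (\<Prod>B\<in>\<tau>'. \<bar>edge_cov cyc_pred r (x(l := a)) B\<bar>) = g x * (\<Prod>B\<in>\<tau>'. \<bar>edge_cov cyc_pred r x B\<bar>)" for x a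
        using ind nB t Suc.prems(8)[OF l] by simp
      show "0 \<le> g x * (\<Prod>B\<in>\<tau>'. \<bar>edge_cov cyc_pred r x B\<bar>)" for x using Suc.prems(7) by (simp add: prod_nonneg)
      show "(\<Sum>a\<in>X. \<bar>edge_cov cyc_pred r (x(l := a)) B\<bar>) \<le> K" for x
        unfolding cm(1) \<open>m = l\<close> edge_cov_pair[OF nl(1)] using nl C_sum1[OF Suc.prems(2)] by simp
    qed
    finally have "(\<Sum>x\<in>PiE (Bs \<union> L) (\<lambda>_. X). g x * (\<Prod>B\<in>\<tau>. \<bar>edge_cov cyc_pred r x B\<bar>)) * real (card X) ^ card \<tau>
      \<le> K * (\<Sum>x\<in>PiE (Bs \<union> L') (\<lambda>_. X). g x * (\<Prod>B\<in>\<tau>'. \<bar>edge_cov cyc_pred r x B\<bar>)) * real (card X) ^ card \<tau>"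
      by (rule mult_right_mono) auto
    also have "\<dots> = K * real (card X) * ((\<Sum>x\<in>PiE (Bs \<union> L') (\<lambda>_. X). g x * (\<Prod>B\<in>\<tau>'. \<bar>edge_cov cyc_pred r x B\<bar>)) * real (card X) ^ card \<tau>')"
      using t by simp
    also have "\<dots> \<le> K * real (card X) * (K ^ card \<tau>' * real (card X) ^ card L' * (\<Sum>x\<in>PiE Bs (\<lambda>_. X). g x))"
    proof (intro mult_left_mono Suc.hyps(1)[OF n])
      show "\<exists>c l. D = {c, l} \<and> c \<noteq> l \<and> l \<in> L' \<and>
        (\<forall>y\<in>{c, cyc_pred c, cyc_pred l}. y \<in> Bs \<or> y \<in> L' \<and> \<rho> y < \<rho> l)" if "D \<in> \<tau>'" for D
        using top'[of D] nB[OF that] that t by auto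
    qed (use Suc.prems t L dis' K_pos in auto)
    finally show ?thesis using L t by (simp add: mult_ac)
  qed
qed

text \<open>If whole blocks lie in L and the rank is injective, the end of larger rank serves as the
  top of each block.\<close>

lemma chain_bound_pairs:
  fixes \<rho> :: "nat \<Rightarrow> nat" and g :: "(nat \<Rightarrow> int) \<Rightarrow> real"
  assumes "finite L" "finite X" "finite \<tau>" "Bs \<inter> L = {}"
    and disj: "\<And>B D. B \<in> \<tau> \<Longrightarrow> D \<in> \<tau> \<Longrightarrow> B \<noteq> D \<Longrightarrow> B \<inter> D = {}"
    and two: "\<And>B. B \<in> \<tau> \<Longrightarrow> card B = 2 \<and> B \<subseteq> L"
    and \<rho>: "inj_on \<rho> L" "\<And>l. l \<in> L \<Longrightarrow> cyc_pred l \<in> Bs \<or> cyc_pred l \<in> L \<and> \<rho> (cyc_pred l) < \<rho> l"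
    and g: "\<And>x. g x \<ge> 0" "\<And>x l a. l \<in> L \<Longrightarrow> g (x(l := a)) = g x"
  shows "(\<Sum>x\<in>PiE (Bs \<union> L) (\<lambda>_. X). g x * (\<Prod>B\<in>\<tau>. \<bar>edge_cov cyc_pred r x B\<bar>)) * real (card X) ^ card \<tau>
    \<le> K ^ card \<tau> * real (card X) ^ card L * (\<Sum>x\<in>PiE Bs (\<lambda>_. X). g x)"
proof (rule chain_bound[where \<rho>=\<rho>, OF assms(1-5) _ g])
  fix B assume B: "B \<in> \<tau>"
  obtain a b where ab: "B = {a,b}" "a \<noteq> b" using two[OF B] by (auto simp: card_2_iff)
  have *: "\<exists>c l. B = {c, l} \<and> c \<noteq> l \<and> l \<in> L \<and> (\<forall>y\<in>{c, cyc_pred c, cyc_pred l}. y \<in> Bs \<or> y \<in> L \<and> \<rho> y < \<rho> l)"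
    if "B = {a,b}" "\<rho> a < \<rho> b" for a b
    using \<rho>(2)[of a] \<rho>(2)[of b] two[OF B] that by (intro exI[of _ a] exI[of _ b]) auto
  have "\<rho> a \<noteq> \<rho> b" using \<rho>(1) two[OF B] ab by (auto simp: inj_on_def)
  then show "\<exists>c l. B = {c, l} \<and> c \<noteq> l \<and> l \<in> L \<and> (\<forall>y\<in>{c, cyc_pred c, cyc_pred l}. y \<in> Bs \<or> y \<in> L \<and> \<rho> y < \<rho> l)"
    using *[of a b] *[of b a] ab by (cases "\<rho> a < \<rho> b") (auto simp: insert_commute)
qed auto

end

section \<open>The cyclic order of a finite set of steps\<close>

definition cyc_pred :: "nat set \<Rightarrow> nat \<Rightarrow> nat" where
  "cyc_pred V l = (if {j\<in>V. j < l} = {} then Max V else Max {j\<in>V. j < l})"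

text \<open>The cycle is cut open behind b: elements above b keep their position, and all others, b
  last among them, are moved beyond Max V. The predecessor of any element other than b is then b
  itself or has smaller rank.\<close>

definition rank_from :: "nat set \<Rightarrow> nat \<Rightarrow> nat \<Rightarrow> nat" where
  "rank_from V b l = (if l > b then l else l + Suc (Max V))"

context
  fixes V :: "nat set" assumes fin: "finite V"
begin

lemma cyc_pred_cases:
  assumes "l \<in> V"
  obtains "\<And>j. j \<in> V \<Longrightarrow> l \<le> j" "cyc_pred V l = Max V"
  | "cyc_pred V l \<in> V" "cyc_pred V l < l" "\<And>j. j \<in> V \<Longrightarrow> j < l \<Longrightarrow> j \<le> cyc_pred V l"
proof (cases "{j\<in>V. j < l} = {}")
  case True
  then show ?thesis using that(1) by (auto simp: cyc_pred_def not_less)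
next
  case False
  have eq: "cyc_pred V l = Max {j\<in>V. j < l}" unfolding cyc_pred_def using False by (rule if_not_P)
  have "Max {j\<in>V. j < l} \<in> {j\<in>V. j < l}" using fin False by (intro Max_in) auto
  moreover have "j \<le> Max {j\<in>V. j < l}" if "j \<in> V" "j < l" for j using fin that by (intro Max_ge) auto
  ultimately show ?thesis using that(2) unfolding eq by blast
qed

lemma cyc_pred_in: assumes "l \<in> V" shows "cyc_pred V l \<in> V"
  using assms
proof (cases rule: cyc_pred_cases)
  case 1
  have "V \<noteq> {}" using assms by blast
  then show ?thesis unfolding 1(2) by (rule Max_in[OF fin])
qed

lemma rank_from_inj: "inj_on (rank_from V b) V"
proof (rule inj_onI)
  fix x y assume "x \<in> V" "y \<in> V" "rank_from V b x = rank_from V b y"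
  moreover have "x \<le> Max V" "y \<le> Max V" using fin \<open>x \<in> V\<close> \<open>y \<in> V\<close> by auto
  ultimately show "x = y" by (auto simp: rank_from_def split: if_splits)
qed

lemma cyc_pred_rank:
  assumes "l \<in> V" "b \<in> V" "l \<noteq> b"
  shows "cyc_pred V l = b \<or> cyc_pred V l \<in> V - {b} \<and> rank_from V b (cyc_pred V l) < rank_from V b l"
proof -
  have m: "x \<le> Max V" if "x \<in> V" for x using fin that by auto
  have "Max V \<in> V" using fin assms by (intro Max_in) auto
  show ?thesis using assms(1)
  proof (cases rule: cyc_pred_cases)
    case 1
    have "l < b" using 1(1)[OF assms(2)] assms(3) by simp
    then show ?thesis using m[OF assms(2)] \<open>Max V \<in> V\<close> unfolding 1(2)
      by (auto simp: rank_from_def)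
  next
    case 2
    have "b < l \<Longrightarrow> b \<le> cyc_pred V l" using 2(3) assms by blast
    then show ?thesis using assms m[OF 2(1)] m[OF assms(1)] 2(1,2)
      by (cases "b < l") (auto simp: rank_from_def)
  qed
qed

lemma cyc_pred_inj:
  assumes "a \<in> V" "b \<in> V" "cyc_pred V a = cyc_pred V b" shows "a = b"
proof -
  have False if ab: "a \<in> V" "b \<in> V" "cyc_pred V a = cyc_pred V b" "a < b" for a b
  proof -
    have "b \<le> Max V" using fin ab by auto
    have "a \<le> cyc_pred V b" "cyc_pred V b < b" using cyc_pred_cases[OF ab(2)] ab(1,4) by (metis leD)+
    then show False using cyc_pred_cases[OF ab(1)] ab \<open>b \<le> Max V\<close> by (metis leD)
  qed
  then show ?thesis using assms by (metis linorder_less_linear)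
qed

context
  fixes u v assumes uv: "u \<in> V" "v \<in> V" "u < v" "\<And>z. z \<in> V \<Longrightarrow> \<not> (u < z \<and> z < v)"
begin

lemma cyc_pred_succ: "cyc_pred V v = u"
  using uv(2)
proof (cases rule: cyc_pred_cases)
  case 1 then show ?thesis using uv(1,3) by force
next
  case 2 then show ?thesis using uv(1,3,4) by (metis le_neq_implies_less)
qed

lemma cyc_pred_neq_u: "l \<in> V \<Longrightarrow> l \<noteq> v \<Longrightarrow> cyc_pred V l \<noteq> u"
  using cyc_pred_inj[of l v] cyc_pred_succ uv by auto

lemma cyc_pred_u_in: "V - {u,v} \<noteq> {} \<Longrightarrow> cyc_pred V u \<in> V - {u,v}"
proof -
  assume "V - {u,v} \<noteq> {}"
  then obtain w where w: "w \<in> V" "w \<noteq> u" "w \<noteq> v" by auto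
  have "cyc_pred V u \<in> V" using cyc_pred_in uv by auto
  moreover have "cyc_pred V u \<noteq> u" using cyc_pred_neq_u uv by auto
  moreover have "cyc_pred V u \<noteq> v" using uv(1)
  proof (cases rule: cyc_pred_cases)
    case 1
    have "w \<le> Max V" using fin w by auto
    then show ?thesis using 1(1)[OF w(1)] uv(4)[OF w(1)] w 1(2) uv(3) by auto
  next
    case 2 then show ?thesis using uv by auto
  qed
  ultimately show ?thesis by auto
qed

text \<open>Cutting the neighbours u and v out of the cycle affects only the element behind v, which
  inherits the predecessor of u. The case distinctions come from the wrap-around at the minimum,
  which may move when u and v are removed.\<close>

lemma cyc_pred_remove:
  assumes "l \<in> V - {u,v}"
  shows "cyc_pred (V - {u,v}) l = (if cyc_pred V l = v then cyc_pred V u else cyc_pred V l)"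
proof -
  have lV: "l \<in> V" "l \<noteq> u" "l \<noteq> v" using assms by auto
  have pu: "cyc_pred V u \<in> V - {u,v}" using cyc_pred_u_in assms by auto
  have pl: "cyc_pred V l \<in> V" "cyc_pred V l \<noteq> u" using cyc_pred_in cyc_pred_neq_u lV by auto
  have M: "Max (V - {u,v}) = x" if "x \<in> V - {u,v}" "\<And>y. y \<in> V - {u,v} \<Longrightarrow> y \<le> x" for x
    using fin that by (intro Max_eqI) auto
  have Ml: "Max {j \<in> V - {u,v}. j < l} = x" if "x \<in> V - {u,v}" "x < l" "\<And>y. y \<in> V - {u,v} \<Longrightarrow> y < l \<Longrightarrow> y \<le> x" for x
    using fin that by (intro Max_eqI) auto
  have mm: "y \<le> Max V" if "y \<in> V" for y using fin that by auto
  show ?thesis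
  proof (cases "cyc_pred V l = v")
    case True
    show ?thesis using lV(1)
    proof (cases rule: cyc_pred_cases)
      case 1
      have "{j \<in> V - {u,v}. j < l} = {}" using 1(1) by (auto simp: not_less)
      moreover have "Max (V - {u,v}) = cyc_pred V u"
      proof (rule M[OF pu])
        fix y assume y: "y \<in> V - {u,v}"
        have "y < u" using mm[of y] y 1 True uv(4)[of y] by force
        then show "y \<le> cyc_pred V u" using y cyc_pred_cases[OF uv(1)] by (metis DiffD1 leD)
      qed
      ultimately show ?thesis using True by (simp add: cyc_pred_def)
    next
      case 2
      show ?thesis
      proof (cases "\<exists>y\<in>V - {u,v}. y < l")
        case ex: True
        then obtain y where y: "y \<in> V - {u,v}" "y < l" by blast
        have less: "y < u" if "y \<in> V - {u,v}" "y < l" for y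
          using 2(3)[of y] that True uv(4)[of y] by force
        have "cyc_pred V u < u \<and> (\<forall>j\<in>V. j < u \<longrightarrow> j \<le> cyc_pred V u)"
          using uv(1) by (cases rule: cyc_pred_cases) (use less[OF y] y in force)+
        moreover have "u < l" using 2(2) True uv(3) by simp
        ultimately have "Max {j \<in> V - {u,v}. j < l} = cyc_pred V u"
          using less pu by (intro Ml) auto
        then show ?thesis using True y by (auto simp: cyc_pred_def)
      next
        case nex: False
        then have e: "{j \<in> V - {u,v}. j < l} = {}" by auto
        have ul: "u < l" using 2(2) True uv(3) by simp
        have "cyc_pred V u = Max V" using uv(1)
        proof (cases rule: cyc_pred_cases)
          case 2
          then have "cyc_pred V u < l" using ul by simp
          then show ?thesis using nex pu by blast
        qed simp
        moreover have "Max (V - {u,v}) = Max V"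
          using mm pu calculation by (intro M) auto
        ultimately show ?thesis using True e by (simp add: cyc_pred_def)
      qed
    qed
  next
    case False
    then have pl': "cyc_pred V l \<in> V - {u,v}" using pl by auto
    show ?thesis using lV(1)
    proof (cases rule: cyc_pred_cases)
      case 1
      have "{j \<in> V - {u,v}. j < l} = {}" using 1(1) by (auto simp: not_less)
      moreover have "Max (V - {u,v}) = cyc_pred V l" using pl' mm 1 by (intro M) auto
      ultimately show ?thesis using False by (simp add: cyc_pred_def)
    next
      case 2
      have "Max {j \<in> V - {u,v}. j < l} = cyc_pred V l" using pl' 2 by (intro Ml) auto
      then show ?thesis using False 2 pl' by (auto simp: cyc_pred_def)
    qed
  qed
qed

end
end

text \<open>The chain bounds carry a power of card X on the left instead of a natural-number
  difference of exponents on the right; this removes it.\<close>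

lemma power_cancel_le:
  fixes q :: real
  assumes "A * q ^ a \<le> B * q ^ (a + c) * D" "q > 0"
  shows "A \<le> B * q ^ c * D"
proof -
  have "A * q ^ a \<le> (B * q ^ c * D) * q ^ a" using assms(1) by (simp add: power_add mult_ac)
  then show ?thesis using assms(2) by simp
qed

lemma sum_PiE_singleton: "(\<Sum>x\<in>PiE {b} (\<lambda>_. X). h (x b)) = (\<Sum>a\<in>X. h a)"
proof -
  have "(\<Sum>x\<in>PiE (insert b {}) (\<lambda>_. X). h (x b)) = (\<Sum>a\<in>X. h a)"
    by (subst sum_PiE_insert) auto
  then show ?thesis .
qed

lemma cyc_pred_disj:
  assumes "finite V" "l \<in> V"
  shows "(\<forall>j\<in>V. l \<le> j) \<and> cyc_pred V l = Max V \<or>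
    cyc_pred V l \<in> V \<and> cyc_pred V l < l \<and> (\<forall>j\<in>V. j < l \<longrightarrow> j \<le> cyc_pred V l)"
  by (rule cyc_pred_cases[OF assms]) blast+

section \<open>Power counting for walks\<close>

context summable_covariance begin

text \<open>The vertex b is kept apart and its block is bounded by K. Of the 2m - 1 other vertices,
  the m - 1 other blocks save one factor n each, which leaves n^m. The weight g, which among the
  vertices sees only \<open>x b\<close>, allows this vertex to be confined to few positions.\<close>

lemma walk_bound:
  assumes V: "finite V" "card V = 2 * m" "\<sigma> \<in> pairings V" "b \<in> V" and X: "finite X" "X \<noteq> {}"
    and g: "\<And>x. g x \<ge> 0" "\<And>x l a. l \<in> V - {b} \<Longrightarrow> g (x(l := a)) = g x"
  shows "(\<Sum>x\<in>PiE V (\<lambda>_. X). g x * (\<Prod>B\<in>\<sigma>. \<bar>edge_cov (cyc_pred V) r x B\<bar>))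
    \<le> K ^ m * real (card X) ^ m * (\<Sum>x\<in>PiE {b} (\<lambda>_. X). g x)"
proof -
  obtain B0 where B0: "B0 \<in> \<sigma>" "b \<in> B0" using pairings_cover V by blast
  define \<tau> where "\<tau> = \<sigma> - {B0}"
  have fs: "finite \<sigma>" using pairings_finite V by auto
  have cs: "card \<sigma> = m" using pairings_card[OF V(3,1)] V by simp
  have m: "m = Suc (card \<tau>)" using cs card.remove[OF fs B0(1)] by (simp add: \<tau>_def)
  have n: "real (card X) > 0" using X by (simp add: card_gt_0_iff)
  have cL: "card (V - {b}) = card \<tau> + m" using V m by simp
  have st: "(\<Prod>B\<in>\<sigma>. \<bar>edge_cov (cyc_pred V) r x B\<bar>) = \<bar>edge_cov (cyc_pred V) r x B0\<bar> * (\<Prod>B\<in>\<tau>. \<bar>edge_cov (cyc_pred V) r x B\<bar>)" for x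
    unfolding \<tau>_def by (rule prod.remove[OF fs B0(1)])
  have "(\<Sum>x\<in>PiE V (\<lambda>_. X). g x * (\<Prod>B\<in>\<sigma>. \<bar>edge_cov (cyc_pred V) r x B\<bar>))
     \<le> (\<Sum>x\<in>PiE V (\<lambda>_. X). K * (g x * (\<Prod>B\<in>\<tau>. \<bar>edge_cov (cyc_pred V) r x B\<bar>)))"
  proof (rule sum_mono)
    fix x
    have "\<bar>edge_cov (cyc_pred V) r x B0\<bar> * (g x * (\<Prod>B\<in>\<tau>. \<bar>edge_cov (cyc_pred V) r x B\<bar>)) \<le> K * (g x * (\<Prod>B\<in>\<tau>. \<bar>edge_cov (cyc_pred V) r x B\<bar>))"
      using g(1) by (intro mult_right_mono edge_cov_le) (simp add: prod_nonneg)
    then show "g x * (\<Prod>B\<in>\<sigma>. \<bar>edge_cov (cyc_pred V) r x B\<bar>) \<le> K * (g x * (\<Prod>B\<in>\<tau>. \<bar>edge_cov (cyc_pred V) r x B\<bar>))"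
      by (simp add: st mult_ac)
  qed
  also have "\<dots> = K * (\<Sum>x\<in>PiE ({b} \<union> (V - {b})) (\<lambda>_. X). g x * (\<Prod>B\<in>\<tau>. \<bar>edge_cov (cyc_pred V) r x B\<bar>))"
    using V(4) by (simp add: sum_distrib_left insert_absorb)
  also have "\<dots> \<le> K * (K ^ card \<tau> * real (card X) ^ m * (\<Sum>x\<in>PiE {b} (\<lambda>_. X). g x))"
  proof (rule mult_left_mono, rule power_cancel_le[OF _ n])
    show "(\<Sum>x\<in>PiE ({b} \<union> (V - {b})) (\<lambda>_. X). g x * (\<Prod>B\<in>\<tau>. \<bar>edge_cov (cyc_pred V) r x B\<bar>)) * real (card X) ^ card \<tau>
      \<le> K ^ card \<tau> * real (card X) ^ (card \<tau> + m) * (\<Sum>x\<in>PiE {b} (\<lambda>_. X). g x)"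
      unfolding cL[symmetric]
    proof (rule chain_bound_pairs[where \<rho> = "rank_from V b"])
      show "B \<inter> D = {}" if "B \<in> \<tau>" "D \<in> \<tau>" "B \<noteq> D" for B D
        using that pairings_disjoint[OF V(3), of B D] unfolding \<tau>_def by blast
      show "card B = 2 \<and> B \<subseteq> V - {b}" if "B \<in> \<tau>" for B
        using that V(3) B0 pairings_disjoint[OF V(3), of B B0 b] unfolding \<tau>_def by (auto simp: pairings_def partition_on_def)
      show "inj_on (rank_from V b) (V - {b})" using rank_from_inj[OF V(1)] by (rule inj_on_subset) auto
      show "cyc_pred V l \<in> {b} \<or> cyc_pred V l \<in> V - {b} \<and> rank_from V b (cyc_pred V l) < rank_from V b l" if "l \<in> V - {b}" for l
        using cyc_pred_rank[OF V(1), of l b] that V(4) by auto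
    qed (use fs V X g in \<open>auto simp: \<tau>_def\<close>)
  qed (use K_pos in auto)
  finally show ?thesis by (simp add: m mult_ac)
qed

lemma walk_bound_total:
  assumes V: "finite V" "card V = 2 * m" "m \<ge> 1" "\<sigma> \<in> pairings V" and X: "finite X" "X \<noteq> {}"
  shows "(\<Sum>x\<in>PiE V (\<lambda>_. X). (\<Prod>B\<in>\<sigma>. \<bar>edge_cov (cyc_pred V) r x B\<bar>)) \<le> K ^ m * real (card X) ^ (m + 1)"
proof -
  obtain b where "b \<in> V" using V by (metis card.empty ex_in_conv mult_is_0 not_one_le_zero zero_neq_numeral)
  from walk_bound[OF V(1,2,4) this X, of "\<lambda>_. 1" r]
  show ?thesis using sum_PiE_singleton[of "\<lambda>_. 1::real" b X] by (simp add: mult_ac)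
qed

text \<open>Since only v has u as its predecessor, the vertex u disappears with the block {u, v},
  and v becomes a free starting point. The count is n for v and n^(m - 1) for the other 2m - 2
  vertices. Such open walks multiply the error of a backtracking step.\<close>

lemma open_walk_bound:
  assumes V: "finite V" "card V = 2 * m" "\<sigma> \<in> pairings V" and X: "finite X" "X \<noteq> {}"
    and uv: "u < v" "{u,v} \<in> \<sigma>" "\<And>z. z \<in> V \<Longrightarrow> \<not> (u < z \<and> z < v)"
  shows "(\<Sum>x\<in>PiE (insert v (V - {u,v})) (\<lambda>_. X). (\<Prod>B\<in>\<sigma> - {{u,v}}. \<bar>edge_cov (cyc_pred V) r x B\<bar>))
    \<le> K ^ (m - 1) * real (card X) ^ m"
proof -
  have uvV: "u \<in> V" "v \<in> V" using pairings_subset[OF V(3) uv(2)] by auto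
  define \<tau> where "\<tau> = \<sigma> - {{u,v}}"
  have fs: "finite \<sigma>" using pairings_finite V by auto
  have cs: "card \<sigma> = m" using pairings_card[OF V(3,1)] V by simp
  have m: "m = Suc (card \<tau>)" using cs card.remove[OF fs uv(2)] by (simp add: \<tau>_def)
  have n: "real (card X) > 0" using X by (simp add: card_gt_0_iff)
  have cL: "card (V - {u,v}) = card \<tau> + card \<tau>" using V m uv(1) uvV by (simp add: card_Diff_subset)
  have tp: "\<tau> \<in> pairings (V - {u,v})" unfolding \<tau>_def by (rule pairings_remove[OF V(3) uv(2)])
  have "(\<Sum>x\<in>PiE ({v} \<union> (V - {u,v})) (\<lambda>_. X). 1 * (\<Prod>B\<in>\<tau>. \<bar>edge_cov (cyc_pred V) r x B\<bar>)) * real (card X) ^ card \<tau>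
      \<le> K ^ card \<tau> * real (card X) ^ card (V - {u,v}) * (\<Sum>x\<in>PiE {v} (\<lambda>_. X). 1)"
  proof (rule chain_bound_pairs[where \<rho> = "rank_from V v"])
    show "B \<inter> D = {}" if "B \<in> \<tau>" "D \<in> \<tau>" "B \<noteq> D" for B D
      using that pairings_disjoint[OF tp, of B D] by blast
    show "card B = 2 \<and> B \<subseteq> V - {u,v}" if "B \<in> \<tau>" for B
      using that tp pairings_subset[OF tp that] by (auto simp: pairings_def)
    show "inj_on (rank_from V v) (V - {u,v})" using rank_from_inj[OF V(1)] by (rule inj_on_subset) auto
    show "cyc_pred V l \<in> {v} \<or> cyc_pred V l \<in> V - {u,v} \<and> rank_from V v (cyc_pred V l) < rank_from V v l" if "l \<in> V - {u,v}" for l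
      using cyc_pred_rank[OF V(1), of l v] cyc_pred_neq_u[OF V(1) uvV uv(1) uv(3), of l] that uvV by auto
  qed (use fs V X in \<open>auto simp: \<tau>_def\<close>)
  then have "(\<Sum>x\<in>PiE ({v} \<union> (V - {u,v})) (\<lambda>_. X). (\<Prod>B\<in>\<tau>. \<bar>edge_cov (cyc_pred V) r x B\<bar>))
      \<le> K ^ card \<tau> * real (card X) ^ card \<tau> * (\<Sum>x\<in>PiE {v} (\<lambda>_. X). 1)"
    unfolding cL mult_1_left by (rule power_cancel_le[OF _ n])
  then show ?thesis using sum_PiE_singleton[of "\<lambda>_. 1::real" v X] by (simp add: \<tau>_def[symmetric] m mult_ac)
qed

text \<open>Every block that meets the set I between u and v has its other end outside. Once the
  outer vertices and u, z are fixed, where z is the first element of I, the rest of I costs only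
  constants. The vertices u and z are then summed together through the single block of z. What
  remains is an open walk from v with a total of n^m, one factor below the closed-walk
  bound.\<close>

lemma crossing_walk_bound:
  assumes V: "finite V" "card V = 2 * m" "\<sigma> \<in> pairings V" and X: "finite X" "X \<noteq> {}"
    and uv: "u < v" "{u,v} \<in> \<sigma>" "\<And>B. B \<in> \<sigma> \<Longrightarrow> \<not> (u < Min B \<and> Max B < v)"
    and ex: "\<exists>z\<in>V. u < z \<and> z < v"
  shows "(\<Sum>x\<in>PiE V (\<lambda>_. X). (\<Prod>B\<in>\<sigma>. \<bar>edge_cov (cyc_pred V) r x B\<bar>)) \<le> K ^ m * real (card X) ^ m"
proof -
  let ?C = "\<lambda>x B. \<bar>edge_cov (cyc_pred V) r x B\<bar>"
  have uvV: "u \<in> V" "v \<in> V" using pairings_subset[OF V(3) uv(2)] by auto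
  have fs: "finite \<sigma>" using pairings_finite V by auto
  have cs: "card \<sigma> = m" using pairings_card[OF V(3,1)] V by simp
  have n: "real (card X) > 0" using X by (simp add: card_gt_0_iff)
  define I where "I = {l\<in>V. u < l \<and> l < v}"
  have I: "finite I" "I \<noteq> {}" using V ex by (auto simp: I_def)
  define z where "z = Min I"
  have z: "z \<in> I" "\<And>l. l \<in> I \<Longrightarrow> z \<le> l" using I by (auto simp: z_def)
  have zV: "z \<in> V" "u < z" "z < v" using z by (auto simp: I_def)
  define Ot where "Ot = V - I - {u}"
  define L1 where "L1 = Ot - {v}"
  have vO: "v \<in> Ot" "Ot = insert v L1" "v \<notin> L1" using uvV uv(1) by (auto simp: Ot_def L1_def I_def)
  have prz: "cyc_pred V z = u" by (rule cyc_pred_succ[OF V(1) uvV(1) zV(1,2)]) (use z(2) zV(3) in \<open>force simp: I_def\<close>)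
  have prI: "cyc_pred V l \<in> I \<and> cyc_pred V l < l" if l: "l \<in> I - {z}" for l
  proof -
    have "l \<in> V" "z < l" using l z(2)[of l] by (auto simp: I_def)
    have "l < v" using l by (auto simp: I_def)
    have "\<not> (\<forall>j\<in>V. l \<le> j)" using \<open>z < l\<close> zV(1) by (auto simp: not_le)
    then have 2: "cyc_pred V l \<in> V" "cyc_pred V l < l" "\<forall>j\<in>V. j < l \<longrightarrow> j \<le> cyc_pred V l" using cyc_pred_disj[OF V(1) \<open>l \<in> V\<close>] by auto
    then have "z \<le> cyc_pred V l" using zV(1) \<open>z < l\<close> by blast
    then show ?thesis using 2(1,2) zV(2) \<open>l < v\<close> by (simp add: I_def)
  qed
  have MV: "Max V \<in> V" "v \<le> Max V" using V(1) uvV by (auto intro!: Max_in)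
  have prO: "cyc_pred V l \<in> Ot" if l: "l \<in> L1" for l
  proof -
    have lV: "l \<in> V" "\<not> (u \<le> l \<and> l \<le> v)" using l by (auto simp: L1_def Ot_def I_def)
    from cyc_pred_disj[OF V(1) lV(1)] show ?thesis
    proof
      assume 1: "(\<forall>j\<in>V. l \<le> j) \<and> cyc_pred V l = Max V"
      then show ?thesis using MV uv(1) by (auto simp: Ot_def I_def)
    next
      assume 2: "cyc_pred V l \<in> V \<and> cyc_pred V l < l \<and> (\<forall>j\<in>V. j < l \<longrightarrow> j \<le> cyc_pred V l)"
      then have "cyc_pred V l < u \<or> v \<le> cyc_pred V l" using lV(2) uvV uv(1) by force
      then show ?thesis using 2 uv(1) by (auto simp: Ot_def I_def)
    qed
  qed
  obtain Bz where Bz: "Bz \<in> \<sigma>" "z \<in> Bz" using pairings_cover[OF V(3) zV(1)] by blast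
  have nouv: "B \<inter> {u,v} = {}" if "B \<in> \<sigma>" "B \<noteq> {u,v}" for B
    using pairings_disjoint[OF V(3) that(1) uv(2)] that by blast
  have Bz_ne: "Bz \<noteq> {u,v}" using Bz zV by auto
  \<comment> \<open>A block with both ends in I would be nested inside {u, v}, contrary to the
    choice of u and v.\<close>
  have split: "\<exists>c l. B = {c,l} \<and> c \<noteq> l \<and> l \<in> I \<and> c \<in> L1" if B: "B \<in> \<sigma>" "B \<inter> I \<noteq> {}" for B
  proof -
    obtain a b where ab: "a < b" "B = {a,b}" "a \<in> V" "b \<in> V" "Min B = a" "Max B = b"
      using pairings_block[OF V(3) B(1)] by metis
    have "B \<noteq> {u,v}" using B(2) by (auto simp: I_def)
    then have n: "a \<noteq> u" "a \<noteq> v" "b \<noteq> u" "b \<noteq> v" using nouv[OF B(1)] ab by auto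
    have "\<not> (u < a \<and> b < v)" using uv(3)[OF B(1)] ab by auto
    then have "a \<notin> I \<or> b \<notin> I" by (auto simp: I_def)
    then show ?thesis
    proof
      assume "a \<notin> I" then have "b \<in> I" "a \<in> L1" using B(2) ab n by (auto simp: L1_def Ot_def)
      then show ?thesis using ab by blast
    next
      assume "b \<notin> I" then have "a \<in> I" "b \<in> L1" using B(2) ab n by (auto simp: L1_def Ot_def)
      then show ?thesis using ab by (intro exI[of _ b] exI[of _ a]) auto
    qed
  qed
  obtain z' where z': "Bz = {z', z}" "z' \<noteq> z" "z' \<in> L1"
  proof -
    obtain c l where "Bz = {c,l}" "c \<noteq> l" "l \<in> I" "c \<in> L1" using split[OF Bz(1)] Bz z by blast
    moreover have "z \<notin> L1" using z by (auto simp: L1_def Ot_def)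
    ultimately show ?thesis using that Bz(2) by auto
  qed
  \<comment> \<open>The blocks are divided into {u, v}, the block of z, the other blocks across the
    boundary of I (\<tau>2), and those that stay outside (\<tau>1).\<close>
  define \<tau>2 where "\<tau>2 = {B\<in>\<sigma>. B \<inter> I \<noteq> {} \<and> B \<noteq> Bz}"
  define \<tau>1 where "\<tau>1 = {B\<in>\<sigma>. B \<subseteq> L1}"
  have f12: "finite \<tau>1" "finite \<tau>2" using fs by (auto simp: \<tau>1_def \<tau>2_def)
  have LI: "L1 \<inter> I = {}" "u \<notin> L1" "v \<notin> L1" "u \<notin> I" "v \<notin> I" by (auto simp: L1_def Ot_def I_def)
  have dec: "\<sigma> = insert {u,v} (insert Bz (\<tau>1 \<union> \<tau>2))"
  proof -
    have "B \<in> \<tau>1" if B: "B \<in> \<sigma>" "B \<noteq> {u,v}" "B \<inter> I = {}" for B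
      using nouv[OF B(1,2)] B pairings_subset[OF V(3) B(1)] by (auto simp: \<tau>1_def L1_def Ot_def)
    then show ?thesis using uv(2) Bz(1) by (auto simp: \<tau>1_def \<tau>2_def)
  qed
  have nin: "{u,v} \<notin> insert Bz (\<tau>1 \<union> \<tau>2)" "Bz \<notin> \<tau>1 \<union> \<tau>2" "\<tau>1 \<inter> \<tau>2 = {}"
    using Bz_ne LI z z' by (auto simp: \<tau>1_def \<tau>2_def)
  have cm: "m = card \<tau>1 + card \<tau>2 + 2"
    unfolding cs[symmetric] by (subst dec) (use nin f12 in \<open>simp add: card_Un_disjoint\<close>)
  \<comment> \<open>As many blocks as vertices: the summation over I without z gains no power of n
    at all.\<close>
  have cI: "card (I - {z}) = card \<tau>2"
  proof -
    have "I - {z} = (\<Union>B\<in>\<tau>2. B \<inter> I)"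
    proof
      show "I - {z} \<subseteq> (\<Union>B\<in>\<tau>2. B \<inter> I)"
      proof
        fix l assume l: "l \<in> I - {z}"
        then obtain B where B: "B \<in> \<sigma>" "l \<in> B" using pairings_cover[OF V(3), of l] by (auto simp: I_def)
        have "B \<noteq> Bz" using B l z' LI by auto
        then show "l \<in> (\<Union>B\<in>\<tau>2. B \<inter> I)" using B l by (auto simp: \<tau>2_def)
      qed
      show "(\<Union>B\<in>\<tau>2. B \<inter> I) \<subseteq> I - {z}"
        using pairings_disjoint[OF V(3) _ Bz(1) _ Bz(2)] by (auto simp: \<tau>2_def)
    qed
    also have "card (\<Union>B\<in>\<tau>2. B \<inter> I) = (\<Sum>B\<in>\<tau>2. card (B \<inter> I))"
      using f12 I pairings_disjoint[OF V(3)] by (intro card_UN_disjoint) (auto simp: \<tau>2_def)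
    also have "\<dots> = (\<Sum>B\<in>\<tau>2. 1)"
    proof (intro sum.cong refl)
      fix B assume B: "B \<in> \<tau>2"
      then obtain c l where "B = {c,l}" "c \<noteq> l" "l \<in> I" "c \<in> L1" using split[of B] by (auto simp: \<tau>2_def)
      then have "B \<inter> I = {l}" using LI by auto
      then show "card (B \<inter> I) = 1" by simp
    qed
    finally show ?thesis by simp
  qed
  have cV: "V = insert u (insert v (I \<union> L1))" using uvV by (auto simp: L1_def Ot_def I_def)
  have fL1: "finite L1" using V(1) by (auto simp: L1_def Ot_def)
  have "card V = card I + card L1 + 2"
    by (subst cV) (use LI fL1 I uv(1) in \<open>simp add: card_Un_disjoint Int_commute\<close>)
  moreover have "card I = Suc (card (I - {z}))" using card.remove[OF I(1) z(1)] .
  ultimately have cL1: "card L1 + 1 = card \<tau>1 + m" using V(2) cm cI by simp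
  let ?P = "\<lambda>\<tau> x. \<Prod>B\<in>\<tau>. ?C x B"
  have z'Ot: "z' \<in> Ot" "cyc_pred V z' \<in> Ot" using z'(3) prO vO by auto
  have uzO: "u \<notin> Ot" "z \<notin> Ot" using z by (auto simp: Ot_def)
  have indP1: "?P \<tau>1 (x(l := a)) = ?P \<tau>1 x" if "l \<notin> Ot" for l a x
  proof (intro prod.cong refl)
    fix B assume B: "B \<in> \<tau>1"
    have "card B = 2" using B V(3) by (auto simp: \<tau>1_def pairings_def)
    then obtain c d where cd: "B = {c,d}" "c \<noteq> d" by (auto simp: card_2_iff)
    have "c \<in> Ot" "d \<in> Ot" "cyc_pred V c \<in> Ot" "cyc_pred V d \<in> Ot" using B cd prO vO by (auto simp: \<tau>1_def)
    then show "?C (x(l := a)) B = ?C x B" using that unfolding cd(1) edge_cov_pair[OF cd(2)] by auto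
  qed
  have indz: "?C (x(l := a)) Bz = ?C x Bz" if "l \<in> I - {z}" for l a x
  proof -
    have "l \<noteq> z" "l \<noteq> z'" "l \<noteq> cyc_pred V z'" "l \<noteq> cyc_pred V z" using that z' z'Ot LI prz by (auto simp: Ot_def)
    then show ?thesis unfolding z'(1) edge_cov_pair[OF z'(2)] by simp
  qed
  have VOI: "V = (insert z (insert u Ot)) \<union> (I - {z})" using z zV uvV by (auto simp: Ot_def I_def)
  have "(\<Sum>x\<in>PiE V (\<lambda>_. X). ?P \<sigma> x) \<le> (\<Sum>x\<in>PiE V (\<lambda>_. X). K * ((?P \<tau>1 x * ?C x Bz) * ?P \<tau>2 x))"
  proof (rule sum_mono)
    fix x
    have "?P \<sigma> x = ?C x {u,v} * ((?P \<tau>1 x * ?C x Bz) * ?P \<tau>2 x)"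
      by (subst dec) (use nin f12 in \<open>simp add: prod.union_disjoint mult_ac\<close>)
    also have "\<dots> \<le> K * ((?P \<tau>1 x * ?C x Bz) * ?P \<tau>2 x)"
      by (intro mult_right_mono edge_cov_le) (simp add: prod_nonneg)
    finally show "?P \<sigma> x \<le> K * ((?P \<tau>1 x * ?C x Bz) * ?P \<tau>2 x)" .
  qed
  also have "\<dots> = K * (\<Sum>x\<in>PiE V (\<lambda>_. X). (?P \<tau>1 x * ?C x Bz) * ?P \<tau>2 x)" by (simp add: sum_distrib_left)
  \<comment> \<open>The vertices of I behind z are eliminated from the right; each has its
    predecessor in I and its partner outside, so the natural order is a valid rank.\<close>
  also have "(\<Sum>x\<in>PiE V (\<lambda>_. X). (?P \<tau>1 x * ?C x Bz) * ?P \<tau>2 x)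
     \<le> K ^ card \<tau>2 * real (card X) ^ 0 * (\<Sum>x\<in>PiE (insert z (insert u Ot)) (\<lambda>_. X). ?P \<tau>1 x * ?C x Bz)"
  proof -
    have "(\<Sum>x\<in>PiE (insert z (insert u Ot) \<union> (I - {z})) (\<lambda>_. X). (?P \<tau>1 x * ?C x Bz) * ?P \<tau>2 x) * real (card X) ^ card \<tau>2
     \<le> K ^ card \<tau>2 * real (card X) ^ card (I - {z}) * (\<Sum>x\<in>PiE (insert z (insert u Ot)) (\<lambda>_. X). ?P \<tau>1 x * ?C x Bz)"
    proof (rule chain_bound[where \<rho> = "\<lambda>l. l"])
      show "insert z (insert u Ot) \<inter> (I - {z}) = {}" by (auto simp: Ot_def I_def)
      show "B \<inter> D = {}" if "B \<in> \<tau>2" "D \<in> \<tau>2" "B \<noteq> D" for B D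
        using that pairings_disjoint[OF V(3), of B D] unfolding \<tau>2_def by blast
      show "\<exists>c l. B = {c, l} \<and> c \<noteq> l \<and> l \<in> I - {z} \<and>
        (\<forall>y\<in>{c, cyc_pred V c, cyc_pred V l}. y \<in> insert z (insert u Ot) \<or> y \<in> I - {z} \<and> y < l)" if B: "B \<in> \<tau>2" for B
      proof -
        obtain c l where cl: "B = {c,l}" "c \<noteq> l" "l \<in> I" "c \<in> L1" using split[of B] B by (auto simp: \<tau>2_def)
        have "l \<noteq> z" using B cl pairings_disjoint[OF V(3) _ Bz(1) _ Bz(2), of B] by (auto simp: \<tau>2_def)
        then show ?thesis using cl prO[OF cl(4)] prI[of l] vO by (intro exI[of _ c] exI[of _ l]) auto
      qed
      show "?P \<tau>1 (x(l := a)) * ?C (x(l := a)) Bz = ?P \<tau>1 x * ?C x Bz" if "l \<in> I - {z}" for x l a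
        using indP1[of l] indz[OF that] that by (simp add: Ot_def)
    qed (use I X f12 in \<open>auto simp: prod_nonneg\<close>)
    then show ?thesis unfolding VOI[symmetric] cI
      by (rule power_cancel_le[where c = 0, unfolded add_0_right, OF _ n])
  qed
  \<comment> \<open>With {u, v} already bounded, \<open>x u\<close> enters only as the start of the
    edge ending at z, which is why \<open>C_sum2\<close> can sum over both vertices.\<close>
  also have "(\<Sum>x\<in>PiE (insert z (insert u Ot)) (\<lambda>_. X). ?P \<tau>1 x * ?C x Bz) \<le> K * (\<Sum>x\<in>PiE Ot (\<lambda>_. X). ?P \<tau>1 x)"
  proof -
    have "(\<Sum>x\<in>PiE (insert z (insert u Ot)) (\<lambda>_. X). ?P \<tau>1 x * ?C x Bz)
       = (\<Sum>x\<in>PiE Ot (\<lambda>_. X). \<Sum>a\<in>X. \<Sum>b\<in>X. ?P \<tau>1 x * ?C (x(u := a, z := b)) Bz)"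
      using uzO zV indP1 by (simp add: sum_PiE_insert)
    also have "\<dots> = (\<Sum>x\<in>PiE Ot (\<lambda>_. X). ?P \<tau>1 x * (\<Sum>a\<in>X. \<Sum>b\<in>X. ?C (x(u := a, z := b)) Bz))"
      by (simp add: sum_distrib_left)
    also have "\<dots> \<le> (\<Sum>x\<in>PiE Ot (\<lambda>_. X). ?P \<tau>1 x * K)"
    proof (intro sum_mono mult_left_mono)
      fix x
      have ne: "z' \<noteq> u" "z' \<noteq> z" "cyc_pred V z' \<noteq> u" "cyc_pred V z' \<noteq> z" "u \<noteq> z" using z'Ot uzO zV by auto
      show "(\<Sum>a\<in>X. \<Sum>b\<in>X. ?C (x(u := a, z := b)) Bz) \<le> K"
        unfolding z'(1) edge_cov_pair[OF z'(2)] using ne C_sum2[OF X(1)] by (simp add: prz)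
    qed (simp add: prod_nonneg)
    finally show ?thesis by (simp add: sum_distrib_left mult.commute)
  qed
  also have "(\<Sum>x\<in>PiE Ot (\<lambda>_. X). ?P \<tau>1 x) \<le> K ^ card \<tau>1 * real (card X) ^ m"
  proof -
    have "(\<Sum>x\<in>PiE ({v} \<union> L1) (\<lambda>_. X). 1 * ?P \<tau>1 x) * real (card X) ^ card \<tau>1
      \<le> K ^ card \<tau>1 * real (card X) ^ card L1 * (\<Sum>x\<in>PiE {v} (\<lambda>_. X). 1)"
    proof (rule chain_bound_pairs[where \<rho> = "rank_from V v"])
      show "B \<inter> D = {}" if "B \<in> \<tau>1" "D \<in> \<tau>1" "B \<noteq> D" for B D
        using that pairings_disjoint[OF V(3), of B D] unfolding \<tau>1_def by blast
      show "card B = 2 \<and> B \<subseteq> L1" if "B \<in> \<tau>1" for B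
        using that V(3) by (auto simp: pairings_def \<tau>1_def)
      show "inj_on (rank_from V v) L1" using rank_from_inj[OF V(1)] by (rule inj_on_subset) (auto simp: L1_def Ot_def)
      show "cyc_pred V l \<in> {v} \<or> cyc_pred V l \<in> L1 \<and> rank_from V v (cyc_pred V l) < rank_from V v l" if "l \<in> L1" for l
        using cyc_pred_rank[OF V(1), of l v] prO[OF that] that uvV by (auto simp: L1_def Ot_def)
    qed (use fL1 X f12 LI in auto)
    then have "(\<Sum>x\<in>PiE Ot (\<lambda>_. X). ?P \<tau>1 x) * real (card X) ^ card \<tau>1 \<le> K ^ card \<tau>1 * real (card X) ^ (card L1 + 1)"
      using sum_PiE_singleton[of "\<lambda>_. 1::real" v X] vO by (simp add: mult_ac)
    then have "(\<Sum>x\<in>PiE Ot (\<lambda>_. X). ?P \<tau>1 x) * real (card X) ^ card \<tau>1 \<le> K ^ card \<tau>1 * real (card X) ^ (card \<tau>1 + m) * 1"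
      unfolding cL1 by simp
    from power_cancel_le[OF this n] show ?thesis by simp
  qed
  finally show ?thesis using K_pos by (simp add: cm power_add mult_ac)
qed

text \<open>Both cycles are cut open at the ends of a linking block, whose covariance is bounded by
  K. The two starting points give n^2 and the remaining 2m - 2 vertices n^(m - 1): one factor less
  than the n^(m + 2) of two separate closed walks.\<close>

lemma linked_walk_bound:
  assumes V: "finite V1" "finite V2" "V1 \<inter> V2 = {}" "card (V1 \<union> V2) = 2 * m" "\<sigma> \<in> pairings (V1 \<union> V2)"
    and X: "finite X" "X \<noteq> {}"
    and uv: "{u,v} \<in> \<sigma>" "u \<in> V1" "v \<in> V2"
  shows "(\<Sum>x\<in>PiE (V1 \<union> V2) (\<lambda>_. X). (\<Prod>B\<in>\<sigma>. \<bar>edge_cov (\<lambda>l. if l \<in> V1 then cyc_pred V1 l else cyc_pred V2 l) r x B\<bar>))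
    \<le> K ^ m * real (card X) ^ (m + 1)"
proof -
  define V where "V = V1 \<union> V2"
  define q where "q l = (if l \<in> V1 then cyc_pred V1 l else cyc_pred V2 l)" for l
  let ?C = "\<lambda>x B. \<bar>edge_cov q r x B\<bar>"
  have fV: "finite V" using V by (simp add: V_def)
  have sp: "\<sigma> \<in> pairings V" using V by (simp add: V_def)
  have ne: "u \<noteq> v" using uv V by auto
  define \<tau> where "\<tau> = \<sigma> - {{u,v}}"
  have fs: "finite \<sigma>" using pairings_finite[OF sp fV] .
  have cs: "card \<sigma> = m" using pairings_card[OF sp fV] V by (simp add: V_def)
  have m: "m = Suc (card \<tau>)" using cs card.remove[OF fs uv(1)] by (simp add: \<tau>_def)
  have n: "real (card X) > 0" using X by (simp add: card_gt_0_iff)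
  have cL: "card (V - {u,v}) = card \<tau> + card \<tau>"
    using V m uv ne by (simp add: card_Diff_subset V_def)
  have tp: "\<tau> \<in> pairings (V - {u,v})" unfolding \<tau>_def by (rule pairings_remove[OF sp uv(1)])
  \<comment> \<open>Even ranks for one cycle and odd ranks for the other keep \<rho> injective on
    the union.\<close>
  define \<rho> where "\<rho> l = (if l \<in> V1 then 2 * rank_from V1 u l else 2 * rank_from V2 v l + 1)" for l
  have "(\<Sum>x\<in>PiE ({u,v} \<union> (V - {u,v})) (\<lambda>_. X). 1 * (\<Prod>B\<in>\<tau>. ?C x B)) * real (card X) ^ card \<tau>
      \<le> K ^ card \<tau> * real (card X) ^ card (V - {u,v}) * (\<Sum>x\<in>PiE {u,v} (\<lambda>_. X). 1)"
  proof (rule chain_bound_pairs[where \<rho> = \<rho>])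
    show "B \<inter> D = {}" if "B \<in> \<tau>" "D \<in> \<tau>" "B \<noteq> D" for B D
      using that pairings_disjoint[OF tp, of B D] by blast
    show "card B = 2 \<and> B \<subseteq> V - {u,v}" if "B \<in> \<tau>" for B
      using that tp pairings_subset[OF tp that] by (auto simp: pairings_def)
    show "inj_on \<rho> (V - {u,v})"
    proof (rule inj_onI)
      fix x y assume xy: "x \<in> V - {u,v}" "y \<in> V - {u,v}" "\<rho> x = \<rho> y"
      have "x \<in> V1 \<longleftrightarrow> y \<in> V1" using arg_cong[OF xy(3), of even] by (auto simp: \<rho>_def split: if_splits)
      then show "x = y" using xy inj_onD[OF rank_from_inj[OF V(1)], of u x y] inj_onD[OF rank_from_inj[OF V(2)], of v x y]
        by (auto simp: \<rho>_def V_def split: if_splits)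
    qed
    show "q l \<in> {u,v} \<or> q l \<in> V - {u,v} \<and> \<rho> (q l) < \<rho> l" if l: "l \<in> V - {u,v}" for l
    proof (cases "l \<in> V1")
      case True
      then show ?thesis using cyc_pred_rank[OF V(1), of l u] l uv by (auto simp: q_def \<rho>_def V_def)
    next
      case False
      then have "l \<in> V2" using l by (auto simp: V_def)
      then show ?thesis using cyc_pred_rank[OF V(2), of l v] l uv False V(3) by (auto simp: q_def \<rho>_def V_def)
    qed
  qed (use fs fV X in \<open>auto simp: \<tau>_def\<close>)
  then have "(\<Sum>x\<in>PiE ({u,v} \<union> (V - {u,v})) (\<lambda>_. X). (\<Prod>B\<in>\<tau>. ?C x B))
      \<le> K ^ card \<tau> * real (card X) ^ card \<tau> * (\<Sum>x\<in>PiE {u,v} (\<lambda>_. X). 1)"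
    unfolding cL mult_1_left by (rule power_cancel_le[OF _ n])
  moreover have "{u,v} \<union> (V - {u,v}) = V" using uv by (auto simp: V_def)
  ultimately have "(\<Sum>x\<in>PiE V (\<lambda>_. X). (\<Prod>B\<in>\<tau>. ?C x B)) \<le> K ^ card \<tau> * real (card X) ^ (m + 1)"
    using ne by (simp add: card_PiE m mult_ac power2_eq_square)
  then have "K * (\<Sum>x\<in>PiE V (\<lambda>_. X). (\<Prod>B\<in>\<tau>. ?C x B)) \<le> K * (K ^ card \<tau> * real (card X) ^ (m + 1))"
    using K_pos by (intro mult_left_mono) auto
  moreover have "(\<Sum>x\<in>PiE V (\<lambda>_. X). (\<Prod>B\<in>\<sigma>. ?C x B)) \<le> K * (\<Sum>x\<in>PiE V (\<lambda>_. X). (\<Prod>B\<in>\<tau>. ?C x B))"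
    unfolding sum_distrib_left
  proof (rule sum_mono)
    fix x
    have "(\<Prod>B\<in>\<sigma>. ?C x B) = ?C x {u,v} * (\<Prod>B\<in>\<tau>. ?C x B)"
      unfolding \<tau>_def by (rule prod.remove[OF fs uv(1)])
    also have "\<dots> \<le> K * (\<Prod>B\<in>\<tau>. ?C x B)" by (intro mult_right_mono edge_cov_le) (simp add: prod_nonneg)
    finally show "(\<Prod>B\<in>\<sigma>. ?C x B) \<le> K * (\<Prod>B\<in>\<tau>. ?C x B)" .
  qed
  moreover have "q = (\<lambda>l. if l \<in> V1 then cyc_pred V1 l else cyc_pred V2 l)" by (auto simp: q_def)
  ultimately show ?thesis by (simp add: V_def m mult_ac)
qed

end

section \<open>Limits of the sums over walks\<close>

text \<open>Absolutely summable families are integrable for the counting measure, to which the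
  integral theorem applies.\<close>

lemma infsum_dominated_convergence:
  fixes h :: "nat \<Rightarrow> 'b \<Rightarrow> real"
  assumes M: "M summable_on UNIV" and dom: "\<And>n t. \<bar>h n t\<bar> \<le> M t"
    and lim: "\<And>t. (\<lambda>n. h n t) \<longlonglongrightarrow> l t"
  shows "(\<lambda>n. \<Sum>\<^sub>\<infinity>t. h n t) \<longlonglongrightarrow> (\<Sum>\<^sub>\<infinity>t. l t)"
proof -
  have eq: "infsum f UNIV = integral\<^sup>L (count_space UNIV) f \<and> integrable (count_space UNIV) f"
    if "\<And>t. \<bar>f t\<bar> \<le> M t" for f :: "'b \<Rightarrow> real"
  proof -
    have "(\<lambda>t. norm (f t)) summable_on UNIV"
      using that by (intro summable_on_comparison_test[OF M]) auto
    then have "Infinite_Set_Sum.abs_summable_on f UNIV" using abs_summable_equivalent by blast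
    then show ?thesis using infsetsum_infsum[of f UNIV]
      by (simp add: infsetsum_def Infinite_Set_Sum.abs_summable_on_def)
  qed
  have Mnn: "\<bar>M t\<bar> \<le> M t" for t using dom[of 0 t] by simp
  have dl: "\<bar>l t\<bar> \<le> M t" for t
    using dom by (intro LIMSEQ_le_const2[OF tendsto_rabs[OF lim]]) auto
  have "(\<lambda>n. integral\<^sup>L (count_space UNIV) (h n)) \<longlonglongrightarrow> integral\<^sup>L (count_space UNIV) l"
    using eq[of M, OF Mnn] by (intro integral_dominated_convergence[where w=M]) (auto simp: lim dom)
  then show ?thesis using eq[of l, OF dl] eq[of "h _", OF dom] by simp
qed

section \<open>Walks with a backtracking step\<close>

context summable_covariance begin

definition opp_count :: "nat \<Rightarrow> int \<Rightarrow> int \<Rightarrow> int \<Rightarrow> nat" where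
  "opp_count n a s d = card {z\<in>{0..<int n}. opposite a z (z + s) d}"

text \<open>The directions can fail to be opposite only for z between a and d - s, hence for at most
  |a - d + s| values.\<close>

lemma opp_count_bounds:
  "opp_count n a s d \<le> n" "real n \<le> real (opp_count n a s d) + \<bar>real_of_int (a - d + s)\<bar>"
proof -
  let ?X = "{0..<int n}"
  have c: "card {z\<in>?X. opposite a z (z + s) d} \<le> card ?X" by (intro card_mono) auto
  then show "opp_count n a s d \<le> n" by (simp add: opp_count_def)
  have "?X \<subseteq> {z\<in>?X. opposite a z (z + s) d} \<union> ({a..<d-s} \<union> {d-s..<a})"
    by (auto simp: opposite_def)
  then have "card ?X \<le> card {z\<in>?X. opposite a z (z + s) d} + (card {a..<d-s} + card {d-s..<a})"
  proof -
    assume sub: "?X \<subseteq> {z\<in>?X. opposite a z (z + s) d} \<union> ({a..<d-s} \<union> {d-s..<a})"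
    have "card ?X \<le> card ({z\<in>?X. opposite a z (z + s) d} \<union> ({a..<d-s} \<union> {d-s..<a}))"
      by (rule card_mono[OF _ sub]) (auto intro: finite_subset[of _ ?X])
    also have "\<dots> \<le> card {z\<in>?X. opposite a z (z + s) d} + card ({a..<d-s} \<union> {d-s..<a})" by (rule card_Un_le)
    also have "card ({a..<d-s} \<union> {d-s..<a}) \<le> card {a..<d-s} + card {d-s..<a}" by (rule card_Un_le)
    finally show ?thesis by simp
  qed
  then show "real n \<le> real (opp_count n a s d) + \<bar>real_of_int (a - d + s)\<bar>"
    by (auto simp: opp_count_def)
qed

text \<open>In the opposite case the covariance is \<open>R (a - d) s\<close>, free of z, which
  gives the main term. The error from \<open>C_err\<close> has z in both arguments of R, so its sum
  over z stays below S whatever n is.\<close>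

lemma sum_C_backtrack:
  "\<bar>(\<Sum>z\<in>{0..<int n}. C a z (z + s) d) - real (opp_count n a s d) * R (a - d) s\<bar> \<le> S"
proof -
  let ?X = "{0..<int n}"
  have "real (opp_count n a s d) * R (a - d) s = (\<Sum>z\<in>?X. if opposite a z (z + s) d then R (a - d) (z + s - z) else 0)"
    by (simp add: opp_count_def flip: sum.inter_filter)
  then have "\<bar>(\<Sum>z\<in>?X. C a z (z + s) d) - real (opp_count n a s d) * R (a - d) s\<bar> =
    \<bar>\<Sum>z\<in>?X. C a z (z + s) d - (if opposite a z (z + s) d then R (a - d) (z + s - z) else 0)\<bar>"
    by (simp add: sum_subtractf)
  also have "\<dots> \<le> (\<Sum>z\<in>?X. \<bar>R (a - (z + s)) (d - z)\<bar>)"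
    by (rule order_trans[OF sum_abs]) (intro sum_mono C_err)
  also have "\<dots> \<le> S" by (intro sum_R_le) (auto simp: inj_on_def)
  finally show ?thesis .
qed

definition W :: "nat \<Rightarrow> nat set \<Rightarrow> nat set set \<Rightarrow> (nat \<Rightarrow> int) \<Rightarrow> real" where
  "W n V \<sigma> r = (\<Sum>x\<in>PiE V (\<lambda>_. {0..<int n}). \<Prod>B\<in>\<sigma>. edge_cov (cyc_pred V) r x B)"

lemma W_abs_le:
  "\<bar>W n V \<sigma> r\<bar> \<le> (\<Sum>x\<in>PiE V (\<lambda>_. {0..<int n}). \<Prod>B\<in>\<sigma>. \<bar>edge_cov (cyc_pred V) r x B\<bar>)"
  unfolding W_def by (rule order_trans[OF sum_abs]) (simp add: abs_prod)

lemma tendsto_over_n: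
  fixes f :: "nat \<Rightarrow> real"
  assumes "\<And>n. n \<ge> 1 \<Longrightarrow> \<bar>f n - c\<bar> \<le> k / real n"
  shows "f \<longlonglongrightarrow> c"
proof (rule LIM_zero_cancel, rule Lim_null_comparison)
  show "\<forall>\<^sub>F n in sequentially. norm (f n - c) \<le> k / real n"
    using assms by (auto simp: eventually_sequentially intro!: exI[of _ 1])
  show "(\<lambda>n. k / real n) \<longlonglongrightarrow> 0" by real_asymp
qed

lemma W_crossing_tendsto:
  assumes V: "finite V" "card V = 2 * m" "\<sigma> \<in> pairings V"
    and uv: "u < v" "{u,v} \<in> \<sigma>" "\<And>B. B \<in> \<sigma> \<Longrightarrow> \<not> (u < Min B \<and> Max B < v)"
    and ex: "\<exists>z\<in>V. u < z \<and> z < v"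
  shows "(\<lambda>n. W n V \<sigma> r / real n ^ (m + 1)) \<longlonglongrightarrow> 0"
proof (rule tendsto_over_n[where k = "K ^ m"])
  fix n :: nat assume n: "n \<ge> 1"
  have "\<bar>W n V \<sigma> r\<bar> \<le> K ^ m * real n ^ m"
    using order_trans[OF W_abs_le crossing_walk_bound[OF V _ _ uv ex, of "{0..<int n}"]] n by simp
  then show "\<bar>W n V \<sigma> r / real n ^ (m + 1) - 0\<bar> \<le> K ^ m / real n"
    using n by (simp add: field_simps)
qed

lemma W_single_tendsto:
  assumes "u < v"
  shows "(\<lambda>n. W n {u,v} {{u,v}} r / real n ^ (1 + 1)) \<longlonglongrightarrow> R (r u) (r v)"
proof (rule tendsto_over_n[where k = "S + \<bar>real_of_int (r v + r u)\<bar> * \<bar>R (r v) (r u)\<bar>"])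
  fix n :: nat assume n: "n \<ge> 1"
  let ?X = "{0..<int n}"
  \<comment> \<open>With only two vertices each one precedes the other, so there is no third vertex
    p to receive a shift; this is the base case of the induction.\<close>
  have prs: "cyc_pred {u,v} v = u" "cyc_pred {u,v} u = v"
  proof -
    have "{j \<in> {u,v}. j < v} = {u}" "{j \<in> {u,v}. j < u} = {}" "Max {u,v} = v" using assms by auto
    then show "cyc_pred {u,v} v = u" "cyc_pred {u,v} u = v" by (simp_all add: cyc_pred_def)
  qed
  have uv: "u \<noteq> v" using assms by simp
  have "W n {u,v} {{u,v}} r = (\<Sum>x\<in>PiE (insert u (insert v {})) (\<lambda>_. ?X). edge_cov (cyc_pred {u,v}) r x {u,v})"
    by (simp add: W_def)
  also have "\<dots> = (\<Sum>b\<in>?X. \<Sum>z\<in>?X. C (b + r v) z (z + r u) b)"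
    using uv by (simp add: sum_PiE_insert edge_cov_pair prs)
  finally have W: "W n {u,v} {{u,v}} r = (\<Sum>b\<in>?X. \<Sum>z\<in>?X. C (b + r v) z (z + r u) b)" .
  have "\<bar>W n {u,v} {{u,v}} r - real n ^ 2 * R (r v) (r u)\<bar>
     = \<bar>\<Sum>b\<in>?X. (\<Sum>z\<in>?X. C (b + r v) z (z + r u) b) - real n * R (r v) (r u)\<bar>"
    by (simp add: W sum_subtractf power2_eq_square)
  also have "\<dots> \<le> (\<Sum>b\<in>?X. S + \<bar>real_of_int (r v + r u)\<bar> * \<bar>R (r v) (r u)\<bar>)"
  proof (rule order_trans[OF sum_abs], rule sum_mono)
    fix b
    let ?N = "real (opp_count n (b + r v) (r u) b)"
    have "\<bar>?N - real n\<bar> \<le> \<bar>real_of_int (r v + r u)\<bar>"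
      using opp_count_bounds[of n "b + r v" "r u" b] by simp
    then have "\<bar>?N * R (r v) (r u) - real n * R (r v) (r u)\<bar> \<le> \<bar>real_of_int (r v + r u)\<bar> * \<bar>R (r v) (r u)\<bar>"
      unfolding left_diff_distrib[symmetric] abs_mult by (rule mult_right_mono) simp
    then show "\<bar>(\<Sum>z\<in>?X. C (b + r v) z (z + r u) b) - real n * R (r v) (r u)\<bar> \<le> S + \<bar>real_of_int (r v + r u)\<bar> * \<bar>R (r v) (r u)\<bar>"
      using sum_C_backtrack[where n=n and a="b + r v" and s="r u" and d=b] by simp
  qed
  also have "\<dots> = real n * (S + \<bar>real_of_int (r v + r u)\<bar> * \<bar>R (r v) (r u)\<bar>)" by simp
  finally have *: "\<bar>W n {u,v} {{u,v}} r - real n ^ 2 * R (r v) (r u)\<bar> \<le> real n * (S + \<bar>real_of_int (r v + r u)\<bar> * \<bar>R (r v) (r u)\<bar>)" .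
  have "\<bar>W n {u,v} {{u,v}} r / real n ^ (1 + 1) - R (r u) (r v)\<bar> = \<bar>W n {u,v} {{u,v}} r - real n ^ 2 * R (r v) (r u)\<bar> / real n ^ 2"
  proof -
    have "W n {u,v} {{u,v}} r / real n ^ (1 + 1) - R (r u) (r v) = (W n {u,v} {{u,v}} r - real n ^ 2 * R (r v) (r u)) / real n ^ 2"
      using n R_sym[of "r u" "r v"] by (simp add: diff_divide_distrib power2_eq_square)
    then show ?thesis by (simp add: abs_divide)
  qed
  also have "\<dots> \<le> real n * (S + \<bar>real_of_int (r v + r u)\<bar> * \<bar>R (r v) (r u)\<bar>) / real n ^ 2"
    using * by (intro divide_right_mono) auto
  also have "\<dots> = (S + \<bar>real_of_int (r v + r u)\<bar> * \<bar>R (r v) (r u)\<bar>) / real n"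
    using n by (simp add: power2_eq_square)
  finally show "\<bar>W n {u,v} {{u,v}} r / real n ^ (1 + 1) - R (r u) (r v)\<bar> \<le> (S + \<bar>real_of_int (r v + r u)\<bar> * \<bar>R (r v) (r u)\<bar>) / real n" .
qed

lemma R_row_summable: "(\<lambda>t. \<bar>R t s\<bar>) summable_on UNIV"
proof -
  have "(\<lambda>t. \<bar>R s t\<bar>) summable_on UNIV"
    using summable_on_SigmaD1[of "\<lambda>u v. \<bar>R u v\<bar>" UNIV "\<lambda>_. UNIV" s] R_summable by simp
  then show ?thesis by (simp add: R_sym[of s])
qed

lemma card_shift_out: "card {a\<in>{0..<int n}. a + c \<notin> {0..<int n}} \<le> nat \<bar>c\<bar>"
proof -
  have "{a\<in>{0..<int n}. a + c \<notin> {0..<int n}} \<subseteq> (if c < 0 then {0..<-c} else {int n - c..<int n})" by auto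
  then have "card {a\<in>{0..<int n}. a + c \<notin> {0..<int n}} \<le> card (if c < 0 then {0..<-c} else {int n - c..<int n})"
    by (intro card_mono) auto
  then show ?thesis by (auto split: if_splits)
qed

section \<open>Removal of a pair of neighbouring steps\<close>

context
  fixes V m \<sigma> and u v :: nat
  assumes V: "finite V" "card V = 2 * m" "\<sigma> \<in> pairings V"
    and uv: "u < v" "{u,v} \<in> \<sigma>" "\<And>z. z \<in> V \<Longrightarrow> \<not> (u < z \<and> z < v)"
    and ne: "V - {u,v} \<noteq> {}"
begin

private definition "V' = V - {u,v}"
private definition "\<sigma>' = \<sigma> - {{u,v}}"
private definition "p = cyc_pred V u"

private lemma uvV: "u \<in> V" "v \<in> V" using pairings_subset[OF V(3) uv(2)] by auto
private lemma s'p: "\<sigma>' \<in> pairings V'" unfolding \<sigma>'_def V'_def by (rule pairings_remove[OF V(3) uv(2)])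
private lemma fV': "finite V'" using V by (simp add: V'_def)
private lemma cV': "card V' = 2 * (m - 1)" using V(1,2) uv(1) uvV by (simp add: V'_def card_Diff_subset)
private lemma m2: "m \<ge> 2"
proof -
  have "card V' > 0" using ne fV' by (simp add: V'_def card_gt_0_iff)
  then show ?thesis using cV' by simp
qed
private lemma p_in: "p \<in> V'" unfolding p_def V'_def by (rule cyc_pred_u_in[OF V(1) uvV uv(1,3) ne])

text \<open>After the removal the edge behind v starts at \<open>x p\<close> instead of at the
  vertex of v. The new jump at p has to bridge that distance in addition to the old jump at v; all
  other edges are unchanged.\<close>

private lemma rest_eq:
  assumes "\<And>l. l \<in> V' \<Longrightarrow> y l = x l" "B \<in> \<sigma>'"
  shows "edge_cov (cyc_pred V) r y B = edge_cov (cyc_pred V') (r(p := y v + r v - x p)) x B"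
proof -
  have st: "y (cyc_pred V l) + r (cyc_pred V l) = x (cyc_pred V' l) + (r(p := y v + r v - x p)) (cyc_pred V' l)" if l: "l \<in> V'" for l
  proof (cases "cyc_pred V l = v")
    case True
    then show ?thesis using cyc_pred_remove[OF V(1) uvV uv(1,3), of l] l by (simp add: V'_def[symmetric] p_def)
  next
    case False
    have lV: "l \<in> V" "l \<noteq> u" "l \<noteq> v" using l by (auto simp: V'_def)
    have "cyc_pred V l \<in> V'" using False cyc_pred_in[OF V(1) lV(1)] cyc_pred_neq_u[OF V(1) uvV uv(1,3) lV(1,3)] by (simp add: V'_def)
    moreover have "cyc_pred V l \<noteq> p" using cyc_pred_inj[OF V(1) lV(1) uvV(1)] lV(2) by (auto simp: p_def)
    moreover have "cyc_pred V' l = cyc_pred V l" using cyc_pred_remove[OF V(1) uvV uv(1,3), of l] l False by (simp add: V'_def)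
    ultimately show ?thesis using assms(1) by simp
  qed
  obtain c d where cd: "c < d" "B = {c,d}" "c \<in> V'" "d \<in> V'" using pairings_block[OF s'p assms(2)] by metis
  have "c \<noteq> d" using cd by simp
  then show ?thesis unfolding cd(2) edge_cov_pair[OF \<open>c \<noteq> d\<close>] using st[OF cd(3)] st[OF cd(4)] assms(1) cd by simp
qed

private definition "I x \<rho> = (\<Prod>B\<in>\<sigma>'. edge_cov (cyc_pred V') \<rho> x B)"

text \<open>Here z is the vertex of u and b that of v. Since z occurs only in the block {u, v}, its
  sum splits off, while b survives in the shift of the remaining walk.\<close>

private lemma W_eq: "W n V \<sigma> r = (\<Sum>x\<in>PiE V' (\<lambda>_. {0..<int n}). \<Sum>b\<in>{0..<int n}.
   (\<Sum>z\<in>{0..<int n}. C (x p + r p) z (z + r u) b) * I x (r(p := b + r v - x p)))"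
proof -
  let ?X = "{0..<int n}"
  have Vi: "V = insert u (insert v V')" "u \<notin> insert v V'" "v \<notin> V'" using uvV uv(1) by (auto simp: V'_def)
  have fs: "finite \<sigma>" using pairings_finite V by auto
  have pp: "p \<noteq> u" "p \<noteq> v" using p_in by (auto simp: V'_def)
  have prv: "cyc_pred V v = u" by (rule cyc_pred_succ[OF V(1) uvV uv(1,3)])
  have "W n V \<sigma> r = (\<Sum>x\<in>PiE (insert u (insert v V')) (\<lambda>_. ?X). \<Prod>B\<in>\<sigma>. edge_cov (cyc_pred V) r x B)"
    unfolding W_def using Vi(1) by simp
  also have "\<dots> = (\<Sum>x\<in>PiE V' (\<lambda>_. ?X). \<Sum>b\<in>?X. \<Sum>z\<in>?X. \<Prod>B\<in>\<sigma>. edge_cov (cyc_pred V) r (x(v := b, u := z)) B)"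
    using Vi(2,3) by (simp add: sum_PiE_insert)
  also have "\<dots> = (\<Sum>x\<in>PiE V' (\<lambda>_. ?X). \<Sum>b\<in>?X. \<Sum>z\<in>?X. C (x p + r p) z (z + r u) b * I x (r(p := b + r v - x p)))"
  proof (intro sum.cong refl)
    fix x :: "nat \<Rightarrow> int" and b z :: int
    let ?y = "x(v := b, u := z)"
    have "(\<Prod>B\<in>\<sigma>. edge_cov (cyc_pred V) r ?y B) = edge_cov (cyc_pred V) r ?y {u,v} * (\<Prod>B\<in>\<sigma>'. edge_cov (cyc_pred V) r ?y B)"
      unfolding \<sigma>'_def by (rule prod.remove[OF fs uv(2)])
    also have "(\<Prod>B\<in>\<sigma>'. edge_cov (cyc_pred V) r ?y B) = I x (r(p := b + r v - x p))"
      unfolding I_def using Vi uv(1) rest_eq[of ?y x _ r] by (intro prod.cong refl) (auto simp: V'_def)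
    also have "edge_cov (cyc_pred V) r ?y {u,v} = C (x p + r p) z (z + r u) b"
      using uv(1) pp by (subst edge_cov_pair) (auto simp: p_def[symmetric] prv)
    finally show "(\<Prod>B\<in>\<sigma>. edge_cov (cyc_pred V) r ?y B) = C (x p + r p) z (z + r u) b * I x (r(p := b + r v - x p))" .
  qed
  finally show ?thesis by (simp add: sum_distrib_right)
qed

text \<open>The new jump \<open>b + r v - x p\<close> after the substitution t = x p + r p - b,
  which makes it independent of the walk x.\<close>

private definition "r' r t = r(p := r p + r v - t)"

text \<open>The contribution of a fixed t with the sum over z replaced by its main term; the case
  distinction discards those t for which b = x p + r p - t leaves the box.\<close>

private definition "H r n t = (\<Sum>x\<in>PiE V' (\<lambda>_. {0..<int n}).
   (if x p + r p - t \<in> {0..<int n} then real (opp_count n (x p + r p) (r u) (x p + r p - t)) else 0) * R t (r u) * I x (r' r t))"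

text \<open>The replacement costs at most S for each choice of the other vertices, and
  \<open>open_walk_bound\<close> counts these with the remaining covariances as weights. The error
  is of order n^m, one below the normalisation.\<close>

private lemma W_minus_H: "n \<ge> 1 \<Longrightarrow> \<bar>W n V \<sigma> r - (\<Sum>\<^sub>\<infinity>t. H r n t)\<bar> \<le> S * (K ^ (m - 1) * real n ^ m)"
proof -
  assume n: "n \<ge> 1"
  let ?X = "{0..<int n}"
  define F where "F x b = real (opp_count n (x p + r p) (r u) b) * R (x p + r p - b) (r u) * I x (r(p := b + r v - x p))" for x b
  \<comment> \<open>A finite window that contains every t arising from x p and b in {0..<n}; outside
    it H vanishes.\<close>
  define T where "T = {- (int n + \<bar>r p\<bar>)..int n + \<bar>r p\<bar>}"
  have F: "F x (x p + r p - t) = real (opp_count n (x p + r p) (r u) (x p + r p - t)) * R t (r u) * I x (r' r t)" for x t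
    by (simp add: F_def r'_def algebra_simps)
  have "(\<Sum>b\<in>?X. F x b) = (\<Sum>t\<in>T. if x p + r p - t \<in> ?X then F x (x p + r p - t) else 0)"
    if x: "x \<in> PiE V' (\<lambda>_. ?X)" for x
  proof -
    have "(\<Sum>b\<in>?X. F x b) = (\<Sum>t\<in>{t\<in>T. x p + r p - t \<in> ?X}. F x (x p + r p - t))"
    proof (rule sum.reindex_bij_witness[of _ "\<lambda>t. x p + r p - t" "\<lambda>b. x p + r p - b"])
      have "x p \<in> ?X" using x p_in by (auto simp: PiE_iff)
      then show "x p + r p - b \<in> {t\<in>T. x p + r p - t \<in> ?X}" if "b \<in> ?X" for b using that by (auto simp: T_def)
    qed auto
    also have "\<dots> = (\<Sum>t\<in>T. if x p + r p - t \<in> ?X then F x (x p + r p - t) else 0)"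
      by (rule sum.inter_filter) (simp add: T_def)
    finally show ?thesis .
  qed
  then have "(\<Sum>x\<in>PiE V' (\<lambda>_. ?X). \<Sum>b\<in>?X. F x b) = (\<Sum>x\<in>PiE V' (\<lambda>_. ?X). \<Sum>t\<in>T. if x p + r p - t \<in> ?X then F x (x p + r p - t) else 0)"
    by (rule sum.cong[OF refl])
  also have "\<dots> = (\<Sum>t\<in>T. H r n t)"
    unfolding H_def by (subst sum.swap) (auto intro!: sum.cong simp: F)
  also have "\<dots> = (\<Sum>\<^sub>\<infinity>t\<in>T. H r n t)" by (simp add: T_def)
  also have "\<dots> = (\<Sum>\<^sub>\<infinity>t. H r n t)"
  proof (rule infsum_cong_neutral)
    fix t assume t: "t \<in> UNIV - T"
    show "H r n t = 0" unfolding H_def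
    proof (intro sum.neutral ballI)
      fix x assume "x \<in> PiE V' (\<lambda>_. ?X)"
      then have "x p \<in> ?X" using p_in by (auto simp: PiE_iff)
      then have "x p + r p - t \<notin> ?X" using t by (auto simp: T_def)
      then show "(if x p + r p - t \<in> ?X then real (opp_count n (x p + r p) (r u) (x p + r p - t)) else 0) * R t (r u) * I x (r' r t) = 0"
        by (simp only: if_False mult_zero_left)
    qed
  qed auto
  finally have HF: "(\<Sum>\<^sub>\<infinity>t. H r n t) = (\<Sum>x\<in>PiE V' (\<lambda>_. ?X). \<Sum>b\<in>?X. F x b)" by simp
  have "\<bar>W n V \<sigma> r - (\<Sum>\<^sub>\<infinity>t. H r n t)\<bar> = \<bar>\<Sum>x\<in>PiE V' (\<lambda>_. ?X). \<Sum>b\<in>?X.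
     ((\<Sum>z\<in>?X. C (x p + r p) z (z + r u) b) - real (opp_count n (x p + r p) (r u) b) * R (x p + r p - b) (r u)) * I x (r(p := b + r v - x p))\<bar>"
    unfolding W_eq HF F_def by (simp add: sum_subtractf left_diff_distrib)
  also have "\<dots> \<le> (\<Sum>x\<in>PiE V' (\<lambda>_. ?X). \<Sum>b\<in>?X. S * \<bar>I x (r(p := b + r v - x p))\<bar>)"
    by (rule order_trans[OF sum_abs], rule sum_mono, rule order_trans[OF sum_abs], rule sum_mono)
      (auto simp: abs_mult intro!: mult_right_mono sum_C_backtrack)
  also have "\<dots> = S * (\<Sum>x\<in>PiE V' (\<lambda>_. ?X). \<Sum>b\<in>?X. \<Prod>B\<in>\<sigma>'. \<bar>edge_cov (cyc_pred V) r (x(v := b)) B\<bar>)"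
  proof -
    have "\<bar>I x (r(p := b + r v - x p))\<bar> = (\<Prod>B\<in>\<sigma>'. \<bar>edge_cov (cyc_pred V) r (x(v := b)) B\<bar>)" for x b
      unfolding I_def abs_prod using rest_eq[of "x(v := b)" x _ r] by (intro prod.cong refl) (auto simp: V'_def)
    then show ?thesis by (simp add: sum_distrib_left)
  qed
  also have "(\<Sum>x\<in>PiE V' (\<lambda>_. ?X). \<Sum>b\<in>?X. \<Prod>B\<in>\<sigma>'. \<bar>edge_cov (cyc_pred V) r (x(v := b)) B\<bar>) =
     (\<Sum>x\<in>PiE (insert v V') (\<lambda>_. ?X). \<Prod>B\<in>\<sigma>'. \<bar>edge_cov (cyc_pred V) r x B\<bar>)"
    by (subst sum_PiE_insert) (auto simp: V'_def)
  also have "\<dots> \<le> K ^ (m - 1) * real n ^ m"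
    using open_walk_bound[OF V _ _ uv, of ?X r] n unfolding V'_def \<sigma>'_def by simp
  finally show ?thesis using S_nonneg by (simp add: mult_left_mono)
qed

private lemma sum_I_le: "n \<ge> 1 \<Longrightarrow> (\<Sum>x\<in>PiE V' (\<lambda>_. {0..<int n}). \<bar>I x \<rho>\<bar>) \<le> K ^ (m - 1) * real n ^ m"
  using walk_bound_total[OF fV' cV' _ s'p, of "{0..<int n}" \<rho>] m2 by (simp add: I_def abs_prod)

private lemma sum_I_restricted_le:
  assumes n: "n \<ge> 1"
  shows "(\<Sum>x\<in>PiE V' (\<lambda>_. {0..<int n}). (if P (x p) then 1 else 0) * \<bar>I x \<rho>\<bar>)
     \<le> K ^ (m - 1) * real n ^ (m - 1) * real (card {a\<in>{0..<int n}. P a})"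
proof -
  let ?g = "\<lambda>x. if P (x p) then 1 else 0 :: real"
  have "(\<Sum>x\<in>PiE V' (\<lambda>_. {0..<int n}). ?g x * (\<Prod>B\<in>\<sigma>'. \<bar>edge_cov (cyc_pred V') \<rho> x B\<bar>))
     \<le> K ^ (m - 1) * real (card {0..<int n}) ^ (m - 1) * (\<Sum>x\<in>PiE {p} (\<lambda>_. {0..<int n}). ?g x)"
    using n by (intro walk_bound[OF fV' cV' s'p p_in]) auto
  also have "(\<Sum>x\<in>PiE {p} (\<lambda>_. {0..<int n}). ?g x) = (\<Sum>a\<in>{0..<int n}. if P a then 1 else 0)"
    by (rule sum_PiE_singleton)
  also have "\<dots> = real (card {a\<in>{0..<int n}. P a})"
    by (simp flip: sum.inter_filter)
  finally show ?thesis by (simp add: I_def abs_prod)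
qed

private lemma H_bound: "n \<ge> 1 \<Longrightarrow> \<bar>H r n t\<bar> \<le> \<bar>R t (r u)\<bar> * K ^ (m - 1) * real n ^ (m + 1)"
proof -
  assume n: "n \<ge> 1"
  have "\<bar>H r n t\<bar> \<le> (\<Sum>x\<in>PiE V' (\<lambda>_. {0..<int n}). real n * \<bar>R t (r u)\<bar> * \<bar>I x (r' r t)\<bar>)"
    unfolding H_def
    by (rule order_trans[OF sum_abs], rule sum_mono)
      (auto simp: abs_mult intro!: mult_right_mono opp_count_bounds)
  also have "\<dots> = real n * \<bar>R t (r u)\<bar> * (\<Sum>x\<in>PiE V' (\<lambda>_. {0..<int n}). \<bar>I x (r' r t)\<bar>)"
    by (simp add: sum_distrib_left)
  also have "\<dots> \<le> real n * \<bar>R t (r u)\<bar> * (K ^ (m - 1) * real n ^ m)"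
    using n by (intro mult_left_mono sum_I_le) auto
  finally show ?thesis by (simp add: mult_ac)
qed

text \<open>Two boundary effects: b leaves the box for at most |r p - t| positions of p, and
  \<open>opp_count\<close> falls short of n by at most |t + r u|. Both grow with t but are of lower
  order for each fixed t; uniformity in t is left to \<open>H_bound\<close>.\<close>

private lemma H_approx:
  assumes n: "n \<ge> 1"
  shows "\<bar>H r n t - R t (r u) * real n * W n V' \<sigma>' (r' r t)\<bar>
    \<le> \<bar>R t (r u)\<bar> * K ^ (m - 1) * (\<bar>real_of_int (r p - t)\<bar> + \<bar>real_of_int (t + r u)\<bar>) * real n ^ m"
proof -
  let ?X = "{0..<int n}"
  let ?N = "\<lambda>x. if x p + r p - t \<in> ?X then real (opp_count n (x p + r p) (r u) (x p + r p - t)) else 0"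
  let ?g = "\<lambda>x. if x p + (r p - t) \<notin> ?X then 1 else 0 :: real"
  define c where "c = \<bar>real_of_int (t + r u)\<bar>"
  have Nb: "\<bar>?N x - real n\<bar> \<le> real n * ?g x + c" for x
    using opp_count_bounds[of n "x p + r p" "r u" "x p + r p - t"] by (auto simp: c_def algebra_simps)
  have "\<bar>H r n t - R t (r u) * real n * W n V' \<sigma>' (r' r t)\<bar> = \<bar>\<Sum>x\<in>PiE V' (\<lambda>_. ?X). (?N x - real n) * R t (r u) * I x (r' r t)\<bar>"
    unfolding H_def W_def I_def by (simp add: sum_distrib_left sum_subtractf[symmetric] algebra_simps)
  also have "\<dots> \<le> (\<Sum>x\<in>PiE V' (\<lambda>_. ?X). (real n * ?g x + c) * \<bar>R t (r u)\<bar> * \<bar>I x (r' r t)\<bar>)"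
  proof (rule order_trans[OF sum_abs], rule sum_mono)
    fix x
    show "\<bar>(?N x - real n) * R t (r u) * I x (r' r t)\<bar> \<le> (real n * ?g x + c) * \<bar>R t (r u)\<bar> * \<bar>I x (r' r t)\<bar>"
      unfolding abs_mult by (intro mult_right_mono Nb) auto
  qed
  also have "\<dots> = \<bar>R t (r u)\<bar> * (real n * (\<Sum>x\<in>PiE V' (\<lambda>_. ?X). ?g x * \<bar>I x (r' r t)\<bar>) + c * (\<Sum>x\<in>PiE V' (\<lambda>_. ?X). \<bar>I x (r' r t)\<bar>))"
    by (simp only: sum_distrib_left sum.distrib[symmetric] distrib_left distrib_right mult_ac)
  also have "\<dots> \<le> \<bar>R t (r u)\<bar> * (real n * (K ^ (m - 1) * real n ^ (m - 1) * \<bar>real_of_int (r p - t)\<bar>) + c * (K ^ (m - 1) * real n ^ m))"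
  proof (intro mult_left_mono add_mono sum_I_le[OF n])
    have "real (card {a\<in>?X. a + (r p - t) \<notin> ?X}) \<le> \<bar>real_of_int (r p - t)\<bar>"
      using card_shift_out[of n "r p - t"] by linarith
    then have "K ^ (m - 1) * real n ^ (m - 1) * real (card {a\<in>?X. a + (r p - t) \<notin> ?X}) \<le> K ^ (m - 1) * real n ^ (m - 1) * \<bar>real_of_int (r p - t)\<bar>"
      using K_pos by (intro mult_left_mono) auto
    then show "(\<Sum>x\<in>PiE V' (\<lambda>_. ?X). ?g x * \<bar>I x (r' r t)\<bar>) \<le> K ^ (m - 1) * real n ^ (m - 1) * \<bar>real_of_int (r p - t)\<bar>"
      by (rule order_trans[OF sum_I_restricted_le[OF n, of "\<lambda>a. a + (r p - t) \<notin> ?X"]])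
  qed (auto simp: c_def)
  also have "real n * (K ^ (m - 1) * real n ^ (m - 1) * \<bar>real_of_int (r p - t)\<bar>) = K ^ (m - 1) * real n ^ m * \<bar>real_of_int (r p - t)\<bar>"
    using m2 by (cases m) auto
  finally show ?thesis by (simp add: c_def algebra_simps)
qed

private lemma W_step_tendsto':
  assumes IH: "\<And>\<rho>. (\<lambda>n. W n V' \<sigma>' \<rho> / real n ^ (m - 1 + 1)) \<longlonglongrightarrow> L \<rho>"
  shows "(\<lambda>n. W n V \<sigma> r / real n ^ (m + 1)) \<longlonglongrightarrow> (\<Sum>\<^sub>\<infinity>t. R t (r u) * L (r' r t))"
proof -
  have m1: "m - 1 + 1 = m" using m2 by simp
  define h where "h n t = H r n t / real n ^ (m + 1)" for n t
  have "(\<lambda>n. \<Sum>\<^sub>\<infinity>t. h n t) \<longlonglongrightarrow> (\<Sum>\<^sub>\<infinity>t. R t (r u) * L (r' r t))"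
  proof (rule infsum_dominated_convergence)
    \<comment> \<open>The dominating function: \<open>H_bound\<close> divided by the normalisation,
      summable because one row of R is.\<close>
    show "(\<lambda>t. \<bar>R t (r u)\<bar> * K ^ (m - 1)) summable_on UNIV"
      by (intro summable_on_cmult_left R_row_summable)
    show "\<bar>h n t\<bar> \<le> \<bar>R t (r u)\<bar> * K ^ (m - 1)" for n t
    proof (cases "n \<ge> 1")
      case True
      then show ?thesis using H_bound[OF True, of r t] by (simp add: h_def divide_le_eq mult_ac del: power_Suc)
    next
      \<comment> \<open>For n = 0 the denominator is 0, and the quotient takes the default value
        0.\<close>
      case False
      then have "n = 0" by simp
      then show ?thesis using K_pos by (simp add: h_def)
    qed
    fix t
    have "(\<lambda>n. R t (r u) * (W n V' \<sigma>' (r' r t) / real n ^ m)) \<longlonglongrightarrow> R t (r u) * L (r' r t)"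
      using IH[of "r' r t"] unfolding m1 by (intro tendsto_mult tendsto_const)
    moreover have "(\<lambda>n. h n t - R t (r u) * (W n V' \<sigma>' (r' r t) / real n ^ m)) \<longlonglongrightarrow> 0"
    proof (rule tendsto_over_n[where k = "\<bar>R t (r u)\<bar> * K ^ (m - 1) * (\<bar>real_of_int (r p - t)\<bar> + \<bar>real_of_int (t + r u)\<bar>)"])
      fix n :: nat assume n: "n \<ge> 1"
      have "h n t - R t (r u) * (W n V' \<sigma>' (r' r t) / real n ^ m) = (H r n t - R t (r u) * real n * W n V' \<sigma>' (r' r t)) / real n ^ (m + 1)"
        using n by (simp add: h_def field_simps)
      then have "\<bar>h n t - R t (r u) * (W n V' \<sigma>' (r' r t) / real n ^ m) - 0\<bar> = \<bar>H r n t - R t (r u) * real n * W n V' \<sigma>' (r' r t)\<bar> / real n ^ (m + 1)"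
        by (simp add: abs_divide)
      also have "\<dots> \<le> (\<bar>R t (r u)\<bar> * K ^ (m - 1) * (\<bar>real_of_int (r p - t)\<bar> + \<bar>real_of_int (t + r u)\<bar>) * real n ^ m) / real n ^ (m + 1)"
        by (intro divide_right_mono H_approx[OF n]) auto
      also have "\<dots> = (\<bar>R t (r u)\<bar> * K ^ (m - 1) * (\<bar>real_of_int (r p - t)\<bar> + \<bar>real_of_int (t + r u)\<bar>)) / real n"
        using n by simp
      finally show "\<bar>h n t - R t (r u) * (W n V' \<sigma>' (r' r t) / real n ^ m) - 0\<bar> \<le> \<dots>" .
    qed
    ultimately have "(\<lambda>n. (h n t - R t (r u) * (W n V' \<sigma>' (r' r t) / real n ^ m)) + R t (r u) * (W n V' \<sigma>' (r' r t) / real n ^ m)) \<longlonglongrightarrow> 0 + R t (r u) * L (r' r t)"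
      by (intro tendsto_add)
    then show "(\<lambda>n. h n t) \<longlonglongrightarrow> R t (r u) * L (r' r t)" by simp
  qed
  moreover have "(\<lambda>n. W n V \<sigma> r / real n ^ (m + 1) - (\<Sum>\<^sub>\<infinity>t. h n t)) \<longlonglongrightarrow> 0"
  proof (rule tendsto_over_n[where k = "S * K ^ (m - 1)"])
    fix n :: nat assume n: "n \<ge> 1"
    have "(\<Sum>\<^sub>\<infinity>t. h n t) = (\<Sum>\<^sub>\<infinity>t. H r n t) / real n ^ (m + 1)"
      unfolding h_def divide_inverse by (rule infsum_cmult_left') 
    then have "\<bar>W n V \<sigma> r / real n ^ (m + 1) - (\<Sum>\<^sub>\<infinity>t. h n t) - 0\<bar> = \<bar>W n V \<sigma> r - (\<Sum>\<^sub>\<infinity>t. H r n t)\<bar> / real n ^ (m + 1)"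
      by (simp add: diff_divide_distrib[symmetric] abs_divide)
    also have "\<dots> \<le> S * (K ^ (m - 1) * real n ^ m) / real n ^ (m + 1)"
      by (intro divide_right_mono W_minus_H[OF n]) auto
    also have "\<dots> = S * K ^ (m - 1) / real n" using n by simp
    finally show "\<bar>W n V \<sigma> r / real n ^ (m + 1) - (\<Sum>\<^sub>\<infinity>t. h n t) - 0\<bar> \<le> S * K ^ (m - 1) / real n" .
  qed
  ultimately have "(\<lambda>n. (W n V \<sigma> r / real n ^ (m + 1) - (\<Sum>\<^sub>\<infinity>t. h n t)) + (\<Sum>\<^sub>\<infinity>t. h n t)) \<longlonglongrightarrow> 0 + (\<Sum>\<^sub>\<infinity>t. R t (r u) * L (r' r t))"
    by (intro tendsto_add)
  then show ?thesis by simp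
qed

lemmas W_step_tendsto = W_step_tendsto'[unfolded r'_def p_def V'_def \<sigma>'_def]

end
end

section \<open>Kreweras complements\<close>

lemma noncrossingD:
  assumes "noncrossing P" "B \<in> P" "C \<in> P" "B \<noteq> C" "a \<in> B" "b \<in> C" "c \<in> B" "d \<in> C" "a < b" "b < c" "c < d"
  shows False
proof -
  have "\<exists>B\<in>P. \<exists>C\<in>P. B \<noteq> C \<and> (\<exists>a\<in>B. \<exists>b\<in>C. \<exists>c\<in>B. \<exists>d\<in>C. a < b \<and> b < c \<and> c < d)"
    by (intro bexI[of _ B] bexI[of _ C] bexI[of _ a] bexI[of _ b] bexI[of _ c] bexI[of _ d] conjI) (use assms in simp_all)
  then show False using assms(1) unfolding noncrossing_def by (rule notE[rotated])
qed

lemma noncrossingI: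
  assumes "\<And>B C a b c d. B \<in> P \<Longrightarrow> C \<in> P \<Longrightarrow> B \<noteq> C \<Longrightarrow> a \<in> B \<Longrightarrow> b \<in> C \<Longrightarrow> c \<in> B \<Longrightarrow> d \<in> C \<Longrightarrow>
    a < b \<Longrightarrow> b < c \<Longrightarrow> c < d \<Longrightarrow> False"
  shows "noncrossing P"
  unfolding noncrossing_def by (rule notI, elim bexE conjE, rule assms)

lemma noncrossing_subset:
  assumes "noncrossing P" "Q \<subseteq> P" shows "noncrossing Q"
proof (rule noncrossingI)
  fix B C a b c d
  assume x: "B \<in> Q" "C \<in> Q" "B \<noteq> C" "a \<in> B" "b \<in> C" "c \<in> B" "d \<in> C" "a < b" "b < c" "c < d"
  show False by (rule noncrossingD[OF assms(1) subsetD[OF assms(2) x(1)] subsetD[OF assms(2) x(2)] x(3-)])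
qed

text \<open>With no element between its ends, the block {u, v} cannot take part in a
  crossing.\<close>

lemma noncrossing_remove_adjacent:
  assumes s: "\<sigma> \<in> pairings V" and uv: "u < v" "{u,v} \<in> \<sigma>" "\<And>z. z \<in> V \<Longrightarrow> \<not> (u < z \<and> z < v)"
  shows "noncrossing \<sigma> \<longleftrightarrow> noncrossing (\<sigma> - {{u,v}})"
proof -
  have no: "\<not> (u < b \<and> b < v)" if "C \<in> \<sigma>" "b \<in> C" for C b
    using uv(3)[of b] pairings_subset[OF s that(1)] that by auto
  show ?thesis
  proof
    assume "noncrossing \<sigma>"
    then show "noncrossing (\<sigma> - {{u,v}})"
      by (rule noncrossing_subset) auto
  next
    assume nc: "noncrossing (\<sigma> - {{u,v}})"
    show "noncrossing \<sigma>"
    proof (rule noncrossingI)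
      fix B C a b c d
      assume BC: "B \<in> \<sigma>" "C \<in> \<sigma>" "B \<noteq> C" and x: "a \<in> B" "b \<in> C" "c \<in> B" "d \<in> C" "a < b" "b < c" "c < d"
      have "B \<noteq> {u,v}" using no[OF BC(2) x(2)] x uv(1) by auto
      moreover have "C \<noteq> {u,v}" using no[OF BC(1) x(3)] x uv(1) by auto
      ultimately have "B \<in> \<sigma> - {{u,v}}" "C \<in> \<sigma> - {{u,v}}" using BC by auto
      then show False by (rule noncrossingD[OF nc _ _ BC(3) x])
    qed
  qed
qed

text \<open>The block of z is not nested inside {u, v} by the choice of u and v, so its other end
  lies outside and the two blocks cross.\<close>

lemma innermost_not_adjacent_crossing:
  assumes s: "\<sigma> \<in> pairings V" and uv: "u < v" "{u,v} \<in> \<sigma>" "\<And>B. B \<in> \<sigma> \<Longrightarrow> \<not> (u < Min B \<and> Max B < v)"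
    and z: "z \<in> V" "u < z" "z < v"
  shows "\<not> noncrossing \<sigma>"
proof
  assume nc: "noncrossing \<sigma>"
  obtain B where B: "B \<in> \<sigma>" "z \<in> B" using pairings_cover[OF s z(1)] by blast
  obtain a b where ab: "a < b" "B = {a,b}" "Min B = a" "Max B = b" using pairings_block[OF s B(1)] by metis
  have ne: "B \<noteq> {u,v}" using B z by auto
  then have d: "a \<noteq> u" "a \<noteq> v" "b \<noteq> u" "b \<noteq> v"
    using pairings_disjoint[OF s B(1) uv(2)] ab by auto
  have "\<not> (u < a \<and> b < v)" using uv(3)[OF B(1)] ab by simp
  then have "z = a \<and> v < b \<or> z = b \<and> a < u" using B ab d z by auto
  then show False
  proof
    assume "z = a \<and> v < b"
    then show False using noncrossingD[OF nc uv(2) B(1) ne[symmetric], of u z v b] z ab by auto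
  next
    assume "z = b \<and> a < u"
    then show False using noncrossingD[OF nc B(1) uv(2) ne, of a u z v] z ab by auto
  qed
qed

text \<open>Two elements are equivalent if no block of \<open>\<sigma>\<close> separates their barred copies; the
  class of \<open>i\<close> is a block of the Kreweras complement.\<close>
definition kreweras_class :: "nat set \<Rightarrow> nat set set \<Rightarrow> nat \<Rightarrow> nat set" where
  "kreweras_class V \<sigma> i = {j\<in>V. \<forall>B\<in>\<sigma>. (Min B \<le> i \<and> i < Max B) = (Min B \<le> j \<and> j < Max B)}"

text \<open>For r = 0 this is S(\<sigma>). A general r is what remains to be matched after
  neighbouring pairs have been removed, and it corresponds to the jumps of a walk.\<close>

definition class_sum_labels :: "nat set \<Rightarrow> nat set set \<Rightarrow> (nat \<Rightarrow> int) \<Rightarrow> (nat \<Rightarrow> int) set" where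
  "class_sum_labels V \<sigma> r = {k \<in> V \<rightarrow>\<^sub>E UNIV. \<forall>i\<in>V. sum k (kreweras_class V \<sigma> i) = sum r (kreweras_class V \<sigma> i)}"

lemma kreweras_class_sub: "kreweras_class V \<sigma> i \<subseteq> V" by (auto simp: kreweras_class_def)
lemma kreweras_class_refl: "i \<in> V \<Longrightarrow> i \<in> kreweras_class V \<sigma> i" by (auto simp: kreweras_class_def)
lemma kreweras_class_eq: "j \<in> kreweras_class V \<sigma> i \<Longrightarrow> kreweras_class V \<sigma> j = kreweras_class V \<sigma> i" by (auto simp: kreweras_class_def)

section \<open>Kreweras classes under removal of neighbours\<close>

context
  fixes V \<sigma> and u v :: nat
  assumes V: "finite V" "\<sigma> \<in> pairings V"
    and uv: "u < v" "{u,v} \<in> \<sigma>" "\<And>z. z \<in> V \<Longrightarrow> \<not> (u < z \<and> z < v)"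
begin

private definition "V' = V - {u,v}"
private definition "\<sigma>' = \<sigma> - {{u,v}}"

private lemma uvV: "u \<in> V" "v \<in> V" using pairings_subset[OF V(2) uv(2)] by auto
private lemma s'p: "\<sigma>' \<in> pairings V'" unfolding \<sigma>'_def V'_def by (rule pairings_remove[OF V(2) uv(2)])
private lemma s_ins: "\<sigma> = insert {u,v} \<sigma>'" using uv by (auto simp: \<sigma>'_def)
private lemma mm: "Min {u,v} = u" "Max {u,v} = v" using uv(1) by auto

private lemma kreweras_class_iff: "j \<in> kreweras_class V \<sigma> i \<longleftrightarrow> j \<in> V \<and> (u \<le> i \<and> i < v) = (u \<le> j \<and> j < v) \<and>
    (\<forall>B\<in>\<sigma>'. (Min B \<le> i \<and> i < Max B) = (Min B \<le> j \<and> j < Max B))"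
proof -
  have all: "(\<forall>B\<in>\<sigma>. P B) \<longleftrightarrow> P {u,v} \<and> (\<forall>B\<in>\<sigma>'. P B)" for P by (subst s_ins) simp
  show ?thesis unfolding kreweras_class_def all mm by simp
qed

private lemma kreweras_class_remove_iff: "j \<in> kreweras_class V' \<sigma>' i \<longleftrightarrow> j \<in> V' \<and>
    (\<forall>B\<in>\<sigma>'. (Min B \<le> i \<and> i < Max B) = (Min B \<le> j \<and> j < Max B))"
  by (simp add: kreweras_class_def)

private lemma sep: "j \<in> V \<Longrightarrow> (u \<le> j \<and> j < v) = (j = u)"
  using uv by (metis le_neq_implies_less order_refl)

private lemma kreweras_class_u: "kreweras_class V \<sigma> u = {u}"
proof -
  have "x = u" if "x \<in> kreweras_class V \<sigma> u" for x using that sep[of x] uv(1) unfolding kreweras_class_iff by simp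
  then show ?thesis using kreweras_class_refl[OF uvV(1)] by auto
qed

private lemma out: "i \<in> V' \<Longrightarrow> (u \<le> i \<and> i < v) = False"
  using sep[of i] by (auto simp: V'_def)

private lemma kreweras_class_same: "i \<in> V' \<Longrightarrow> j \<in> V' \<Longrightarrow> j \<in> kreweras_class V \<sigma> i \<longleftrightarrow> j \<in> kreweras_class V' \<sigma>' i"
  unfolding kreweras_class_iff kreweras_class_remove_iff by (simp only: out) (auto simp: V'_def)

private lemma u_notin: "i \<in> V \<Longrightarrow> i \<noteq> u \<Longrightarrow> u \<notin> kreweras_class V \<sigma> i"
proof
  assume i: "i \<in> V" "i \<noteq> u" and "u \<in> kreweras_class V \<sigma> i"
  then have "(u \<le> i \<and> i < v) = (u \<le> u \<and> u < v)" unfolding kreweras_class_iff by blast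
  then show False using sep[OF i(1)] uv(1) i(2) by simp
qed

private lemma class_sum_labels_single: "V' = {} \<Longrightarrow> class_sum_labels V \<sigma> r = {\<lambda>l. if l = u then r u else if l = v then r v else undefined}"
proof -
  assume e: "V' = {}"
  have Ve: "V = {u,v}" using e uvV by (auto simp: V'_def)
  have "kreweras_class V \<sigma> v = {v}" using kreweras_class_refl[OF uvV(2), of \<sigma>] u_notin[OF uvV(2)] uv(1) kreweras_class_sub[of V \<sigma> v] Ve by auto
  then have "class_sum_labels V \<sigma> r = {k \<in> V \<rightarrow>\<^sub>E UNIV. k u = r u \<and> k v = r v}"
    unfolding class_sum_labels_def using kreweras_class_u Ve by auto
  also have "\<dots> = {\<lambda>l. if l = u then r u else if l = v then r v else undefined}"
    using Ve by (auto simp: PiE_iff extensional_def fun_eq_iff)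
  finally show ?thesis .
qed

context
  assumes ne: "V - {u,v} \<noteq> {}"
begin

private definition "p = cyc_pred V u"
private lemma p_in: "p \<in> V'" unfolding p_def V'_def by (rule cyc_pred_u_in[OF V(1) uvV uv(1,3) ne])

text \<open>In the cyclic order only u lies between p and v, so no other block separates them. If u
  is the minimum, p wraps around to Max V, and both v and p lie outside the interval of every
  remaining block.\<close>

private lemma v_p:
  assumes "B \<in> \<sigma>'" shows "(Min B \<le> v \<and> v < Max B) = (Min B \<le> p \<and> p < Max B)"
proof -
  obtain a b where ab: "a < b" "a \<in> V'" "b \<in> V'" "Min B = a" "Max B = b" using pairings_block[OF s'p assms] by metis
  have x: "x \<in> V" "x \<noteq> u" "x \<noteq> v" "x < u \<or> v < x" if "x \<in> V'" for x
    using that uv(3)[of x] by (auto simp: V'_def)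
  have pV: "p \<in> V" using p_in by (auto simp: V'_def)
  have mx: "x \<le> Max V" if "x \<in> V'" for x using V x(1)[OF that] by auto
  show ?thesis
  proof (cases "\<forall>j\<in>V. u \<le> j")
    case True
    then have "p = Max V" using cyc_pred_disj[OF V(1) uvV(1)] uvV unfolding p_def by (metis leD)
    moreover have "v < a" using x[OF ab(2)] True by (metis leD)
    ultimately show ?thesis using ab mx[OF ab(3)] by auto
  next
    case False
    then have p: "p < u" "\<And>j. j \<in> V \<Longrightarrow> j < u \<Longrightarrow> j \<le> p" using cyc_pred_disj[OF V(1) uvV(1)] unfolding p_def by auto
    have pa: "a < u \<Longrightarrow> a \<le> p" "b < u \<Longrightarrow> b \<le> p" using p(2) x(1)[OF ab(2)] x(1)[OF ab(3)] by blast+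
    show ?thesis unfolding ab(4,5) using pa p(1) x(4)[OF ab(2)] x(4)[OF ab(3)] uv(1) ab(1) by auto
  qed
qed

private lemma v_in_cls: "i \<in> V' \<Longrightarrow> v \<in> kreweras_class V \<sigma> i \<longleftrightarrow> p \<in> kreweras_class V' \<sigma>' i"
proof -
  assume i: "i \<in> V'"
  have "(u \<le> v \<and> v < v) = False" by simp
  then show ?thesis unfolding kreweras_class_iff kreweras_class_remove_iff out[OF i] using uvV v_p p_in by simp
qed

private lemma kreweras_class_V: "i \<in> V' \<Longrightarrow> kreweras_class V \<sigma> i = kreweras_class V' \<sigma>' i \<union> (if p \<in> kreweras_class V' \<sigma>' i then {v} else {})"
  using kreweras_class_same[of i] v_in_cls[of i] u_notin[of i] kreweras_class_sub[of V \<sigma> i] kreweras_class_sub[of V' \<sigma>' i] by (auto simp: V'_def)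

private lemma kreweras_class_v: "kreweras_class V \<sigma> v = kreweras_class V \<sigma> p"
  using v_in_cls[OF p_in] kreweras_class_refl[OF p_in] by (intro kreweras_class_eq) auto

private lemma sum_cls:
  fixes k :: "nat \<Rightarrow> int"
  assumes "i \<in> V'"
  shows "sum k (kreweras_class V \<sigma> i) = sum k (kreweras_class V' \<sigma>' i) + (if p \<in> kreweras_class V' \<sigma>' i then k v else 0)"
proof -
  have "finite (kreweras_class V' \<sigma>' i)" "v \<notin> kreweras_class V' \<sigma>' i" using V kreweras_class_sub[of V' \<sigma>' i] by (auto simp: V'_def intro: finite_subset)
  then show ?thesis using kreweras_class_V[OF assms] by simp
qed

private lemma sum_cls_upd:
  fixes r :: "nat \<Rightarrow> int"
  shows "sum (r(p := r p + d)) (kreweras_class V' \<sigma>' i) = sum r (kreweras_class V' \<sigma>' i) + (if p \<in> kreweras_class V' \<sigma>' i then d else 0)"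
proof -
  have f: "finite (kreweras_class V' \<sigma>' i)" using V kreweras_class_sub[of V' \<sigma>' i] by (auto simp: V'_def intro: finite_subset)
  have "sum (r(p := r p + d)) (kreweras_class V' \<sigma>' i) = (\<Sum>j\<in>kreweras_class V' \<sigma>' i. r j + (if p = j then d else 0))"
    by (intro sum.cong) auto
  then show ?thesis using f by (simp add: sum.distrib)
qed

text \<open>The class of u is {u}, which forces k u = r u. The class of p additionally contains v;
  moving k v to the other side changes the required sum by r v - k v, recorded at p. With t = k v
  this is the update of r made for walks in \<open>W_eq\<close>.\<close>

private lemma class_sum_labels_iff:
  "k \<in> class_sum_labels V \<sigma> r \<longleftrightarrow> k \<in> V \<rightarrow>\<^sub>E UNIV \<and> k u = r u \<and> (\<forall>i\<in>V'. sum k (kreweras_class V' \<sigma>' i) = sum (r(p := r p + (r v - k v))) (kreweras_class V' \<sigma>' i))"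
proof -
  have "(\<forall>i\<in>V. sum k (kreweras_class V \<sigma> i) = sum r (kreweras_class V \<sigma> i)) \<longleftrightarrow>
    sum k (kreweras_class V \<sigma> u) = sum r (kreweras_class V \<sigma> u) \<and> sum k (kreweras_class V \<sigma> v) = sum r (kreweras_class V \<sigma> v) \<and> (\<forall>i\<in>V'. sum k (kreweras_class V \<sigma> i) = sum r (kreweras_class V \<sigma> i))"
    using uvV by (auto simp: V'_def)
  also have "\<dots> \<longleftrightarrow> k u = r u \<and> (\<forall>i\<in>V'. sum k (kreweras_class V \<sigma> i) = sum r (kreweras_class V \<sigma> i))"
    using p_in by (auto simp: kreweras_class_u kreweras_class_v)
  also have "\<dots> \<longleftrightarrow> k u = r u \<and> (\<forall>i\<in>V'. sum k (kreweras_class V' \<sigma>' i) = sum (r(p := r p + (r v - k v))) (kreweras_class V' \<sigma>' i))"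
    unfolding sum_cls_upd by (auto simp: sum_cls)
  finally show ?thesis unfolding class_sum_labels_def by auto
qed

private definition "r' r t = r(p := r p + r v - t)"

private lemma class_sum_labels_bij:
  fixes r :: "nat \<Rightarrow> int"
  defines "i \<equiv> \<lambda>(t, k). (k(v := t, u := r u)) :: nat \<Rightarrow> int" and "j \<equiv> \<lambda>k. (k v, restrict k V')"
  shows "\<And>k. k \<in> class_sum_labels V \<sigma> r \<Longrightarrow> i (j k) = k" "\<And>k. k \<in> class_sum_labels V \<sigma> r \<Longrightarrow> j k \<in> (SIGMA t:UNIV. class_sum_labels V' \<sigma>' (r' r t))"
    "\<And>q. q \<in> (SIGMA t:UNIV. class_sum_labels V' \<sigma>' (r' r t)) \<Longrightarrow> j (i q) = q"
    "\<And>q. q \<in> (SIGMA t:UNIV. class_sum_labels V' \<sigma>' (r' r t)) \<Longrightarrow> i q \<in> class_sum_labels V \<sigma> r"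
proof -
  have nv: "u \<notin> V'" "v \<notin> V'" "u \<noteq> v" using uv(1) by (auto simp: V'_def)
  have sr: "sum (restrict k V') (kreweras_class V' \<sigma>' l) = sum k (kreweras_class V' \<sigma>' l)" for k :: "nat \<Rightarrow> int" and l
    using kreweras_class_sub[of V' \<sigma>' l] by (intro sum.cong) auto
  have su: "sum (k(v := t, u := s)) (kreweras_class V' \<sigma>' l) = sum k (kreweras_class V' \<sigma>' l)" for k :: "nat \<Rightarrow> int" and l s t
    using kreweras_class_sub[of V' \<sigma>' l] nv by (intro sum.cong) auto
  have e: "r p + (r v - t) = r p + r v - t" for t by simp
  show "i (j k) = k" if "k \<in> class_sum_labels V \<sigma> r" for k
  proof -
    have k: "k \<in> V \<rightarrow>\<^sub>E UNIV" "k u = r u" using that by (auto simp: class_sum_labels_iff)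
    show ?thesis using k uv(1) unfolding i_def j_def
      by (auto simp: fun_eq_iff restrict_def V'_def PiE_iff extensional_def)
  qed
  show "j k \<in> (SIGMA t:UNIV. class_sum_labels V' \<sigma>' (r' r t))" if "k \<in> class_sum_labels V \<sigma> r" for k
    using that unfolding class_sum_labels_iff j_def by (simp add: class_sum_labels_def sr r'_def e del: restrict_apply)
  show "j (i q) = q" if "q \<in> (SIGMA t:UNIV. class_sum_labels V' \<sigma>' (r' r t))" for q
    using that nv unfolding i_def j_def
    by (auto simp: class_sum_labels_def restrict_def fun_eq_iff PiE_iff extensional_def)
  show "i q \<in> class_sum_labels V \<sigma> r" if q0: "q \<in> (SIGMA t:UNIV. class_sum_labels V' \<sigma>' (r' r t))" for q
  proof -
    obtain t k where q: "q = (t,k)" "k \<in> class_sum_labels V' \<sigma>' (r' r t)" using q0 by auto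
    have "k(v := t, u := r u) \<in> V \<rightarrow>\<^sub>E UNIV"
      using q(2) uvV by (auto simp: class_sum_labels_def PiE_iff extensional_def V'_def)
    then show ?thesis using q(2) nv unfolding class_sum_labels_iff i_def q(1) prod.case su
      by (auto simp: class_sum_labels_def r'_def e)
  qed
qed

private lemma prod_ins:
  fixes h :: "int \<Rightarrow> int \<Rightarrow> real"
  shows "(\<Prod>B\<in>\<sigma>. h (k (Min B)) (k (Max B))) = h (k u) (k v) * (\<Prod>B\<in>\<sigma>'. h (k (Min B)) (k (Max B)))"
proof -
  have "finite \<sigma>" using pairings_finite V by auto
  then have "(\<Prod>B\<in>\<sigma>. h (k (Min B)) (k (Max B))) = h (k (Min {u,v})) (k (Max {u,v})) * (\<Prod>B\<in>\<sigma>'. h (k (Min B)) (k (Max B)))"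
    unfolding \<sigma>'_def using uv(2) by (rule prod.remove)
  then show ?thesis by (simp only: mm)
qed

private lemma prod_restrict:
  fixes h :: "int \<Rightarrow> int \<Rightarrow> real"
  shows "(\<Prod>B\<in>\<sigma>'. h (restrict k V' (Min B)) (restrict k V' (Max B))) = (\<Prod>B\<in>\<sigma>'. h (k (Min B)) (k (Max B)))"
proof (intro prod.cong refl)
  fix B assume "B \<in> \<sigma>'"
  then obtain a b where "a \<in> V'" "b \<in> V'" "Min B = a" "Max B = b" using pairings_block[OF s'p] by metis
  then show "h (restrict k V' (Min B)) (restrict k V' (Max B)) = h (k (Min B)) (k (Max B))" by simp
qed

private lemma class_sum_labels_summable_iff':
  fixes h :: "int \<Rightarrow> int \<Rightarrow> real"
  shows "(\<lambda>k. \<Prod>B\<in>\<sigma>. h (k (Min B)) (k (Max B))) summable_on class_sum_labels V \<sigma> r \<longleftrightarrow>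
    (\<lambda>(t, k). h (r u) t * (\<Prod>B\<in>\<sigma>'. h (k (Min B)) (k (Max B)))) summable_on (SIGMA t:UNIV. class_sum_labels V' \<sigma>' (r' r t))"
  by (rule summable_on_reindex_bij_witness[OF class_sum_labels_bij]) (auto simp: prod_ins prod_restrict class_sum_labels_iff simp del: restrict_apply)

private lemma class_sum_labels_infsum':
  fixes h :: "int \<Rightarrow> int \<Rightarrow> real"
  shows "(\<Sum>\<^sub>\<infinity>k\<in>class_sum_labels V \<sigma> r. \<Prod>B\<in>\<sigma>. h (k (Min B)) (k (Max B))) =
    (\<Sum>\<^sub>\<infinity>(t, k)\<in>(SIGMA t:UNIV. class_sum_labels V' \<sigma>' (r' r t)). h (r u) t * (\<Prod>B\<in>\<sigma>'. h (k (Min B)) (k (Max B))))"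
  by (rule infsum_reindex_bij_witness[OF class_sum_labels_bij]) (auto simp: prod_ins prod_restrict class_sum_labels_iff simp del: restrict_apply)

lemmas class_sum_labels_summable_iff = class_sum_labels_summable_iff'[unfolded r'_def p_def \<sigma>'_def, unfolded V'_def]
lemmas class_sum_labels_infsum = class_sum_labels_infsum'[unfolded r'_def p_def \<sigma>'_def, unfolded V'_def]

end

lemmas class_sum_labels_singleton = class_sum_labels_single[unfolded V'_def]

end

section \<open>Series over labels as limits of walk sums\<close>

context summable_covariance begin

lemma adjacent_of_noncrossing:
  assumes "\<sigma> \<in> pairings V" "finite V" "V \<noteq> {}" "noncrossing \<sigma>"
  obtains u v where "u < v" "{u,v} \<in> \<sigma>" "\<And>z. z \<in> V \<Longrightarrow> \<not> (u < z \<and> z < v)"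
  using exists_innermost[OF assms(1-3)] innermost_not_adjacent_crossing[OF assms(1)] assms(4) by metis

lemma R_row_infsum_le: "(\<Sum>\<^sub>\<infinity>t. \<bar>R s t\<bar>) \<le> S"
proof -
  have "(\<Sum>\<^sub>\<infinity>t. \<bar>R s t\<bar>) = (\<Sum>\<^sub>\<infinity>(u,v)\<in>{s} \<times> UNIV. \<bar>R u v\<bar>)"
    by (rule infsum_reindex_bij_witness[of _ snd "\<lambda>t. (s,t)"]) auto
  also have "\<dots> \<le> S" unfolding S_def
    using summable_on_subset[OF R_summable, of "{s} \<times> UNIV"] R_summable
    by (intro infsum_mono_neutral) auto
  finally show ?thesis .
qed

text \<open>Each removal of neighbours leaves one free label t = k v, and a row of R has absolute
  sum at most S; every block contributes one factor.\<close>

lemma class_sum_labels_abs_summable: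
  assumes "finite V" "V \<noteq> {}" "\<sigma> \<in> pairings V" "noncrossing \<sigma>"
  shows "(\<lambda>k. \<Prod>B\<in>\<sigma>. \<bar>R (k (Min B)) (k (Max B))\<bar>) summable_on class_sum_labels V \<sigma> r \<and>
    (\<Sum>\<^sub>\<infinity>k\<in>class_sum_labels V \<sigma> r. \<Prod>B\<in>\<sigma>. \<bar>R (k (Min B)) (k (Max B))\<bar>) \<le> S ^ card \<sigma>"
  using assms
proof (induction "card V" arbitrary: V \<sigma> r rule: less_induct)
  case less
  obtain u v where uv: "u < v" "{u,v} \<in> \<sigma>" "\<And>z. z \<in> V \<Longrightarrow> \<not> (u < z \<and> z < v)"
    using adjacent_of_noncrossing[OF less.prems(3,1,2,4)] by metis
  have uvV: "u \<in> V" "v \<in> V" using pairings_subset[OF less.prems(3) uv(2)] by auto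
  have fs: "finite \<sigma>" using pairings_finite less.prems by auto
  have cs: "card \<sigma> = Suc (card (\<sigma> - {{u,v}}))" by (rule card.remove[OF fs uv(2)])
  have sp: "\<sigma> - {{u,v}} \<in> pairings (V - {u,v})" by (rule pairings_remove[OF less.prems(3) uv(2)])
  show ?case
  proof (cases "V - {u,v} = {}")
    case True
    have "\<sigma> - {{u,v}} = {}" using sp unfolding True pairings_empty by simp
    then have "\<sigma> = {{u,v}}" using uv(2) by auto
    then show ?thesis using class_sum_labels_singleton[OF less.prems(1,3) uv True, of r] R_le_S uv(1) by simp
  next
    case False
    have cl: "card (V - {u,v}) < card V" using uvV less.prems(1) by (intro psubset_card_mono) auto
    have IH: "(\<lambda>k. \<Prod>B\<in>\<sigma> - {{u,v}}. \<bar>R (k (Min B)) (k (Max B))\<bar>) summable_on class_sum_labels (V - {u,v}) (\<sigma> - {{u,v}}) \<rho>"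
      "(\<Sum>\<^sub>\<infinity>k\<in>class_sum_labels (V - {u,v}) (\<sigma> - {{u,v}}) \<rho>. \<Prod>B\<in>\<sigma> - {{u,v}}. \<bar>R (k (Min B)) (k (Max B))\<bar>) \<le> S ^ card (\<sigma> - {{u,v}})" for \<rho>
      using less.hyps[OF cl _ False sp, of \<rho>] less.prems(1,4) noncrossing_remove_adjacent[OF less.prems(3) uv]
      by auto
    let ?r = "\<lambda>t. r(cyc_pred V u := r (cyc_pred V u) + r v - t)"
    let ?A = "SIGMA t:UNIV. class_sum_labels (V - {u,v}) (\<sigma> - {{u,v}}) (?r t)"
    let ?P = "\<lambda>k. \<Prod>B\<in>\<sigma> - {{u,v}}. \<bar>R (k (Min B)) (k (Max B))\<bar>"
    define G where "G t = (\<Sum>\<^sub>\<infinity>k\<in>class_sum_labels (V - {u,v}) (\<sigma> - {{u,v}}) (?r t). ?P k)" for t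
    have row: "(\<lambda>t. \<bar>R (r u) t\<bar>) summable_on UNIV" using R_row_summable[of "r u"] by (simp add: R_sym[of "r u"])
    have G0: "0 \<le> G t" for t unfolding G_def by (intro infsum_nonneg prod_nonneg) auto
    have b: "\<bar>R (r u) t\<bar> * G t \<le> \<bar>R (r u) t\<bar> * S ^ card (\<sigma> - {{u,v}})" for t
      unfolding G_def by (intro mult_left_mono IH) auto
    have rs: "(\<lambda>t. \<bar>R (r u) t\<bar> * S ^ card (\<sigma> - {{u,v}})) summable_on UNIV"
      by (intro summable_on_cmult_left row)
    have s1: "(\<lambda>t. \<bar>R (r u) t\<bar> * G t) summable_on UNIV"
      by (rule summable_on_comparison_test[OF rs]) (use b G0 in auto)
    have hs: "((\<lambda>k. \<bar>R (r u) t\<bar> * ?P k) has_sum (\<bar>R (r u) t\<bar> * G t)) (class_sum_labels (V - {u,v}) (\<sigma> - {{u,v}}) (?r t))" for t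
      unfolding G_def by (intro has_sum_cmult_right has_sum_infsum IH)
    have sm: "(\<lambda>(t, k). \<bar>R (r u) t\<bar> * ?P k) summable_on ?A"
      by (rule summable_on_SigmaI[OF _ s1]) (use hs in \<open>auto simp: prod_nonneg\<close>)
    have eq: "(\<Sum>\<^sub>\<infinity>(t, k)\<in>?A. \<bar>R (r u) t\<bar> * ?P k) = (\<Sum>\<^sub>\<infinity>t. \<bar>R (r u) t\<bar> * G t)"
      using infsum_Sigma'_banach[OF sm] infsumI[OF hs] by simp
    have "(\<Sum>\<^sub>\<infinity>t. \<bar>R (r u) t\<bar> * G t) \<le> (\<Sum>\<^sub>\<infinity>t. \<bar>R (r u) t\<bar> * S ^ card (\<sigma> - {{u,v}}))"
      by (rule infsum_mono[OF s1 rs]) (rule b)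
    also have "\<dots> = (\<Sum>\<^sub>\<infinity>t. \<bar>R (r u) t\<bar>) * S ^ card (\<sigma> - {{u,v}})" by (rule infsum_cmult_left') 
    also have "\<dots> \<le> S * S ^ card (\<sigma> - {{u,v}})" using S_nonneg by (intro mult_right_mono R_row_infsum_le) auto
    finally have le: "(\<Sum>\<^sub>\<infinity>t. \<bar>R (r u) t\<bar> * G t) \<le> S ^ card \<sigma>" by (simp add: cs)
    show ?thesis
      using class_sum_labels_summable_iff[OF less.prems(1,3) uv False, of "\<lambda>a b. \<bar>R a b\<bar>" r]
        class_sum_labels_infsum[OF less.prems(1,3) uv False, of "\<lambda>a b. \<bar>R a b\<bar>" r] sm eq le by simp
  qed
qed

text \<open>Absolute summability justifies summing over t last. Symmetry of R brings the factor into
  the form in which it arises in \<open>W_step_tendsto\<close>.\<close>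

lemma class_sum_labels_infsum_step:
  assumes V: "finite V" "\<sigma> \<in> pairings V" "noncrossing \<sigma>"
    and uv: "u < v" "{u,v} \<in> \<sigma>" "\<And>z. z \<in> V \<Longrightarrow> \<not> (u < z \<and> z < v)"
    and ne: "V - {u,v} \<noteq> {}"
  shows "(\<Sum>\<^sub>\<infinity>k\<in>class_sum_labels V \<sigma> r. \<Prod>B\<in>\<sigma>. R (k (Min B)) (k (Max B))) =
    (\<Sum>\<^sub>\<infinity>t. R t (r u) * (\<Sum>\<^sub>\<infinity>k\<in>class_sum_labels (V - {u,v}) (\<sigma> - {{u,v}}) (r(cyc_pred V u := r (cyc_pred V u) + r v - t)).
       \<Prod>B\<in>\<sigma> - {{u,v}}. R (k (Min B)) (k (Max B))))"
proof -
  let ?A = "SIGMA t:UNIV. class_sum_labels (V - {u,v}) (\<sigma> - {{u,v}}) (r(cyc_pred V u := r (cyc_pred V u) + r v - t))"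
  let ?P = "\<lambda>k. \<Prod>B\<in>\<sigma> - {{u,v}}. R (k (Min B)) (k (Max B))"
  have Vne: "V \<noteq> {}" using ne by auto
  have "(\<lambda>(t, k). \<bar>R (r u) t\<bar> * (\<Prod>B\<in>\<sigma> - {{u,v}}. \<bar>R (k (Min B)) (k (Max B))\<bar>)) summable_on ?A"
    using class_sum_labels_summable_iff[OF V(1,2) uv ne, of "\<lambda>a b. \<bar>R a b\<bar>" r] class_sum_labels_abs_summable[OF V(1) Vne V(2,3), of r] by simp
  then have "(\<lambda>q. norm (case q of (t, k) \<Rightarrow> R (r u) t * ?P k)) summable_on ?A"
    by (simp add: case_prod_unfold abs_mult abs_prod)
  then have sm: "(\<lambda>(t, k). R (r u) t * ?P k) summable_on ?A" by (rule abs_summable_summable)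
  have "(\<Sum>\<^sub>\<infinity>k\<in>class_sum_labels V \<sigma> r. \<Prod>B\<in>\<sigma>. R (k (Min B)) (k (Max B))) = (\<Sum>\<^sub>\<infinity>(t, k)\<in>?A. R (r u) t * ?P k)"
    by (rule class_sum_labels_infsum[OF V(1,2) uv ne])
  also have "\<dots> = (\<Sum>\<^sub>\<infinity>t. \<Sum>\<^sub>\<infinity>k\<in>class_sum_labels (V - {u,v}) (\<sigma> - {{u,v}}) (r(cyc_pred V u := r (cyc_pred V u) + r v - t)). R (r u) t * ?P k)"
    using infsum_Sigma'_banach[OF sm] by simp
  also have "\<dots> = (\<Sum>\<^sub>\<infinity>t. R t (r u) * (\<Sum>\<^sub>\<infinity>k\<in>class_sum_labels (V - {u,v}) (\<sigma> - {{u,v}}) (r(cyc_pred V u := r (cyc_pred V u) + r v - t)). ?P k))"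
    by (intro infsum_cong) (simp add: infsum_cmult_right' R_sym)
  finally show ?thesis .
qed

text \<open>Walk sums and label series satisfy the same recursion. A crossing pairing stays crossing
  when neighbours are removed, so it eventually presents an innermost block with elements between
  its ends, where the limit is 0.\<close>

theorem W_tendsto:
  assumes "finite V" "card V = 2 * m" "m \<ge> 1" "\<sigma> \<in> pairings V"
  shows "(\<lambda>n. W n V \<sigma> r / real n ^ (m + 1)) \<longlonglongrightarrow>
    (if noncrossing \<sigma> then \<Sum>\<^sub>\<infinity>k\<in>class_sum_labels V \<sigma> r. \<Prod>B\<in>\<sigma>. R (k (Min B)) (k (Max B)) else 0)"
  using assms
proof (induction m arbitrary: V \<sigma> r rule: less_induct)
  case (less m)
  note V = less.prems(1,2,4)
  have "V \<noteq> {}" using less.prems by auto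
  obtain u v where uv: "u < v" "{u,v} \<in> \<sigma>" "\<And>B. B \<in> \<sigma> \<Longrightarrow> \<not> (u < Min B \<and> Max B < v)"
    using exists_innermost[OF V(3,1) \<open>V \<noteq> {}\<close>] by metis
  have uvV: "u \<in> V" "v \<in> V" using pairings_subset[OF V(3) uv(2)] by auto
  show ?case
  proof (cases "\<exists>z\<in>V. u < z \<and> z < v")
    case True
    then have "\<not> noncrossing \<sigma>" using innermost_not_adjacent_crossing[OF V(3) uv] by blast
    then show ?thesis using W_crossing_tendsto[OF V uv True] by simp
  next
    case False
    then have adj: "\<And>z. z \<in> V \<Longrightarrow> \<not> (u < z \<and> z < v)" by blast
    have sp: "\<sigma> - {{u,v}} \<in> pairings (V - {u,v})" by (rule pairings_remove[OF V(3) uv(2)])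
    have nc: "noncrossing \<sigma> = noncrossing (\<sigma> - {{u,v}})" by (rule noncrossing_remove_adjacent[OF V(3) uv(1,2) adj])
    show ?thesis
    proof (cases "V - {u,v} = {}")
      case True
      have "\<sigma> - {{u,v}} = {}" using sp unfolding True pairings_empty by simp
      then have s: "\<sigma> = {{u,v}}" using uv(2) by auto
      have Ve: "V = {u,v}" using True uvV by auto
      have m: "m = 1" using V(2) uv(1) Ve by simp
      have "noncrossing \<sigma>" unfolding s noncrossing_def by auto
      moreover have "(\<Sum>\<^sub>\<infinity>k\<in>class_sum_labels V \<sigma> r. \<Prod>B\<in>\<sigma>. R (k (Min B)) (k (Max B))) = R (r u) (r v)"
        using class_sum_labels_singleton[OF V(1,3) uv(1,2) adj True, of r] uv(1) by (simp add: s)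
      ultimately show ?thesis using W_single_tendsto[OF uv(1), of r] unfolding s Ve m by simp
    next
      case ne: False
      have c': "card (V - {u,v}) = 2 * (m - 1)" using V(1,2) uv(1) uvV by (simp add: card_Diff_subset)
      have "card (V - {u,v}) > 0" using ne V(1) by (simp add: card_gt_0_iff)
      then have m2: "m - 1 \<ge> 1" using c' by simp
      let ?L = "\<lambda>\<rho>. if noncrossing (\<sigma> - {{u,v}}) then \<Sum>\<^sub>\<infinity>k\<in>class_sum_labels (V - {u,v}) (\<sigma> - {{u,v}}) \<rho>. \<Prod>B\<in>\<sigma> - {{u,v}}. R (k (Min B)) (k (Max B)) else 0"
      have IH: "(\<lambda>n. W n (V - {u,v}) (\<sigma> - {{u,v}}) \<rho> / real n ^ (m - 1 + 1)) \<longlonglongrightarrow> ?L \<rho>" for \<rho>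
        using m2 V(1) by (intro less.IH c' sp) auto
      have "(\<lambda>n. W n V \<sigma> r / real n ^ (m + 1)) \<longlonglongrightarrow> (\<Sum>\<^sub>\<infinity>t. R t (r u) * ?L (r(cyc_pred V u := r (cyc_pred V u) + r v - t)))"
        by (rule W_step_tendsto[OF V uv(1,2) adj ne IH])
      moreover have "(\<Sum>\<^sub>\<infinity>t. R t (r u) * ?L (r(cyc_pred V u := r (cyc_pred V u) + r v - t))) =
         (if noncrossing \<sigma> then \<Sum>\<^sub>\<infinity>k\<in>class_sum_labels V \<sigma> r. \<Prod>B\<in>\<sigma>. R (k (Min B)) (k (Max B)) else 0)"
        using class_sum_labels_infsum_step[OF V(1,3) _ uv(1,2) adj ne, of r] nc by simp
      ultimately show ?thesis by simp
    qed
  qed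
qed

end

text \<open>The barred copy of i lies between u and v exactly when u \<le> i < v, hence the
  half-open test in \<open>kreweras_class\<close>. A barred block with points on both sides of {u,
  v} crosses it, so every admissible partition refines the classes; the classes themselves are
  admissible, and refinement is antisymmetric.\<close>

lemma kreweras_eq:
  assumes s: "\<sigma> \<in> NC2 N"
  shows "kreweras N \<sigma> = kreweras_class {1..N} \<sigma> ` {1..N}"
proof -
  define V where "V = {1..N}"
  have sp: "\<sigma> \<in> pairings V" and nc: "noncrossing \<sigma>" using s by (auto simp: NC2_eq V_def)
  define \<tau> where "\<tau> = kreweras_class V \<sigma> ` V"
  let ?adm = "\<lambda>\<tau>. partition_on V \<tau> \<and> noncrossing (interleave \<sigma> \<tau>)"
  have blk: "\<exists>u v. u < v \<and> B = {u,v} \<and> Min B = u \<and> Max B = v" if "B \<in> \<sigma>" for B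
    using pairings_block[OF sp that] by metis
  have part: "partition_on V \<tau>"
  proof (rule partition_onI)
    show "\<Union>\<tau> = V"
    proof
      show "\<Union>\<tau> \<subseteq> V" unfolding \<tau>_def using kreweras_class_sub by blast
      show "V \<subseteq> \<Union>\<tau>" unfolding \<tau>_def using kreweras_class_refl by blast
    qed
    show "disjnt p q" if pq: "p \<in> \<tau>" "q \<in> \<tau>" "p \<noteq> q" for p q
    proof (rule ccontr)
      assume "\<not> disjnt p q"
      then obtain x where x: "x \<in> p" "x \<in> q" by (auto simp: disjnt_iff)
      obtain a b where "p = kreweras_class V \<sigma> a" "q = kreweras_class V \<sigma> b" using pq by (auto simp: \<tau>_def)
      then show False using kreweras_class_eq[of x V \<sigma> a] kreweras_class_eq[of x V \<sigma> b] x pq(3) by simp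
    qed
    show "{} \<notin> \<tau>" unfolding \<tau>_def using kreweras_class_refl by blast
  qed
  have same: "(Min B \<le> i \<and> i < Max B) = (Min B \<le> j \<and> j < Max B)" if "B \<in> \<sigma>" "X \<in> \<tau>" "i \<in> X" "j \<in> X" for B X i j
    using that unfolding \<tau>_def kreweras_class_def by auto
  have diff: "\<exists>B\<in>\<sigma>. (Min B \<le> i \<and> i < Max B) \<noteq> (Min B \<le> j \<and> j < Max B)"
    if X: "X \<in> \<tau>" "Y \<in> \<tau>" "X \<noteq> Y" "i \<in> X" "j \<in> Y" for X Y i j
  proof (rule ccontr)
    assume "\<not> ?thesis"
    moreover have "i \<in> V" "j \<in> V" using X kreweras_class_sub by (auto simp: \<tau>_def)
    ultimately have "j \<in> kreweras_class V \<sigma> i" by (auto simp: kreweras_class_def)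
    moreover obtain a b where "X = kreweras_class V \<sigma> a" "Y = kreweras_class V \<sigma> b" using X by (auto simp: \<tau>_def)
    ultimately show False using X kreweras_class_eq by metis
  qed
  have "noncrossing (interleave \<sigma> \<tau>)"
  proof (rule noncrossingI)
    fix P Q a b c d
    assume P: "P \<in> interleave \<sigma> \<tau>" and Q: "Q \<in> interleave \<sigma> \<tau>" and "P \<noteq> Q"
      and abcd: "a \<in> P" "b \<in> Q" "c \<in> P" "d \<in> Q" "a < b" "b < c" "c < d"
    consider (ss) B C where "B \<in> \<sigma>" "C \<in> \<sigma>" "P = (\<lambda>j. 2 * j) ` B" "Q = (\<lambda>j. 2 * j) ` C"
      | (st) B X where "B \<in> \<sigma>" "X \<in> \<tau>" "P = (\<lambda>j. 2 * j) ` B" "Q = (\<lambda>j. 2 * j + 1) ` X"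
      | (ts) B X where "B \<in> \<sigma>" "X \<in> \<tau>" "Q = (\<lambda>j. 2 * j) ` B" "P = (\<lambda>j. 2 * j + 1) ` X"
      | (tt) X Y where "X \<in> \<tau>" "Y \<in> \<tau>" "P = (\<lambda>j. 2 * j + 1) ` X" "Q = (\<lambda>j. 2 * j + 1) ` Y"
      using P Q unfolding interleave_def by blast
    then show False
    proof cases
      case ss
      obtain a' b' c' d' where "a' \<in> B" "b' \<in> C" "c' \<in> B" "d' \<in> C" "a' < b'" "b' < c'" "c' < d'"
        using abcd ss(3,4) by auto
      moreover have "B \<noteq> C" using \<open>P \<noteq> Q\<close> ss by auto
      ultimately show False using noncrossingD[OF nc ss(1,2)] by metis
    next
      case st
      obtain u v where uv: "u < v" "B = {u,v}" "Min B = u" "Max B = v" using blk[OF st(1)] by blast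
      obtain b' d' where "b' \<in> X" "d' \<in> X" "u \<le> b'" "b' < v" "v \<le> d'"
        using abcd uv(1,2) st(3,4) by auto
      then show False using same[OF st(1,2), of b' d'] uv by auto
    next
      case ts
      obtain u v where uv: "u < v" "B = {u,v}" "Min B = u" "Max B = v" using blk[OF ts(1)] by blast
      obtain a' c' where "a' \<in> X" "c' \<in> X" "a' < u" "u \<le> c'" "c' < v"
        using abcd uv(1,2) ts(3,4) by auto
      then show False using same[OF ts(1,2), of a' c'] uv by auto
    next
      case tt
      obtain a' b' c' d' where p: "a' \<in> X" "b' \<in> Y" "c' \<in> X" "d' \<in> Y" "a' < b'" "b' < c'" "c' < d'"
        using abcd tt(3,4) by auto
      have "X \<noteq> Y" using \<open>P \<noteq> Q\<close> tt by auto
      then obtain B where B: "B \<in> \<sigma>" "(Min B \<le> a' \<and> a' < Max B) \<noteq> (Min B \<le> b' \<and> b' < Max B)"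
        using diff[OF tt(1,2) _ p(1,2)] by blast
      \<comment> \<open>The interval of B treats a' and c' alike, b' and d' alike, but a' and b'
        differently. No interval does this for a' < b' < c' < d'.\<close>
      show False using B(2) same[OF B(1) tt(1) p(1,3)] same[OF B(1) tt(2) p(2,4)] p(5-7) by auto
    qed
  qed
  then have adm: "?adm \<tau>" using part by blast
  have great: "refines V \<tau>' \<tau>" if a: "?adm \<tau>'" for \<tau>'
    unfolding refines_def
  proof (intro conjI ballI)
    show "partition_on V \<tau>'" "partition_on V \<tau>" using a part by auto
    fix X assume X: "X \<in> \<tau>'"
    then have XV: "X \<subseteq> V" "X \<noteq> {}" using a by (auto simp: partition_on_def)
    then obtain i where i: "i \<in> X" by auto
    have "(Min B \<le> i \<and> i < Max B) = (Min B \<le> j \<and> j < Max B)" if j: "j \<in> X" and B: "B \<in> \<sigma>" for j B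
    proof -
      obtain u v where uv: "u < v" "B = {u,v}" "Min B = u" "Max B = v" using blk[OF B] by blast
      have mem: "(\<lambda>j. 2 * j) ` B \<in> interleave \<sigma> \<tau>'" "(\<lambda>j. 2 * j + 1) ` X \<in> interleave \<sigma> \<tau>'"
        using B X by (auto simp: interleave_def)
      have "2 * u \<in> (\<lambda>j. 2 * j) ` B" using uv by auto
      moreover have "2 * u \<notin> (\<lambda>j. 2 * j + 1) ` X" by (auto, presburger)
      ultimately have ne: "(\<lambda>j. 2 * j) ` B \<noteq> (\<lambda>j. 2 * j + 1) ` X" by blast
      note no = noncrossingD[OF conjunct2[OF a]]
      have B2: "2 * u \<in> (\<lambda>j. 2 * j) ` B" "2 * v \<in> (\<lambda>j. 2 * j) ` B" using uv(2) by auto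
      have X2: "2 * x + 1 \<in> (\<lambda>j. 2 * j + 1) ` X" if "x \<in> X" for x using that by auto
      have F: False if xy: "x \<in> X" "y \<in> X" "u \<le> x" "x < v" "\<not> (u \<le> y \<and> y < v)" for x y
      proof (cases "y < u")
        case True
        then have "2 * y + 1 < 2 * u \<and> 2 * u < 2 * x + 1 \<and> 2 * x + 1 < 2 * v" using xy by auto
        then show False using no[OF mem(2,1) ne[symmetric] X2[OF xy(2)] B2(1) X2[OF xy(1)] B2(2)] by blast
      next
        case False
        then have "2 * u < 2 * x + 1 \<and> 2 * x + 1 < 2 * v \<and> 2 * v < 2 * y + 1" using xy by auto
        then show False using no[OF mem ne B2(1) X2[OF xy(1)] B2(2) X2[OF xy(2)]] by blast
      qed
      show ?thesis unfolding uv(3,4) using F[of i j] F[of j i] i j by blast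
    qed
    then have "X \<subseteq> kreweras_class V \<sigma> i" using XV by (auto simp: kreweras_class_def)
    moreover have "kreweras_class V \<sigma> i \<in> \<tau>" using i XV by (auto simp: \<tau>_def)
    ultimately show "\<exists>Y\<in>\<tau>. X \<subseteq> Y" by blast
  qed
  have "kreweras N \<sigma> = \<tau>"
    unfolding kreweras_def V_def[symmetric]
  proof (rule the_equality)
    show "partition_on V \<tau> \<and> noncrossing (interleave \<sigma> \<tau>) \<and>
      (\<forall>\<tau>'. partition_on V \<tau>' \<and> noncrossing (interleave \<sigma> \<tau>') \<longrightarrow> refines V \<tau>' \<tau>)"
      using adm great by blast
    fix \<tau>'' assume "partition_on V \<tau>'' \<and> noncrossing (interleave \<sigma> \<tau>'') \<and>
      (\<forall>\<tau>'. partition_on V \<tau>' \<and> noncrossing (interleave \<sigma> \<tau>') \<longrightarrow> refines V \<tau>' \<tau>'')"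
    then have "refines V \<tau> \<tau>''" "refines V \<tau>'' \<tau>" using adm great by blast+
    then show "\<tau>'' = \<tau>" by (rule refines_asym[rotated])
  qed
  then show ?thesis by (simp add: \<tau>_def V_def)
qed

lemma S_set_eq: "\<sigma> \<in> NC2 N \<Longrightarrow> S_set N \<sigma> = class_sum_labels {1..N} \<sigma> (\<lambda>_. 0)"
  unfolding S_set_def class_sum_labels_def by (simp add: kreweras_eq)

text \<open>Call the smaller end of a block its opener. The block of the largest opener u must close
  at the next element: anything in between would be a closer of an earlier opener and cross it. Both
  pairings share this block; remove it.\<close>

lemma noncrossing_determined_by_openers:
  assumes "finite V" "\<sigma> \<in> pairings V" "\<tau> \<in> pairings V" "noncrossing \<sigma>" "noncrossing \<tau>" "Min ` \<sigma> = Min ` \<tau>"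
  shows "\<sigma> = \<tau>"
  using assms
proof (induction "card V" arbitrary: V \<sigma> \<tau> rule: less_induct)
  case less
  show ?case
  proof (cases "V = {}")
    case True then show ?thesis using less.prems by (simp add: pairings_empty)
  next
    case False
    define u where "u = Max (Min ` \<sigma>)"
    have last: "\<exists>v. u < v \<and> {u,v} \<in> \<rho> \<and> (\<forall>z\<in>V. \<not> (u < z \<and> z < v))"
      if \<rho>: "\<rho> \<in> pairings V" "noncrossing \<rho>" "Min ` \<rho> = Min ` \<sigma>" for \<rho>
    proof -
      have f: "finite \<rho>" "\<rho> \<noteq> {}" using pairings_finite[OF \<rho>(1)] less.prems(1) False \<rho>(1)
        by (auto simp: pairings_def partition_on_def)
      then have "u \<in> Min ` \<rho>" unfolding u_def \<rho>(3)[symmetric] by (intro Max_in) auto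
      then obtain B where B: "B \<in> \<rho>" "Min B = u" by auto
      obtain v where v: "u < v" "B = {u,v}" using pairings_block[OF \<rho>(1) B(1)] B(2) by metis
      have "\<not> (u < z \<and> z < v)" if z: "z \<in> V" for z
      proof
        assume zz: "u < z \<and> z < v"
        obtain D where D: "D \<in> \<rho>" "z \<in> D" using pairings_cover[OF \<rho>(1) z] by blast
        obtain a b where ab: "a < b" "D = {a,b}" "Min D = a" using pairings_block[OF \<rho>(1) D(1)] by metis
        have "D \<noteq> B" using D v zz by auto
        then have "a \<noteq> u" using pairings_disjoint[OF \<rho>(1) D(1) B(1)] ab v by auto
        moreover have "a \<le> u"
        proof -
          have "a \<in> Min ` \<rho>" using D(1) ab(3) by (metis image_eqI)
          then show ?thesis using f(1) unfolding u_def \<rho>(3)[symmetric] by (intro Max_ge) auto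
        qed
        ultimately have "a < u" "z = b" using D ab zz by auto
        then show False using noncrossingD[OF \<rho>(2) D(1) B(1) \<open>D \<noteq> B\<close>, of a u z v] ab v zz by auto
      qed
      then show ?thesis using B v by auto
    qed
    obtain v where v: "u < v" "{u,v} \<in> \<sigma>" "\<And>z. z \<in> V \<Longrightarrow> \<not> (u < z \<and> z < v)"
      using last[OF less.prems(2,4)] by blast
    obtain v' where v': "u < v'" "{u,v'} \<in> \<tau>" "\<And>z. z \<in> V \<Longrightarrow> \<not> (u < z \<and> z < v')"
      using last[OF less.prems(3,5)] less.prems(6) by metis
    have V: "u \<in> V" "v \<in> V" "v' \<in> V" using pairings_subset[OF less.prems(2) v(2)] pairings_subset[OF less.prems(3) v'(2)] by auto
    have eq: "v' = v" using v(3)[OF V(3)] v'(3)[OF V(2)] v(1) v'(1) by auto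
    note v'' = v'(2)[unfolded eq]
    have im: "Min ` (\<rho> - {{u,v}}) = Min ` \<rho> - {u}" if r: "\<rho> \<in> pairings V" "{u,v} \<in> \<rho>" for \<rho>
    proof -
      have "Min B \<noteq> u" if "B \<in> \<rho>" "B \<noteq> {u,v}" for B
        using pairings_block[OF r(1) that(1)] pairings_disjoint[OF r(1) that(1) r(2)] that(2)
        by (metis insertCI)
      moreover have "Min {u,v} = u" using v(1) by simp
      ultimately show ?thesis by auto
    qed
    have "card (V - {u,v}) < card V" using V less.prems(1) by (intro psubset_card_mono) auto
    then have "\<sigma> - {{u,v}} = \<tau> - {{u,v}}"
    proof (rule less.hyps)
      show "noncrossing (\<sigma> - {{u,v}})" using noncrossing_remove_adjacent[OF less.prems(2) v] less.prems by simp
      show "noncrossing (\<tau> - {{u,v}})" using noncrossing_remove_adjacent[OF less.prems(3) v(1) v'' v(3)] less.prems by simp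
    qed (use less.prems v(2) v'' pairings_remove im in auto)
    then show ?thesis using v(2) v'' by blast
  qed
qed

text \<open>The set of openers is an injective code. The exact count is a Catalan number, but any
  geometric bound serves.\<close>

lemma card_NC2_le: "card (NC2 N) \<le> 2 ^ N"
proof -
  have "card (NC2 N) \<le> card (Pow {1..N})"
  proof (rule card_inj_on_le[where f = "\<lambda>\<sigma>. Min ` \<sigma>"])
    show "inj_on (\<lambda>\<sigma>. Min ` \<sigma>) (NC2 N)"
      using noncrossing_determined_by_openers[of "{1..N}"] by (auto simp: inj_on_def NC2_eq)
    show "(\<lambda>\<sigma>. Min ` \<sigma>) ` NC2 N \<subseteq> Pow {1..N}"
    proof (safe)
      fix \<sigma> B assume "\<sigma> \<in> NC2 N" "B \<in> \<sigma>"
      then show "Min B \<in> {1..N}" using pairings_block[of \<sigma> "{1..N}" B] unfolding NC2_eq by (metis (mono_tags, lifting) mem_Collect_eq)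
    qed
  qed simp
  then show ?thesis by (simp add: card_Pow)
qed

section \<open>The random matrices\<close>

text \<open>Stationarity enters in the form of the covariance formula, obtained by moving the first
  index pair to the origin.\<close>

locale gaussian_field = prob_space M for M :: "'a measure" +
  fixes Z :: "int \<Rightarrow> int \<Rightarrow> 'a \<Rightarrow> real" and R :: "int \<Rightarrow> int \<Rightarrow> real"
  assumes gaussian: "gaussian_process M (\<lambda>(i, j). Z i j)"
    and centered: "\<And>i j. expectation (Z i j) = 0"
    and covariance: "\<And>i j k l. expectation (\<lambda>\<omega>. Z i j \<omega> * Z k l \<omega>) = R (i - k) (l - j)"
    and R_symmetric: "\<And>u v. R u v = R v u"
    and R_abs_summable: "(\<lambda>(u, v). \<bar>R u v\<bar>) summable_on UNIV"

sublocale gaussian_field \<subseteq> summable_covariance R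
proof
  fix u v
  show "R u v = R v u" by (rule R_symmetric)
  \<comment> \<open>Exchanging the two factors of a covariance negates both arguments of R.\<close>
  have "R (- u) (- v) = expectation (\<lambda>\<omega>. Z 0 0 \<omega> * Z u (- v) \<omega>)"
    using covariance[of 0 0 u "- v"] by simp
  also have "\<dots> = expectation (\<lambda>\<omega>. Z u (- v) \<omega> * Z 0 0 \<omega>)" by (simp add: mult.commute)
  also have "\<dots> = R u v" using covariance[of u "- v" 0 0] by simp
  finally show "R (- u) (- v) = R u v" .
qed (rule R_abs_summable)

context gaussian_field begin

text \<open>Vertices run over 0, ..., n - 1; the offset 1 matches \<open>sym_field_matrix\<close>
  and cancels in covariances.\<close>

definition entry :: "int \<Rightarrow> int \<Rightarrow> 'a \<Rightarrow> real" where
  "entry a b = Z (min a b + 1) (max a b + 1)"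

lemma entry_measurable[measurable]: "entry a b \<in> borel_measurable M"
proof -
  have "\<And>p. (\<lambda>(i, j). Z i j) p \<in> borel_measurable M" using gaussian unfolding gaussian_process_def by blast
  from this[of "(min a b + 1, max a b + 1)"] show ?thesis by (simp add: entry_def)
qed

text \<open>The predecessor map is a parameter so that two disjoint cycles can be treated as one
  walk sum, as the second moment requires.\<close>

definition walk_sum :: "nat \<Rightarrow> nat set \<Rightarrow> (nat \<Rightarrow> nat) \<Rightarrow> 'a \<Rightarrow> real" where
  "walk_sum n V q \<omega> = (\<Sum>x\<in>PiE V (\<lambda>_. {0..<int n}). \<Prod>v\<in>V. entry (x (q v)) (x v) \<omega>)"

lemma entry_process: "gaussian_process M (\<lambda>v. entry (a v) (b v))" "expectation (entry c d) = 0"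
proof -
  have "gaussian_process M (\<lambda>v. (\<lambda>(i, j). Z i j) (min (a v) (b v) + 1, max (a v) (b v) + 1))"
    by (rule gaussian_process_comp[OF gaussian])
  then show "gaussian_process M (\<lambda>v. entry (a v) (b v))" by (simp add: entry_def)
  show "expectation (entry c d) = 0" by (simp add: entry_def centered)
qed

lemma entry_cov: "expectation (\<lambda>\<omega>. entry a b \<omega> * entry c d \<omega>) = C a b c d"
  unfolding entry_def covariance C_def by (simp add: algebra_simps)

lemma entry_prod_integrable: "finite V \<Longrightarrow> integrable M (\<lambda>\<omega>. \<Prod>v\<in>V. entry (a v) (b v) \<omega>)"
  using gaussian_process_integrable_prod[OF entry_process(1)[of a b] entry_process(2), of V "\<lambda>v. v"] by simp

lemma walk_sum_measurable[measurable]: "walk_sum n V q \<in> borel_measurable M"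
  unfolding walk_sum_def[abs_def] by measurable

lemma walk_sum_integrable: "finite V \<Longrightarrow> integrable M (walk_sum n V q)"
  unfolding walk_sum_def[abs_def] by (intro Bochner_Integration.integrable_sum entry_prod_integrable)

lemma walk_sum_expectation:
  assumes V: "finite V"
  shows "expectation (walk_sum n V q) = (\<Sum>\<sigma>\<in>pairings V. \<Sum>x\<in>PiE V (\<lambda>_. {0..<int n}). \<Prod>B\<in>\<sigma>. edge_cov q (\<lambda>_. 0) x B)"
proof -
  have "expectation (walk_sum n V q) = (\<Sum>x\<in>PiE V (\<lambda>_. {0..<int n}). expectation (\<lambda>\<omega>. \<Prod>v\<in>V. entry (x (q v)) (x v) \<omega>))"
    unfolding walk_sum_def by (intro Bochner_Integration.integral_sum entry_prod_integrable V)
  also have "\<dots> = (\<Sum>x\<in>PiE V (\<lambda>_. {0..<int n}). \<Sum>\<sigma>\<in>pairings V. \<Prod>B\<in>\<sigma>. edge_cov q (\<lambda>_. 0) x B)"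
  proof (intro sum.cong refl)
    fix x :: "nat \<Rightarrow> int"
    show "expectation (\<lambda>\<omega>. \<Prod>v\<in>V. entry (x (q v)) (x v) \<omega>) = (\<Sum>\<sigma>\<in>pairings V. \<Prod>B\<in>\<sigma>. edge_cov q (\<lambda>_. 0) x B)"
      unfolding edge_cov_def using wick[OF entry_process(1)[of "\<lambda>v. x (q v)" "\<lambda>v. x v"] entry_process(2) V] by (simp add: entry_cov)
  qed
  finally show ?thesis by (simp add: sum.swap[of _ "pairings V"])
qed

lemma walk_sum_expectation_pr:
  assumes "finite V" shows "expectation (walk_sum n V (cyc_pred V)) = (\<Sum>\<sigma>\<in>pairings V. W n V \<sigma> (\<lambda>_. 0))"
  unfolding W_def by (rule walk_sum_expectation[OF assms])

section \<open>Two closed walks at once\<close>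

definition cyc_pred2 :: "nat set \<Rightarrow> nat set \<Rightarrow> nat \<Rightarrow> nat" where
  "cyc_pred2 V1 V2 l = (if l \<in> V1 then cyc_pred V1 l else cyc_pred V2 l)"

context
  fixes V1 V2 :: "nat set"
  assumes V: "finite V1" "finite V2" "V1 \<inter> V2 = {}"
begin

lemma sum_PiE_Un:
  fixes h :: "(nat \<Rightarrow> int) \<Rightarrow> real"
  assumes f: "\<And>x y. (\<And>v. v \<in> V1 \<Longrightarrow> x v = y v) \<Longrightarrow> f x = f y" and g: "\<And>x y. (\<And>v. v \<in> V2 \<Longrightarrow> x v = y v) \<Longrightarrow> g x = g y"
  shows "(\<Sum>x\<in>PiE (V1 \<union> V2) (\<lambda>_. X). f x * g x) = (\<Sum>x\<in>PiE V1 (\<lambda>_. X). f x) * (\<Sum>x\<in>PiE V2 (\<lambda>_. X). (g x :: real))"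
proof -
  have "(\<Sum>x\<in>PiE (V1 \<union> V2) (\<lambda>_. X). f x * g x) = (\<Sum>p\<in>PiE V1 (\<lambda>_. X) \<times> PiE V2 (\<lambda>_. X). f (fst p) * g (snd p))"
  proof (rule sum.reindex_bij_witness[of _ "\<lambda>p. (\<lambda>v. if v \<in> V1 then fst p v else snd p v)" "\<lambda>x. (restrict x V1, restrict x V2)"])
    fix p assume "p \<in> PiE V1 (\<lambda>_. X) \<times> PiE V2 (\<lambda>_. X)"
    then show "(restrict (\<lambda>v. if v \<in> V1 then fst p v else snd p v) V1, restrict (\<lambda>v. if v \<in> V1 then fst p v else snd p v) V2) = p"
      "(\<lambda>v. if v \<in> V1 then fst p v else snd p v) \<in> PiE (V1 \<union> V2) (\<lambda>_. X)"
      using V by (auto simp: fun_eq_iff restrict_def PiE_iff extensional_def prod_eq_iff)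
  next
    fix x assume x: "x \<in> PiE (V1 \<union> V2) (\<lambda>_. X)"
    then show "(\<lambda>v. if v \<in> V1 then fst (restrict x V1, restrict x V2) v else snd (restrict x V1, restrict x V2) v) = x"
      by (auto simp: fun_eq_iff restrict_def PiE_iff extensional_def)
    show "(restrict x V1, restrict x V2) \<in> PiE V1 (\<lambda>_. X) \<times> PiE V2 (\<lambda>_. X)"
      using x by (auto simp: PiE_iff)
    have "f (restrict x V1) = f x" "g (restrict x V2) = g x" by (intro f g; simp)+
    then show "f (fst (restrict x V1, restrict x V2)) * g (snd (restrict x V1, restrict x V2)) = f x * g x" by simp
  qed
  also have "\<dots> = (\<Sum>x\<in>PiE V1 (\<lambda>_. X). f x) * (\<Sum>x\<in>PiE V2 (\<lambda>_. X). g x)"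
    by (simp add: sum_product sum.cartesian_product case_prod_unfold)
  finally show ?thesis .
qed

lemma cyc_pred2_in: "l \<in> V1 \<Longrightarrow> cyc_pred2 V1 V2 l = cyc_pred V1 l \<and> cyc_pred2 V1 V2 l \<in> V1" "l \<in> V2 \<Longrightarrow> cyc_pred2 V1 V2 l = cyc_pred V2 l \<and> cyc_pred2 V1 V2 l \<in> V2"
  using V cyc_pred_in[OF V(1), of l] cyc_pred_in[OF V(2), of l] by (auto simp: cyc_pred2_def)

lemma walk_sum_prod: "walk_sum n (V1 \<union> V2) (cyc_pred2 V1 V2) \<omega> = walk_sum n V1 (cyc_pred V1) \<omega> * walk_sum n V2 (cyc_pred V2) \<omega>"
proof -
  have "walk_sum n (V1 \<union> V2) (cyc_pred2 V1 V2) \<omega> = (\<Sum>x\<in>PiE (V1 \<union> V2) (\<lambda>_. {0..<int n}).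
      (\<Prod>v\<in>V1. entry (x (cyc_pred2 V1 V2 v)) (x v) \<omega>) * (\<Prod>v\<in>V2. entry (x (cyc_pred2 V1 V2 v)) (x v) \<omega>))"
    unfolding walk_sum_def using V by (simp add: prod.union_disjoint)
  also have "\<dots> = (\<Sum>x\<in>PiE V1 (\<lambda>_. {0..<int n}). \<Prod>v\<in>V1. entry (x (cyc_pred2 V1 V2 v)) (x v) \<omega>) * (\<Sum>x\<in>PiE V2 (\<lambda>_. {0..<int n}). \<Prod>v\<in>V2. entry (x (cyc_pred2 V1 V2 v)) (x v) \<omega>)"
    using cyc_pred2_in by (intro sum_PiE_Un prod.cong refl) metis+
  also have "\<dots> = walk_sum n V1 (cyc_pred V1) \<omega> * walk_sum n V2 (cyc_pred V2) \<omega>"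
    unfolding walk_sum_def using cyc_pred2_in by (intro arg_cong2[of _ _ _ _ "(*)"] sum.cong prod.cong refl) metis+
  finally show ?thesis .
qed

definition unlinked :: "nat set set set" where
  "unlinked = {\<sigma>\<in>pairings (V1 \<union> V2). \<forall>B\<in>\<sigma>. B \<subseteq> V1 \<or> B \<subseteq> V2}"

lemma sum_unlinked:
  "(\<Sum>\<sigma>\<in>unlinked. h \<sigma>) = (\<Sum>\<sigma>1\<in>pairings V1. \<Sum>\<sigma>2\<in>pairings V2. (h (\<sigma>1 \<union> \<sigma>2) :: real))"
proof -
  have ne: "B \<noteq> {}" if "B \<in> \<sigma>" "\<sigma> \<in> pairings A" for B \<sigma> A using that by (auto simp: pairings_def)
  have "(\<Sum>\<sigma>\<in>unlinked. h \<sigma>) = (\<Sum>(\<sigma>1,\<sigma>2)\<in>pairings V1 \<times> pairings V2. h (\<sigma>1 \<union> \<sigma>2))"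
  proof (rule sum.reindex_bij_witness[of _ "\<lambda>(\<sigma>1,\<sigma>2). \<sigma>1 \<union> \<sigma>2" "\<lambda>\<sigma>. ({B\<in>\<sigma>. B \<subseteq> V1}, {B\<in>\<sigma>. B \<subseteq> V2})"])
    fix \<sigma> assume s: "\<sigma> \<in> unlinked"
    then have sp: "\<sigma> \<in> pairings (V1 \<union> V2)" and u: "\<And>B. B \<in> \<sigma> \<Longrightarrow> B \<subseteq> V1 \<or> B \<subseteq> V2" by (auto simp: unlinked_def)
    show eq: "(case ({B\<in>\<sigma>. B \<subseteq> V1}, {B\<in>\<sigma>. B \<subseteq> V2}) of (\<sigma>1, \<sigma>2) \<Rightarrow> \<sigma>1 \<union> \<sigma>2) = \<sigma>" using u by auto
    show "(case ({B\<in>\<sigma>. B \<subseteq> V1}, {B\<in>\<sigma>. B \<subseteq> V2}) of (\<sigma>1, \<sigma>2) \<Rightarrow> h (\<sigma>1 \<union> \<sigma>2)) = h \<sigma>" using eq by simp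
    have part: "{B\<in>\<sigma>. B \<subseteq> A} \<in> pairings A" if A: "A = V1 \<or> A = V2" for A
    proof -
      have "\<Union>{B\<in>\<sigma>. B \<subseteq> A} = A"
      proof
        show "A \<subseteq> \<Union>{B\<in>\<sigma>. B \<subseteq> A}"
        proof
          fix x assume x: "x \<in> A"
          then obtain B where B: "B \<in> \<sigma>" "x \<in> B" using pairings_cover[OF sp, of x] A by auto
          then have "B \<subseteq> A" using u[OF B(1)] x A V(3) by auto
          then show "x \<in> \<Union>{B\<in>\<sigma>. B \<subseteq> A}" using B by auto
        qed
      qed auto
      then show ?thesis using sp by (auto simp: pairings_def partition_on_def disjoint_def)
    qed
    then show "({B\<in>\<sigma>. B \<subseteq> V1}, {B\<in>\<sigma>. B \<subseteq> V2}) \<in> pairings V1 \<times> pairings V2" by auto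
  next
    fix p assume "p \<in> pairings V1 \<times> pairings V2"
    then obtain s1 s2 where p: "p = (s1,s2)" and s: "s1 \<in> pairings V1" "s2 \<in> pairings V2" by auto
    have sub: "\<And>B. B \<in> s1 \<Longrightarrow> B \<subseteq> V1 \<and> B \<noteq> {}" "\<And>B. B \<in> s2 \<Longrightarrow> B \<subseteq> V2 \<and> B \<noteq> {}"
      using pairings_subset[OF s(1)] pairings_subset[OF s(2)] ne s by blast+
    have "{B\<in>s1 \<union> s2. B \<subseteq> V1} = s1" "{B\<in>s1 \<union> s2. B \<subseteq> V2} = s2" using sub V(3) by blast+
    then show "({B\<in>(case p of (\<sigma>1, \<sigma>2) \<Rightarrow> \<sigma>1 \<union> \<sigma>2). B \<subseteq> V1}, {B\<in>(case p of (\<sigma>1, \<sigma>2) \<Rightarrow> \<sigma>1 \<union> \<sigma>2). B \<subseteq> V2}) = p"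
      by (simp add: p)
    have "s1 \<union> s2 \<in> pairings (V1 \<union> V2)"
      unfolding pairings_def
    proof (intro CollectI conjI ballI)
      show "partition_on (V1 \<union> V2) (s1 \<union> s2)"
      proof (rule partition_onI)
        show "\<Union>(s1 \<union> s2) = V1 \<union> V2" using s by (simp add: pairings_def partition_on_def)
        show "{} \<notin> s1 \<union> s2" using sub by blast
        show "disjnt a b" if ab: "a \<in> s1 \<union> s2" "b \<in> s1 \<union> s2" "a \<noteq> b" for a b
        proof -
          have 1: "disjnt a b" if "a \<in> s1" "b \<in> s1" using pairings_disjoint[OF s(1) that] ab(3) by (auto simp: disjnt_iff)
          have 2: "disjnt a b" if "a \<in> s2" "b \<in> s2" using pairings_disjoint[OF s(2) that] ab(3) by (auto simp: disjnt_iff)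
          have 3: "disjnt a b" if "a \<in> s1" "b \<in> s2" using sub(1)[OF that(1)] sub(2)[OF that(2)] V(3) by (auto simp: disjnt_iff)
          have 4: "disjnt a b" if "a \<in> s2" "b \<in> s1" using sub(1)[OF that(2)] sub(2)[OF that(1)] V(3) by (auto simp: disjnt_iff)
          show ?thesis using ab(1,2) 1 2 3 4 by blast
        qed
      qed
      show "card B = 2" if "B \<in> s1 \<union> s2" for B using that s by (auto simp: pairings_def)
    qed
    then show "(case p of (\<sigma>1, \<sigma>2) \<Rightarrow> \<sigma>1 \<union> \<sigma>2) \<in> unlinked" using sub by (auto simp: p unlinked_def)
  qed
  then show ?thesis by (simp add: sum.cartesian_product)
qed

text \<open>In Wick's formula for the two cycles together, the unlinked pairings reproduce the
  product of the expectations exactly; every other pairing has a block linking the cycles and falls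
  under \<open>linked_walk_bound\<close>.\<close>

lemma walk_sum_product_moment:
  assumes c: "card (V1 \<union> V2) = 2 * m" and n: "n \<ge> 1"
  shows "\<bar>expectation (\<lambda>\<omega>. walk_sum n V1 (cyc_pred V1) \<omega> * walk_sum n V2 (cyc_pred V2) \<omega>) - expectation (walk_sum n V1 (cyc_pred V1)) * expectation (walk_sum n V2 (cyc_pred V2))\<bar>
    \<le> real (card (pairings (V1 \<union> V2))) * (K ^ m * real n ^ (m + 1))"
proof -
  let ?V = "V1 \<union> V2" let ?q = "cyc_pred2 V1 V2" let ?X = "{0..<int n}" let ?r = "\<lambda>_. 0 :: int"
  let ?h = "\<lambda>\<sigma>. \<Sum>x\<in>PiE ?V (\<lambda>_. ?X). \<Prod>B\<in>\<sigma>. edge_cov ?q ?r x B"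
  have fV: "finite ?V" using V by simp
  have Cq: "edge_cov ?q ?r x B = edge_cov (cyc_pred A) ?r y B" if A: "A = V1 \<or> A = V2" "\<sigma> \<in> pairings A" "B \<in> \<sigma>" and xy: "\<And>v. v \<in> A \<Longrightarrow> x v = y v" for x y A \<sigma> B
  proof -
    obtain a b where ab: "a < b" "B = {a,b}" "a \<in> A" "b \<in> A" using pairings_block[OF A(2,3)] by metis
    have "?q a = cyc_pred A a \<and> ?q a \<in> A" "?q b = cyc_pred A b \<and> ?q b \<in> A" using A(1) cyc_pred2_in ab(3,4) by metis+
    then have "x (?q a) = y (cyc_pred A a)" "x (?q b) = y (cyc_pred A b)" "x a = y a" "x b = y b" using ab(3,4) xy by metis+
    then show ?thesis using ab(1,2) by (simp add: edge_cov_pair)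
  qed
  have h_un: "?h (\<sigma>1 \<union> \<sigma>2) = W n V1 \<sigma>1 ?r * W n V2 \<sigma>2 ?r" if s: "\<sigma>1 \<in> pairings V1" "\<sigma>2 \<in> pairings V2" for \<sigma>1 \<sigma>2
  proof -
    have "B \<noteq> {}" if "B \<in> \<sigma>1" for B using that s by (auto simp: pairings_def)
    then have dis: "\<sigma>1 \<inter> \<sigma>2 = {}" using pairings_subset[OF s(1)] pairings_subset[OF s(2)] V(3) by blast
    have "?h (\<sigma>1 \<union> \<sigma>2) = (\<Sum>x\<in>PiE ?V (\<lambda>_. ?X). (\<Prod>B\<in>\<sigma>1. edge_cov ?q ?r x B) * (\<Prod>B\<in>\<sigma>2. edge_cov ?q ?r x B))"
      using dis s V by (simp add: prod.union_disjoint pairings_finite)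
    also have "\<dots> = (\<Sum>x\<in>PiE ?V (\<lambda>_. ?X). (\<Prod>B\<in>\<sigma>1. edge_cov (cyc_pred V1) ?r x B) * (\<Prod>B\<in>\<sigma>2. edge_cov (cyc_pred V2) ?r x B))"
      using Cq s by (intro sum.cong arg_cong2[of _ _ _ _ "(*)"] prod.cong refl) blast+
    also have "\<dots> = W n V1 \<sigma>1 ?r * W n V2 \<sigma>2 ?r"
      unfolding W_def
    proof (rule sum_PiE_Un)
      show "(\<Prod>B\<in>\<sigma>1. edge_cov (cyc_pred V1) ?r x B) = (\<Prod>B\<in>\<sigma>1. edge_cov (cyc_pred V1) ?r y B)" if "\<And>v. v \<in> V1 \<Longrightarrow> x v = y v" for x y
      proof (intro prod.cong refl)
        fix B assume B: "B \<in> \<sigma>1"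
        have "edge_cov ?q ?r x B = edge_cov (cyc_pred V1) ?r x B" by (rule Cq[OF _ s(1) B]) auto
        moreover have "edge_cov ?q ?r x B = edge_cov (cyc_pred V1) ?r y B" by (rule Cq[OF _ s(1) B]) (use that in auto)
        ultimately show "edge_cov (cyc_pred V1) ?r x B = edge_cov (cyc_pred V1) ?r y B" by simp
      qed
      show "(\<Prod>B\<in>\<sigma>2. edge_cov (cyc_pred V2) ?r x B) = (\<Prod>B\<in>\<sigma>2. edge_cov (cyc_pred V2) ?r y B)" if "\<And>v. v \<in> V2 \<Longrightarrow> x v = y v" for x y
      proof (intro prod.cong refl)
        fix B assume B: "B \<in> \<sigma>2"
        have "edge_cov ?q ?r x B = edge_cov (cyc_pred V2) ?r x B" by (rule Cq[OF _ s(2) B]) auto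
        moreover have "edge_cov ?q ?r x B = edge_cov (cyc_pred V2) ?r y B" by (rule Cq[OF _ s(2) B]) (use that in auto)
        ultimately show "edge_cov (cyc_pred V2) ?r x B = edge_cov (cyc_pred V2) ?r y B" by simp
      qed
    qed
    finally show ?thesis .
  qed
  have sub: "unlinked \<subseteq> pairings ?V" by (auto simp: unlinked_def)
  have fp: "finite (pairings ?V)" using finite_pairings[OF fV] .
  have "expectation (\<lambda>\<omega>. walk_sum n V1 (cyc_pred V1) \<omega> * walk_sum n V2 (cyc_pred V2) \<omega>) = expectation (walk_sum n ?V ?q)"
    by (simp flip: walk_sum_prod)
  also have "\<dots> = (\<Sum>\<sigma>\<in>pairings ?V. ?h \<sigma>)" by (rule walk_sum_expectation[OF fV])
  also have "\<dots> = (\<Sum>\<sigma>\<in>pairings ?V - unlinked. ?h \<sigma>) + (\<Sum>\<sigma>\<in>unlinked. ?h \<sigma>)"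
    by (rule sum.subset_diff[OF sub fp])
  also have "(\<Sum>\<sigma>\<in>unlinked. ?h \<sigma>) = (\<Sum>\<sigma>1\<in>pairings V1. \<Sum>\<sigma>2\<in>pairings V2. W n V1 \<sigma>1 ?r * W n V2 \<sigma>2 ?r)"
    unfolding sum_unlinked by (intro sum.cong refl h_un)
  also have "\<dots> = expectation (walk_sum n V1 (cyc_pred V1)) * expectation (walk_sum n V2 (cyc_pred V2))"
    using V by (simp add: walk_sum_expectation_pr sum_product)
  finally have "\<bar>expectation (\<lambda>\<omega>. walk_sum n V1 (cyc_pred V1) \<omega> * walk_sum n V2 (cyc_pred V2) \<omega>) - expectation (walk_sum n V1 (cyc_pred V1)) * expectation (walk_sum n V2 (cyc_pred V2))\<bar>
    = \<bar>\<Sum>\<sigma>\<in>pairings ?V - unlinked. ?h \<sigma>\<bar>" by simp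
  also have "\<dots> \<le> (\<Sum>\<sigma>\<in>pairings ?V - unlinked. K ^ m * real n ^ (m + 1))"
  proof (rule order_trans[OF sum_abs], rule sum_mono)
    fix \<sigma> assume s: "\<sigma> \<in> pairings ?V - unlinked"
    then obtain B where B: "B \<in> \<sigma>" "\<not> B \<subseteq> V1" "\<not> B \<subseteq> V2" by (auto simp: unlinked_def)
    have sp: "\<sigma> \<in> pairings ?V" using s by simp
    obtain a b where ab: "B = {a,b}" "a \<in> ?V" "b \<in> ?V" using pairings_block[OF sp B(1)] by metis
    have "\<exists>u v. {u,v} \<in> \<sigma> \<and> u \<in> V1 \<and> v \<in> V2"
    proof (cases "a \<in> V1")
      case True then show ?thesis using B ab by blast
    next
      case False
      then have "{b,a} \<in> \<sigma> \<and> b \<in> V1 \<and> a \<in> V2" using B ab by (auto simp: insert_commute)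
      then show ?thesis by blast
    qed
    then obtain u v where uv: "{u,v} \<in> \<sigma>" "u \<in> V1" "v \<in> V2" by blast
    have "\<bar>?h \<sigma>\<bar> \<le> (\<Sum>x\<in>PiE ?V (\<lambda>_. ?X). \<Prod>B\<in>\<sigma>. \<bar>edge_cov ?q ?r x B\<bar>)"
      by (rule order_trans[OF sum_abs]) (simp add: abs_prod)
    also have "\<dots> \<le> K ^ m * real (card ?X) ^ (m + 1)"
    proof -
      have qe: "?q = (\<lambda>l. if l \<in> V1 then cyc_pred V1 l else cyc_pred V2 l)" by (auto simp: cyc_pred2_def)
      show ?thesis unfolding qe using n by (intro linked_walk_bound[OF V c sp _ _ uv]) auto
    qed
    finally show "\<bar>?h \<sigma>\<bar> \<le> K ^ m * real n ^ (m + 1)" by simp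
  qed
  also have "\<dots> \<le> real (card (pairings ?V)) * (K ^ m * real n ^ (m + 1))"
    using card_mono[OF fp, of "pairings ?V - unlinked"] K_pos by (simp add: mult_right_mono)
  finally show ?thesis .
qed

end

lemma cyc_pred_interval: "l \<in> {s+1..s+k} \<Longrightarrow> cyc_pred {s+1..s+k} l = (if l = s + 1 then s + k else l - 1)"
proof -
  assume l: "l \<in> {s+1..s+k}"
  have "{j \<in> {s+1..s+k}. j < l} = {s+1..<l}" using l by auto
  moreover have "Max {s+1..<l} = l - 1" if "l \<noteq> s + 1" using l that by (intro Max_eqI) auto
  moreover have "Max {s+1..s+k} = s + k" using l by (intro Max_eqI) auto
  ultimately show ?thesis using l by (auto simp: cyc_pred_def)
qed

text \<open>A disjoint copy of the step set, by which the square of a trace becomes a walk sum over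
  two cycles.\<close>

lemma walk_sum_shift: "walk_sum n {k+1..k+k} (cyc_pred {k+1..k+k}) \<omega> = walk_sum n {1..k} (cyc_pred {1..k}) \<omega>"
proof -
  let ?V = "{1..k}" let ?U = "{k+1..k+k}" let ?X = "{0..<int n}"
  have p: "cyc_pred ?U (v + k) = cyc_pred ?V v + k" if "v \<in> ?V" for v
    using cyc_pred_interval[of "v + k" k k] cyc_pred_interval[of v 0 k] that by auto
  have pin: "cyc_pred ?V v \<in> ?V" if "v \<in> ?V" for v using cyc_pred_in[OF _ that] by simp
  show ?thesis unfolding walk_sum_def
  proof (rule sum.reindex_bij_witness[of _ "\<lambda>x. restrict (\<lambda>v. x (v - k)) ?U" "\<lambda>x. restrict (\<lambda>v. x (v + k)) ?V"])
    fix x assume x: "x \<in> PiE ?U (\<lambda>_. ?X)"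
    show "restrict (\<lambda>v. restrict (\<lambda>v. x (v + k)) ?V (v - k)) ?U = x"
      using x by (auto simp: fun_eq_iff restrict_def PiE_iff extensional_def)
    show "restrict (\<lambda>v. x (v + k)) ?V \<in> PiE ?V (\<lambda>_. ?X)" using x by (auto simp: PiE_iff)
    have "(\<Prod>v\<in>?U. entry (x (cyc_pred ?U v)) (x v) \<omega>) = (\<Prod>v\<in>?V. entry (x (cyc_pred ?U (v + k))) (x (v + k)) \<omega>)"
      by (rule prod.reindex_bij_witness[of _ "\<lambda>v. v + k" "\<lambda>v. v - k"]) auto
    also have "\<dots> = (\<Prod>v\<in>?V. entry (restrict (\<lambda>v. x (v + k)) ?V (cyc_pred ?V v)) (restrict (\<lambda>v. x (v + k)) ?V v) \<omega>)"
      using p pin by (intro prod.cong refl) simp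
    finally show "(\<Prod>v\<in>?V. entry (restrict (\<lambda>v. x (v + k)) ?V (cyc_pred ?V v)) (restrict (\<lambda>v. x (v + k)) ?V v) \<omega>) = (\<Prod>v\<in>?U. entry (x (cyc_pred ?U v)) (x v) \<omega>)" ..
  next
    fix x assume x: "x \<in> PiE ?V (\<lambda>_. ?X)"
    show "restrict (\<lambda>v. restrict (\<lambda>v. x (v - k)) ?U (v + k)) ?V = x"
      using x by (auto simp: fun_eq_iff restrict_def PiE_iff extensional_def)
    show "restrict (\<lambda>v. x (v - k)) ?U \<in> PiE ?U (\<lambda>_. ?X)"
    proof (rule restrict_PiE_iff[THEN iffD2], rule ballI)
      fix v assume "v \<in> ?U"
      then have "v - k \<in> ?V" by auto
      then show "x (v - k) \<in> ?X" by (rule PiE_mem[OF x])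
    qed
  qed
qed

section \<open>Mean and variance of the traces\<close>

definition trace_power :: "nat \<Rightarrow> nat \<Rightarrow> 'a \<Rightarrow> real" where
  "trace_power n k = walk_sum n {1..k} (cyc_pred {1..k})"

lemma trace_power_measurable[measurable]: "trace_power n k \<in> borel_measurable M" unfolding trace_power_def by measurable

lemma trace_power_integrable: "integrable M (trace_power n k)" "integrable M (\<lambda>\<omega>. (trace_power n k \<omega>)^2)"
proof -
  show "integrable M (trace_power n k)" unfolding trace_power_def by (rule walk_sum_integrable) simp
  have "walk_sum n ({1..k} \<union> {k+1..k+k}) (cyc_pred2 {1..k} {k+1..k+k}) = (\<lambda>\<omega>. (trace_power n k \<omega>)^2)"
  proof
    fix \<omega>
    have "walk_sum n ({1..k} \<union> {k+1..k+k}) (cyc_pred2 {1..k} {k+1..k+k}) \<omega> = walk_sum n {1..k} (cyc_pred {1..k}) \<omega> * walk_sum n {k+1..k+k} (cyc_pred {k+1..k+k}) \<omega>"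
      by (rule walk_sum_prod) auto
    then show "walk_sum n ({1..k} \<union> {k+1..k+k}) (cyc_pred2 {1..k} {k+1..k+k}) \<omega> = (trace_power n k \<omega>)^2"
      by (simp only: trace_power_def walk_sum_shift power2_eq_square)
  qed
  moreover have "integrable M (walk_sum n ({1..k} \<union> {k+1..k+k}) (cyc_pred2 {1..k} {k+1..k+k}))"
    by (rule walk_sum_integrable) auto
  ultimately show "integrable M (\<lambda>\<omega>. (trace_power n k \<omega>)^2)" by (simp only:)
qed

text \<open>The order n^(k + 1) is one below n^(k + 2), the square of the normalisation in
  \<open>trace_power_expectation_tendsto\<close>.\<close>

lemma trace_power_variance_bound:
  assumes n: "n \<ge> 1"
  shows "\<bar>expectation (\<lambda>\<omega>. (trace_power n k \<omega>)^2) - (expectation (trace_power n k))^2\<bar>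
    \<le> real (card (pairings ({1..k} \<union> {k+1..k+k}))) * (K ^ k * real n ^ (k + 1))"
proof -
  have c: "card ({1..k} \<union> {k+1..k+k}) = 2 * k" by (subst card_Un_disjoint) auto
  have s: "walk_sum n {k+1..k+k} (cyc_pred {k+1..k+k}) = trace_power n k" by (rule ext) (simp only: trace_power_def walk_sum_shift)
  have d: "finite {1..k}" "finite {k+1..k+k}" "{1..k} \<inter> {k+1..k+k} = {}" by auto
  show ?thesis using walk_sum_product_moment[OF d c n] by (simp only: s trace_power_def[symmetric] power2_eq_square)
qed

text \<open>The value at k = 0 is the total mass; closed walks account for k \<ge> 1.\<close>

definition limit_moment :: "nat \<Rightarrow> real" where
  "limit_moment k = (if k = 0 then 1 else if odd k then 0 else beta_moment R k)"

lemma beta_moment_eq: "beta_moment R N = (\<Sum>\<sigma>\<in>pairings {1..N}. if noncrossing \<sigma> then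
   \<Sum>\<^sub>\<infinity>k\<in>class_sum_labels {1..N} \<sigma> (\<lambda>_. 0). \<Prod>B\<in>\<sigma>. R (k (Min B)) (k (Max B)) else 0)"
proof -
  have "beta_moment R N = (\<Sum>\<sigma>\<in>NC2 N. \<Sum>\<^sub>\<infinity>k\<in>class_sum_labels {1..N} \<sigma> (\<lambda>_. 0). \<Prod>B\<in>\<sigma>. R (k (Min B)) (k (Max B)))"
    unfolding beta_moment_def by (intro sum.cong refl) (simp add: S_set_eq)
  also have "\<dots> = (\<Sum>\<sigma>\<in>pairings {1..N}. if noncrossing \<sigma> then
   \<Sum>\<^sub>\<infinity>k\<in>class_sum_labels {1..N} \<sigma> (\<lambda>_. 0). \<Prod>B\<in>\<sigma>. R (k (Min B)) (k (Max B)) else 0)"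
    unfolding NC2_eq by (rule sum.inter_filter) (rule finite_pairings, simp)
  finally show ?thesis .
qed

lemma trace_power_expectation_tendsto:
  assumes k: "k \<ge> 1"
  shows "(\<lambda>n. expectation (trace_power n k) / (real n * sqrt (real n) ^ k)) \<longlonglongrightarrow> limit_moment k"
proof (cases "even k")
  case True
  then obtain m where m: "k = 2 * m" by (elim evenE)
  have m1: "m \<ge> 1" using k m by simp
  have "expectation (trace_power n k) / (real n * sqrt (real n) ^ k) = (\<Sum>\<sigma>\<in>pairings {1..k}. W n {1..k} \<sigma> (\<lambda>_. 0) / real n ^ (m + 1))" for n
    unfolding trace_power_def by (subst walk_sum_expectation_pr) (auto simp: m power_mult sum_divide_distrib)
  moreover have "(\<lambda>n. \<Sum>\<sigma>\<in>pairings {1..k}. W n {1..k} \<sigma> (\<lambda>_. 0) / real n ^ (m + 1)) \<longlonglongrightarrow> beta_moment R k"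
    unfolding beta_moment_eq by (intro tendsto_sum W_tendsto) (use m m1 in auto)
  moreover have "limit_moment k = beta_moment R k" using k True by (simp add: limit_moment_def)
  ultimately show ?thesis by (simp only:)
next
  case False
  have "pairings {1..k} = {}"
  proof (rule ccontr)
    assume "pairings {1..k} \<noteq> {}"
    then obtain \<sigma> where "\<sigma> \<in> pairings {1..k}" by blast
    from pairings_card[OF this] False show False by simp
  qed
  then have "expectation (trace_power n k) = 0" for n unfolding trace_power_def by (subst walk_sum_expectation_pr) auto
  then show ?thesis using False k by (simp add: limit_moment_def)
qed

text \<open>At most 2^(2m) non-crossing pairings, each with a series of absolute value at most S^m
  \<le> K^m. This is the origin of 2 sqrt K, which also bounds the support of the limit law.\<close>

lemma limit_moment_bound:
  assumes m: "m \<ge> 1"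
  shows "limit_moment (2 * m) \<le> (2 * sqrt K) ^ (2 * m)"
proof -
  let ?f = "\<lambda>\<sigma>. \<Sum>\<^sub>\<infinity>k\<in>class_sum_labels {1..2*m} \<sigma> (\<lambda>_. 0). \<Prod>B\<in>\<sigma>. R (k (Min B)) (k (Max B))"
  have le: "?f \<sigma> \<le> K ^ m" if s: "\<sigma> \<in> NC2 (2*m)" for \<sigma>
  proof -
    have sp: "\<sigma> \<in> pairings {1..2*m}" "noncrossing \<sigma>" using s by (auto simp: NC2_eq)
    have V: "finite {1..2*m}" "{1..2*m} \<noteq> {}" using m by auto
    have c: "card \<sigma> = m" using pairings_card[OF sp(1)] by simp
    note a = class_sum_labels_abs_summable[OF V sp, of "\<lambda>_. 0"]
    have "norm (?f \<sigma>) \<le> (\<Sum>\<^sub>\<infinity>k\<in>class_sum_labels {1..2*m} \<sigma> (\<lambda>_. 0). norm (\<Prod>B\<in>\<sigma>. R (k (Min B)) (k (Max B))))"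
      using a by (intro norm_infsum_bound) (simp add: abs_prod)
    also have "\<dots> \<le> S ^ m" using a c by (simp add: abs_prod)
    also have "\<dots> \<le> K ^ m" using K_ge S_nonneg by (intro power_mono) auto
    finally show ?thesis by simp
  qed
  have "limit_moment (2*m) = (\<Sum>\<sigma>\<in>NC2 (2*m). ?f \<sigma>)"
    using m by (simp add: limit_moment_def beta_moment_def S_set_eq cong: sum.cong)
  also have "\<dots> \<le> (\<Sum>\<sigma>\<in>NC2 (2*m). K ^ m)" by (intro sum_mono le)
  also have "\<dots> = real (card (NC2 (2*m))) * K ^ m" by simp
  also have "\<dots> \<le> 2 ^ (2*m) * K ^ m"
    using card_NC2_le[of "2*m"] K_pos by (intro mult_right_mono) (auto simp flip: of_nat_le_iff)
  also have "\<dots> = (2 * sqrt K) ^ (2 * m)" using K_pos by (simp add: power_mult power_mult_distrib)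
  finally show ?thesis .
qed

section \<open>The empirical spectral measure\<close>

definition ESD :: "nat \<Rightarrow> 'a \<Rightarrow> real measure" where
  "ESD n \<omega> = scaled_esd n (sym_field_matrix (\<lambda>i j. Z i j \<omega>) n)"

lemma eigenvalue_power_sum:
  assumes k: "k \<ge> 1"
  shows "(\<Sum>i<n. (eigenvalue_list (sym_field_matrix (\<lambda>i j. Z i j \<omega>) n) ! i) ^ k) = trace_power n k \<omega>"
proof -
  let ?A = "sym_field_matrix (\<lambda>i j. Z i j \<omega>) n"
  have A: "?A \<in> carrier_mat n n" by (simp add: sym_field_matrix_def)
  have ent: "?A $$ (i,j) = entry (int i) (int j) \<omega>" if "i < n" "j < n" for i j
    using that by (simp add: sym_field_matrix_def entry_def)
  have "(\<Sum>i<n. (eigenvalue_list ?A ! i) ^ k) = mat_trace (?A ^\<^sub>m k)"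
    by (rule symmetric_eigenvalue_list(2)[OF A]) (simp add: ent entry_def min.commute max.commute)
  also have "\<dots> = (\<Sum>x\<in>PiE {1..k} (\<lambda>_. {..<n}). \<Prod>v\<in>{1..k}. ?A $$ (x (if v = 1 then k else v - 1), x v))"
    by (rule trace_pow_walks[OF A k])
  also have "\<dots> = (\<Sum>x\<in>PiE {1..k} (\<lambda>_. {..<n}). \<Prod>v\<in>{1..k}. entry (int (x (cyc_pred {1..k} v))) (int (x v)) \<omega>)"
  proof (intro sum.cong prod.cong refl)
    fix x v assume x: "x \<in> PiE {1..k} (\<lambda>_. {..<n})" and v: "v \<in> {1..k}"
    have "cyc_pred {1..k} v = (if v = 1 then k else v - 1)" using cyc_pred_interval[of v 0 k] v by auto
    moreover have "cyc_pred {1..k} v \<in> {1..k}" using cyc_pred_in[OF _ v] by simp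
    ultimately show "?A $$ (x (if v = 1 then k else v - 1), x v) = entry (int (x (cyc_pred {1..k} v))) (int (x v)) \<omega>"
      using x v ent by (simp add: PiE_iff)
  qed
  also have "\<dots> = trace_power n k \<omega>" unfolding trace_power_def walk_sum_def
  proof (rule sum.reindex_bij_witness[of _ "\<lambda>x. restrict (\<lambda>v. nat (x v)) {1..k}" "\<lambda>x. restrict (\<lambda>v. int (x v)) {1..k}"])
    fix x :: "nat \<Rightarrow> nat" assume x: "x \<in> PiE {1..k} (\<lambda>_. {..<n})"
    show "restrict (\<lambda>v. nat (restrict (\<lambda>v. int (x v)) {1..k} v)) {1..k} = x"
      using x by (auto simp: fun_eq_iff restrict_def PiE_iff extensional_def)
    show "restrict (\<lambda>v. int (x v)) {1..k} \<in> PiE {1..k} (\<lambda>_. {0..<int n})" using x by (auto simp: PiE_iff)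
    show "(\<Prod>v\<in>{1..k}. entry (restrict (\<lambda>v. int (x v)) {1..k} (cyc_pred {1..k} v)) (restrict (\<lambda>v. int (x v)) {1..k} v) \<omega>)
       = (\<Prod>v\<in>{1..k}. entry (int (x (cyc_pred {1..k} v))) (int (x v)) \<omega>)"
      using cyc_pred_in[of "{1..k}"] by (intro prod.cong refl) simp
  next
    fix x :: "nat \<Rightarrow> int" assume x: "x \<in> PiE {1..k} (\<lambda>_. {0..<int n})"
    show "restrict (\<lambda>v. int (restrict (\<lambda>v. nat (x v)) {1..k} v)) {1..k} = x"
      using x by (auto simp: fun_eq_iff restrict_def PiE_iff extensional_def)
    show "restrict (\<lambda>v. nat (x v)) {1..k} \<in> PiE {1..k} (\<lambda>_. {..<n})" using x by (auto simp: PiE_iff)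
  qed
  finally show ?thesis .
qed

definition eig :: "nat \<Rightarrow> 'a \<Rightarrow> nat \<Rightarrow> real" where
  "eig n \<omega> i = eigenvalue_list (sym_field_matrix (\<lambda>i j. Z i j \<omega>) n) ! i / sqrt (real n)"

lemma ESD_eq: "ESD n \<omega> = distr (uniform_count_measure {..<n}) borel (eig n \<omega>)"
  by (simp add: ESD_def scaled_esd_def eig_def[abs_def])

lemma eig_power_sum: "k \<ge> 1 \<Longrightarrow> (\<Sum>i<n. eig n \<omega> i ^ k) = trace_power n k \<omega> / sqrt (real n) ^ k"
  unfolding eig_def by (simp add: power_divide sum_divide_distrib[symmetric] eigenvalue_power_sum)

lemma ESD_integral:
  assumes n: "n \<ge> 1" and [measurable]: "f \<in> borel_measurable borel"
  shows "integrable (ESD n \<omega>) f" "integral\<^sup>L (ESD n \<omega>) f = (\<Sum>i<n. f (eig n \<omega> i)) / real n"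
proof -
  have "integrable (uniform_count_measure {..<n}) (\<lambda>i. f (eig n \<omega> i))"
    unfolding uniform_count_measure_def by (intro integrable_point_measure_finite) auto
  then show "integrable (ESD n \<omega>) f"
    unfolding ESD_eq by (subst integrable_distr_eq) auto
  show "integral\<^sup>L (ESD n \<omega>) f = (\<Sum>i<n. f (eig n \<omega> i)) / real n"
    unfolding ESD_eq by (subst integral_distr) (auto simp: integral_uniform_count_measure)
qed

lemma ESD_all_moments: "n \<ge> 1 \<Longrightarrow> all_moments (ESD n \<omega>)"
proof -
  assume n: "n \<ge> 1"
  interpret u: prob_space "uniform_count_measure {..<n}"
    using n by (intro prob_space_uniform_count_measure) (auto simp: lessThan_empty_iff)
  have "real_distribution (ESD n \<omega>)" unfolding ESD_eq by (rule u.real_distribution_distr) simp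
  moreover have "integrable (ESD n \<omega>) (\<lambda>x. x ^ k)" for k by (rule ESD_integral(1)[OF n]) measurable
  ultimately show ?thesis unfolding all_moments_def by blast
qed

lemma ESD_moment: "n \<ge> 1 \<Longrightarrow> k \<ge> 1 \<Longrightarrow> moment (ESD n \<omega>) k = trace_power n k \<omega> / (real n * sqrt (real n) ^ k)"
  by (subst ESD_integral(2)) (auto simp: eig_power_sum)

lemma ESD_moment_0: "n \<ge> 1 \<Longrightarrow> moment (ESD n \<omega>) 0 = 1"
  by (subst ESD_integral(2)) auto

lemma ESD_cdf: "n \<ge> 1 \<Longrightarrow> cdf (ESD n \<omega>) t = (\<Sum>i<n. indicator {..t} (eig n \<omega> i)) / real n"
proof -
  assume n: "n \<ge> 1"
  interpret e: real_distribution "ESD n \<omega>" using ESD_all_moments[OF n] by (simp add: all_moments_def)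
  have "cdf (ESD n \<omega>) t = (\<integral>x. indicator {..t} x \<partial>ESD n \<omega>)" by (simp add: cdf_def)
  also have "\<dots> = (\<Sum>i<n. indicator {..t} (eig n \<omega> i)) / real n" by (rule ESD_integral(2)[OF n]) simp
  finally show ?thesis .
qed

text \<open>The power sums of the eigenvalues are traces, hence polynomials in the entries; from
  them the counting function inherits measurability.\<close>

lemma ESD_cdf_measurable: "n \<ge> 1 \<Longrightarrow> (\<lambda>\<omega>. cdf (ESD n \<omega>) t) \<in> borel_measurable M"
proof -
  assume n: "n \<ge> 1"
  have "(\<lambda>\<omega>. \<Sum>i<n. eig n \<omega> i ^ k) \<in> borel_measurable M" for k
    by (cases "k = 0") (simp_all add: eig_power_sum)
  then have "(\<lambda>\<omega>. \<Sum>i<n. indicator {..t} (eig n \<omega> i) :: real) \<in> borel_measurable M"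
    by (rule borel_measurable_sum_of_power_sums)
  then show ?thesis using n by (simp add: ESD_cdf)
qed

lemma levy_ESD_measurable:
  assumes rd: "real_distribution \<mu>"
  shows "(\<lambda>\<omega>. levy_dist (ESD n \<omega>) \<mu>) \<in> borel_measurable M"
proof (cases "n \<ge> 1")
  case True
  interpret e: real_distribution "ESD n \<omega>" for \<omega> using ESD_all_moments[OF True] by (simp add: all_moments_def)
  show ?thesis
    by (rule borel_measurable_levy_dist[OF _ _ rd ESD_cdf_measurable[OF True]])
      (auto simp: e.cdf_bounded_prob e.finite_borel_measure_M)
next
  case False
  \<comment> \<open>Measurability is demanded for n = 0 as well. There the index set is empty and
    the measure is the same for all outcomes.\<close>
  then have "ESD n \<omega> = ESD n \<omega>'" for \<omega> \<omega>'
    unfolding ESD_eq by (intro distr_cong) (auto simp: space_uniform_count_measure)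
  then have "(\<lambda>\<omega>. levy_dist (ESD n \<omega>) \<mu>) = (\<lambda>\<omega>. levy_dist (ESD n undefined) \<mu>)" by metis
  then show ?thesis by simp
qed

lemma moment_measurable: "n \<ge> 1 \<Longrightarrow> (\<lambda>\<omega>. moment (ESD n \<omega>) k) \<in> borel_measurable M"
  by (cases "k = 0") (simp_all only: ESD_moment_0 ESD_moment, simp_all add: ESD_moment)

text \<open>Chebyshev's inequality around the limit instead of the mean: the second moment of the
  deviation is the variance, at most Q / n, plus the squared bias, which tends to 0.\<close>

lemma moment_in_prob:
  assumes \<delta>: "\<delta> > 0"
  shows "(\<lambda>n. measure M {\<omega>\<in>space M. \<bar>moment (ESD n \<omega>) k - limit_moment k\<bar> \<ge> \<delta>}) \<longlonglongrightarrow> 0"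
proof (cases "k = 0")
  case True
  have "\<forall>\<^sub>F n in sequentially. measure M {\<omega>\<in>space M. \<bar>moment (ESD n \<omega>) k - limit_moment k\<bar> \<ge> \<delta>} = 0"
    using eventually_ge_at_top[of 1]
  proof eventually_elim
    case (elim n)
    have "{\<omega>\<in>space M. \<bar>moment (ESD n \<omega>) k - limit_moment k\<bar> \<ge> \<delta>} = {}"
      using \<delta> ESD_moment_0[OF elim] True by (auto simp: limit_moment_def simp del: power_0)
    then show ?case by (simp only: measure_empty)
  qed
  then show ?thesis by (rule tendsto_eventually)
next
  case False
  then have k: "k \<ge> 1" by simp
  define s where "s n = real n * sqrt (real n) ^ k" for n
  define a where "a n = expectation (trace_power n k) / s n" for n
  define Q where "Q = real (card (pairings ({1..k} \<union> {k+1..k+k}))) * K ^ k"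
  let ?b = "limit_moment k"
  have Q: "Q \<ge> 0" using K_pos by (simp add: Q_def)
  have al: "a \<longlonglongrightarrow> ?b" unfolding a_def s_def by (rule trace_power_expectation_tendsto[OF k])
  have bound: "measure M {\<omega>\<in>space M. \<bar>moment (ESD n \<omega>) k - ?b\<bar> \<ge> \<delta>} \<le> (Q / real n + (a n - ?b)^2) / \<delta>^2" if n: "n \<ge> 1" for n
  proof -
    have s: "s n > 0" using n by (simp add: s_def)
    \<comment> \<open>Divided by this power, the variance bound of order n^(k + 1) becomes Q /
      n.\<close>
    have s2: "s n ^ 2 = real n ^ (k + 2)" using n
      by (simp add: s_def power_mult_distrib power2_eq_square power_add mult_ac flip: power_mult_distrib)
    let ?m = "\<lambda>\<omega>. trace_power n k \<omega> / s n"
    have mm: "moment (ESD n \<omega>) k = ?m \<omega>" for \<omega> using ESD_moment[OF n k] by (simp add: s_def)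
    let ?E = "{\<omega>\<in>space M. \<bar>?m \<omega> - ?b\<bar> \<ge> \<delta>}"
    have [measurable]: "?E \<in> sets M" by measurable
    have i1: "integrable M ?m" "integrable M (\<lambda>\<omega>. (?m \<omega>)^2)" using trace_power_integrable[of n k] by (auto simp: power_divide)
    have i2: "integrable M (\<lambda>\<omega>. (?m \<omega> - ?b)^2)"
    proof -
      have e: "(\<lambda>\<omega>. (?m \<omega> - ?b)^2) = (\<lambda>\<omega>. (?m \<omega>)^2 + ?b^2 - (2 * ?b) * ?m \<omega>)" by (simp add: power2_diff mult_ac)
      show ?thesis unfolding e
        by (intro Bochner_Integration.integrable_add Bochner_Integration.integrable_diff integrable_mult_right integrable_const i1)
    qed
    have "measure M ?E = (\<integral>\<omega>. indicator ?E \<omega> \<partial>M)" by simp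
    also have "\<dots> \<le> (\<integral>\<omega>. (?m \<omega> - ?b)^2 / \<delta>^2 \<partial>M)"
    proof (rule integral_mono)
      show "integrable M (indicator ?E :: 'a \<Rightarrow> real)" by (intro integrable_const_bound[of _ 1]) auto
      show "integrable M (\<lambda>\<omega>. (?m \<omega> - ?b)^2 / \<delta>^2)" using i2 by simp
      fix \<omega> assume "\<omega> \<in> space M"
      show "indicator ?E \<omega> \<le> (?m \<omega> - ?b)^2 / \<delta>^2"
      proof (cases "\<omega> \<in> ?E")
        case True
        then have "\<bar>\<delta>\<bar> \<le> \<bar>?m \<omega> - ?b\<bar>" using \<delta> by simp
        then have "\<delta>^2 \<le> (?m \<omega> - ?b)^2" by (simp only: abs_le_square_iff)
        moreover have "0 < \<delta>^2" using \<delta> by simp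
        ultimately show ?thesis using True by (simp only: le_divide_eq_1_pos indicator_simps)
      qed simp
    qed
    also have "\<dots> = expectation (\<lambda>\<omega>. (?m \<omega> - ?b)^2) / \<delta>^2" by simp
    also have "expectation (\<lambda>\<omega>. (?m \<omega> - ?b)^2) = expectation (\<lambda>\<omega>. (?m \<omega>)^2) - 2 * ?b * a n + ?b^2"
    proof -
      have "expectation (\<lambda>\<omega>. (?m \<omega> - ?b)^2) = expectation (\<lambda>\<omega>. (?m \<omega>)^2 - (2 * ?b) * ?m \<omega> + ?b^2)"
        by (intro Bochner_Integration.integral_cong refl) (simp add: power2_diff)
      also have "\<dots> = expectation (\<lambda>\<omega>. (?m \<omega>)^2 - (2 * ?b) * ?m \<omega>) + expectation (\<lambda>_. ?b^2)"
        by (rule Bochner_Integration.integral_add)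
          (intro Bochner_Integration.integrable_diff integrable_mult_right integrable_const i1)+
      also have "expectation (\<lambda>\<omega>. (?m \<omega>)^2 - (2 * ?b) * ?m \<omega>) = expectation (\<lambda>\<omega>. (?m \<omega>)^2) - expectation (\<lambda>\<omega>. (2 * ?b) * ?m \<omega>)"
        by (rule Bochner_Integration.integral_diff) (intro integrable_mult_right i1)+
      also have "expectation (\<lambda>\<omega>. (2 * ?b) * ?m \<omega>) = 2 * ?b * a n" by (simp add: a_def)
      finally show ?thesis by (simp add: prob_space)
    qed
    also have "\<dots> = (expectation (\<lambda>\<omega>. (?m \<omega>)^2) - (a n)^2) + (a n - ?b)^2" by (simp add: power2_diff)
    also have "expectation (\<lambda>\<omega>. (?m \<omega>)^2) - (a n)^2 = (expectation (\<lambda>\<omega>. (trace_power n k \<omega>)^2) - (expectation (trace_power n k))^2) / s n ^ 2"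
      by (simp add: a_def power_divide diff_divide_distrib)
    also have "\<dots> \<le> (Q * real n ^ (k + 1)) / s n ^ 2"
      using trace_power_variance_bound[OF n, of k] unfolding Q_def by (intro divide_right_mono) (auto simp: mult_ac abs_le_iff)
    also have "\<dots> = Q / real n" unfolding s2 using n by (simp add: power_add)
    finally show ?thesis using \<delta> by (simp add: mm divide_right_mono)
  qed
  have "(\<lambda>n. (Q / real n + (a n - ?b)^2) / \<delta>^2) \<longlonglongrightarrow> (0 + (?b - ?b)^2) / \<delta>^2"
    using \<delta> by (intro tendsto_intros al lim_const_over_n) auto
  then have lim: "(\<lambda>n. (Q / real n + (a n - ?b)^2) / \<delta>^2) \<longlonglongrightarrow> 0" by simp
  show ?thesis
  proof (rule Lim_null_comparison[OF _ lim])
    show "\<forall>\<^sub>F n in sequentially. norm (measure M {\<omega>\<in>space M. \<bar>moment (ESD n \<omega>) k - ?b\<bar> \<ge> \<delta>}) \<le> (Q / real n + (a n - ?b)^2) / \<delta>^2"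
      using eventually_ge_at_top[of 1] by eventually_elim (use bound in simp)
  qed
qed

section \<open>Existence of the limit law and convergence in probability\<close>

definition bad :: "nat \<Rightarrow> nat \<Rightarrow> real \<Rightarrow> 'a set" where
  "bad J n \<delta> = (\<Union>k\<le>J. {\<omega>\<in>space M. \<bar>moment (ESD n \<omega>) k - limit_moment k\<bar> \<ge> \<delta>})"

lemma bad_sets: "n \<ge> 1 \<Longrightarrow> bad J n \<delta> \<in> sets M"
  unfolding bad_def using moment_measurable by measurable

lemma bad_tendsto: 
  assumes "\<delta> > 0" shows "(\<lambda>n. measure M (bad J n \<delta>)) \<longlonglongrightarrow> 0"
proof (rule Lim_null_comparison)
  show "(\<lambda>n. \<Sum>k\<le>J. measure M {\<omega>\<in>space M. \<bar>moment (ESD n \<omega>) k - limit_moment k\<bar> \<ge> \<delta>}) \<longlonglongrightarrow> 0"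
    by (intro tendsto_null_sum moment_in_prob assms)
  show "\<forall>\<^sub>F n in sequentially. norm (measure M (bad J n \<delta>)) \<le> (\<Sum>k\<le>J. measure M {\<omega>\<in>space M. \<bar>moment (ESD n \<omega>) k - limit_moment k\<bar> \<ge> \<delta>})"
    using eventually_ge_at_top[of 1]
  proof eventually_elim
    case (elim n)
    have "{\<omega>\<in>space M. \<bar>moment (ESD n \<omega>) k - limit_moment k\<bar> \<ge> \<delta>} \<in> sets M" for k
      using moment_measurable[OF elim, of k] by measurable
    then show ?case unfolding bad_def by (simp add: finite_measure_subadditive_finite image_subset_iff)
  qed
qed

text \<open>For each j the exceptional event has probability below 1 for some n, so some outcome has
  its first moments within 1/(j + 1) of the limits. These spectral measures form a deterministic
  sequence to which \<open>exists_limit_moments\<close> applies.\<close>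

lemma exists_limit: "\<exists>\<mu>. all_moments \<mu> \<and> (\<forall>k. moment \<mu> k = limit_moment k)"
proof -
  have "\<forall>j. \<exists>n \<omega>. n \<ge> 1 \<and> (\<forall>k\<le>j. \<bar>moment (ESD n \<omega>) k - limit_moment k\<bar> < 1 / Suc j)"
  proof
    fix j
    have "\<forall>\<^sub>F n in sequentially. measure M (bad j n (1 / Suc j)) < 1"
      by (intro order_tendstoD(2)[OF bad_tendsto]) auto
    then have "\<forall>\<^sub>F n in sequentially. measure M (bad j n (1 / Suc j)) < 1 \<and> n \<ge> 1"
      by (intro eventually_conj eventually_ge_at_top)
    then obtain n where n: "measure M (bad j n (1 / Suc j)) < 1" "n \<ge> 1" by (auto simp: eventually_sequentially)
    have "\<not> space M \<subseteq> bad j n (1 / Suc j)"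
    proof
      assume "space M \<subseteq> bad j n (1 / Suc j)"
      then have "measure M (space M) \<le> measure M (bad j n (1 / Suc j))"
        by (intro finite_measure_mono bad_sets n)
      then show False using n(1) prob_space by simp
    qed
    then obtain \<omega> where "\<omega> \<in> space M" "\<omega> \<notin> bad j n (1 / Suc j)" by blast
    then show "\<exists>n \<omega>. n \<ge> 1 \<and> (\<forall>k\<le>j. \<bar>moment (ESD n \<omega>) k - limit_moment k\<bar> < 1 / Suc j)"
      using n(2) unfolding bad_def by (intro exI[of _ n] exI[of _ \<omega>]) (auto simp: not_le)
  qed
  then obtain n \<omega> where n: "\<And>j. n j \<ge> 1" and c: "\<And>j k. k \<le> j \<Longrightarrow> \<bar>moment (ESD (n j) (\<omega> j)) k - limit_moment k\<bar> < 1 / Suc j"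
    by metis
  show ?thesis
  proof (rule exists_limit_moments[of "\<lambda>j. ESD (n j) (\<omega> j)" limit_moment "2 * sqrt K"])
    show "all_moments (ESD (n j) (\<omega> j))" for j by (rule ESD_all_moments[OF n])
    show "limit_moment (2 * m) \<le> (2 * sqrt K) ^ (2 * m)" if "m \<ge> 1" for m by (rule limit_moment_bound[OF that])
    show "0 < 2 * sqrt K" using K_pos by simp
    show "(\<lambda>j. moment (ESD (n j) (\<omega> j)) k) \<longlonglongrightarrow> limit_moment k" for k
    proof (rule LIM_zero_cancel, rule Lim_null_comparison)
      show "(\<lambda>j. 1 / real (Suc j)) \<longlonglongrightarrow> 0" by (rule LIMSEQ_Suc[OF lim_inverse_n'])
      show "\<forall>\<^sub>F j in sequentially. norm (moment (ESD (n j) (\<omega> j)) k - limit_moment k) \<le> 1 / real (Suc j)"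
        using eventually_ge_at_top[of k] by eventually_elim (use c in \<open>auto simp: less_imp_le\<close>)
    qed
  qed
qed

text \<open>Outside \<open>bad J n \<delta>\<close> the moments up to order J are within \<delta> of
  the limits, which forces the Levy distance below \<epsilon>.\<close>

theorem ESD_converges:
  assumes am: "all_moments \<mu>" and mu: "\<And>k. moment \<mu> k = limit_moment k"
  shows "weakly_in_prob M ESD \<mu>"
  unfolding weakly_in_prob_def tends_in_prob_def
proof (intro conjI allI impI)
  have rd: "real_distribution \<mu>" using am by (simp add: all_moments_def)
  show "(\<lambda>\<omega>. levy_dist (ESD n \<omega>) \<mu>) \<in> borel_measurable M" for n by (rule levy_ESD_measurable[OF rd])
  fix \<epsilon> :: real assume e: "\<epsilon> > 0"
  have bd: "moment \<mu> (2*m) \<le> (2 * sqrt K) ^ (2*m)" if "m \<ge> 1" for m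
    unfolding mu by (rule limit_moment_bound[OF that])
  obtain J \<delta> where \<delta>: "\<delta> > 0" and J: "\<And>\<nu>. all_moments \<nu> \<Longrightarrow> (\<forall>k\<le>J. \<bar>moment \<nu> k - limit_moment k\<bar> < \<delta>) \<Longrightarrow> levy_dist \<nu> \<mu> \<le> \<epsilon>"
    using moments_close_imp_levy_close[OF am bd _ e] K_pos unfolding mu by auto
  show "(\<lambda>n. measure M {\<omega>\<in>space M. \<bar>levy_dist (ESD n \<omega>) \<mu> - 0\<bar> > \<epsilon>}) \<longlonglongrightarrow> 0"
  proof (rule Lim_null_comparison[OF _ bad_tendsto[OF \<delta>, of J]])
    show "\<forall>\<^sub>F n in sequentially. norm (measure M {\<omega>\<in>space M. \<bar>levy_dist (ESD n \<omega>) \<mu> - 0\<bar> > \<epsilon>}) \<le> measure M (bad J n \<delta>)"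
      using eventually_ge_at_top[of 1]
    proof eventually_elim
      case (elim n)
      interpret e: real_distribution "ESD n \<omega>" for \<omega> using ESD_all_moments[OF elim] by (simp add: all_moments_def)
      have "{\<omega>\<in>space M. \<bar>levy_dist (ESD n \<omega>) \<mu> - 0\<bar> > \<epsilon>} \<subseteq> bad J n \<delta>"
      proof
        fix \<omega> assume w: "\<omega> \<in> {\<omega>\<in>space M. \<bar>levy_dist (ESD n \<omega>) \<mu> - 0\<bar> > \<epsilon>}"
        have "levy_dist (ESD n \<omega>) \<mu> \<ge> 0" by (rule levy_dist_nonneg[OF e.cdf_bounded_prob rd])
        then have "\<not> levy_dist (ESD n \<omega>) \<mu> \<le> \<epsilon>" using w by simp
        then have "\<not> (\<forall>k\<le>J. \<bar>moment (ESD n \<omega>) k - limit_moment k\<bar> < \<delta>)" using J[OF ESD_all_moments[OF elim]] by blast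
        then show "\<omega> \<in> bad J n \<delta>" using w by (auto simp: bad_def not_less)
      qed
      then show ?case by (simp add: finite_measure_mono bad_sets[OF elim])
    qed
  qed
qed

end

text \<open>The product of the coordinates (0, 0) and (k - i, l - j) is a measurable functional of
  the whole field; evaluate it on the field shifted by (i, j).\<close>

lemma covariance_of_stationary:
  assumes "prob_space M" and [measurable]: "\<And>i j. Z i j \<in> borel_measurable M" and st: "stationary_field M Z"
  shows "prob_space.expectation M (\<lambda>\<omega>. Z i j \<omega> * Z k l \<omega>) = prob_space.expectation M (\<lambda>\<omega>. Z 0 0 \<omega> * Z (k - i) (l - j) \<omega> :: real)"
proof -
  interpret prob_space M by fact
  let ?N = "PiM (UNIV :: (int \<times> int) set) (\<lambda>_. borel :: real measure)"
  let ?g = "\<lambda>f :: int \<times> int \<Rightarrow> real. f (0, 0) * f (k - i, l - j)"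
  have g[measurable]: "?g \<in> borel_measurable ?N" by measurable
  have m: "(\<lambda>\<omega> (p, q). Z (p + a) (q + b) \<omega>) \<in> measurable M ?N" for a b
    by (rule measurable_PiM_single') (auto simp: case_prod_unfold)
  have "expectation (\<lambda>\<omega>. ?g (\<lambda>(p, q). Z (p + a) (q + b) \<omega>)) = integral\<^sup>L (distr M ?N (\<lambda>\<omega> (p, q). Z (p + a) (q + b) \<omega>)) ?g" for a b
    by (rule integral_distr[OF m g, symmetric])
  moreover have "distr M ?N (\<lambda>\<omega> (p, q). Z (p + i) (q + j) \<omega>) = distr M ?N (\<lambda>\<omega> (p, q). Z (p + 0) (q + 0) \<omega>)"
    using st unfolding stationary_field_def by simp
  ultimately have "expectation (\<lambda>\<omega>. ?g (\<lambda>(p, q). Z (p + i) (q + j) \<omega>)) = expectation (\<lambda>\<omega>. ?g (\<lambda>(p, q). Z (p + 0) (q + 0) \<omega>))"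
    by metis
  then show ?thesis by simp
qed

theorem theorem2p1:
  fixes M :: "'a measure"
    and Z :: "int \<Rightarrow> int \<Rightarrow> 'a \<Rightarrow> real"
    and R :: "int \<Rightarrow> int \<Rightarrow> real"
  assumes "prob_space M"
    and "gaussian_process M (\<lambda>(i, j). Z i j)"
    and "stationary_field M Z"
    and "\<And>i j. prob_space.expectation M (Z i j) = 0"
    and "\<And>i j. prob_space.variance M (Z i j) = 1"
    and "\<And>u v. R u v = prob_space.expectation M (\<lambda>\<omega>. Z 0 0 \<omega> * Z (- u) v \<omega>)"
    and "\<And>u v. R u v = R v u"
    and "(\<lambda>(u, v). \<bar>R u v\<bar>) summable_on UNIV"
  shows "\<exists>\<mu>. real_distribution \<mu> \<and>
     weakly_in_prob M (\<lambda>n \<omega>. scaled_esd n (sym_field_matrix (\<lambda>i j. Z i j \<omega>) n)) \<mu> \<and>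
     (\<forall>k. integrable \<mu> (\<lambda>x. x ^ k)) \<and>
     (\<forall>k. odd k \<longrightarrow> (\<integral>x. x ^ k \<partial>\<mu>) = 0) \<and>
     (\<forall>m\<ge>1. (\<integral>x. x ^ (2 * m) \<partial>\<mu>) = beta_moment R (2 * m)) \<and>
     (\<forall>\<nu>. real_distribution \<nu> \<and>
        (\<forall>k. integrable \<nu> (\<lambda>x. x ^ k) \<and> (\<integral>x. x ^ k \<partial>\<nu>) = (\<integral>x. x ^ k \<partial>\<mu>)) \<longrightarrow> \<nu> = \<mu>)"
proof -
  interpret prob_space M by fact
  have Zm: "Z i j \<in> borel_measurable M" for i j
  proof -
    have "\<And>p. (\<lambda>(i, j). Z i j) p \<in> borel_measurable M" using assms(2) unfolding gaussian_process_def by blast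
    from this[of "(i, j)"] show ?thesis by simp
  qed
  interpret gaussian_field M Z R
  proof
    show "expectation (\<lambda>\<omega>. Z i j \<omega> * Z k l \<omega>) = R (i - k) (l - j)" for i j k l
      using covariance_of_stationary[OF assms(1) Zm assms(3), of i j k l] assms(6)[of "i - k" "l - j"] by simp
  qed (use assms in auto)
  obtain \<mu> where am: "all_moments \<mu>" and mu: "\<And>k. moment \<mu> k = limit_moment k" using exists_limit by blast
  have bd: "moment \<mu> (2*m) \<le> (2 * sqrt K) ^ (2*m)" if "m \<ge> 1" for m
    unfolding mu by (rule limit_moment_bound[OF that])
  show ?thesis
  proof (intro exI[of _ \<mu>] conjI allI impI)
    show "real_distribution \<mu>" "\<And>k. integrable \<mu> (\<lambda>x. x ^ k)" using am by (auto simp: all_moments_def)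
    show "weakly_in_prob M (\<lambda>n \<omega>. scaled_esd n (sym_field_matrix (\<lambda>i j. Z i j \<omega>) n)) \<mu>"
      using ESD_converges[OF am mu] unfolding ESD_def[abs_def] .
    show "moment \<mu> k = 0" if "odd k" for k using that by (auto simp: mu limit_moment_def intro: odd_pos)
    show "moment \<mu> (2 * m) = beta_moment R (2 * m)" if "m \<ge> 1" for m using that by (simp add: mu limit_moment_def)
    fix \<nu> assume nu: "real_distribution \<nu> \<and> (\<forall>k. integrable \<nu> (\<lambda>x. x ^ k) \<and> moment \<nu> k = moment \<mu> k)"
    show "\<nu> = \<mu>"
      by (rule moments_determine[OF _ am _ bd]) (use nu K_pos in \<open>auto simp: all_moments_def\<close>)
  qed
qed

end
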